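(* Let $f$ be a holomorphic cusp form of weight $k$ for $SL_2(\mathbb{Z})$ which is a normalized Hecke eigenform, with $n$-th Fourier coefficient $a_f(n)$, and put $\lambda_f(n)=a_f(n)/n^{(k-1)/2}$. Let $L_f(s)=\sum_{n=1}^\infty \lambda_f(n)n^{-s}$ ($\mathrm{Re}\, s>1$), continued analytically to an entire function, and let $L_f^{(m)}(s)$ be its $m$-th derivative. Let $n_f$ be the smallest integer greater than $1$ such that $\lambda_f(n_f)\neq 0$. For a fixed $m\in\mathbb{Z}_{\geq 1}$ let $N_{f,m}(T)$ be the number of complex zeros of $L_f^{(m)}(s)$ in $0<\mathrm{Im}\, s\leq T$, and let $N_f(T)$ be the number of complex zeros of $L_f(s)$ in $0<\mathrm{Im}\, s\leq T$. Then for any large $T>0$, $$N_{f,m}(T)=\frac{T}{\pi}\log\frac{T}{2\pi e}-\frac{T}{2\pi}\log n_f+O(\log T),$$ and consequently $$N_{f,m}(T)=N_f(T)-\frac{T}{2\pi}\log n_f+O(\log T).$$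
   Context: $L_f(s)$ extends to an entire function satisfying $L_f(s)=\chi_f(s)L_f(1-s)$ with $\chi_f(s)=(-1)^{-k/2}(2\pi)^{2s-1}\Gamma(1-s+\frac{k-1}{2})/\Gamma(s+\frac{k-1}{2})$. It is known (Lekkerkerker) that $N_f(T)=\frac{T}{\pi}\log\frac{T}{2\pi e}+O(\log T)$. Implied constants may depend on $f$ and $m$. *)

theory Defs
  imports "HOL-Complex_Analysis.Complex_Analysis" "HOL-Library.Landau_Symbols"
begin

text \<open>
  Modular forms are functions \<^typ>\<open>complex \<Rightarrow> complex\<close> of which only the values on
  the upper half-plane matter.
\<close>

definition upper_half_plane :: "complex set" where
  "upper_half_plane = {z. Im z > 0}"

definition has_q_expansion :: "(complex \<Rightarrow> complex) \<Rightarrow> (nat \<Rightarrow> complex) \<Rightarrow> bool" where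
  "has_q_expansion f a \<longleftrightarrow>
     (\<forall>z\<in>upper_half_plane. (\<lambda>n. a n * exp (2 * of_real pi * \<i> * of_nat n * z)) sums f z)"

definition fourier_coeff :: "(complex \<Rightarrow> complex) \<Rightarrow> nat \<Rightarrow> complex" where
  "fourier_coeff f = (THE a. has_q_expansion f a)"

text \<open>
  Since T: \<open>z \<mapsto> z + 1\<close> lies in the group, holomorphy at the cusp means that the Fourier expansion
  has no terms of negative index.
\<close>

definition modular_form :: "int \<Rightarrow> (complex \<Rightarrow> complex) \<Rightarrow> bool" where
  "modular_form k f \<longleftrightarrow>
     f holomorphic_on upper_half_plane \<and>
     (\<forall>a b c d :: int. a * d - b * c = 1 \<longrightarrow>
        (\<forall>z\<in>upper_half_plane.
           f ((of_int a * z + of_int b) / (of_int c * z + of_int d)) =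
             (of_int c * z + of_int d) powi k * f z)) \<and>
     (\<exists>a. has_q_expansion f a)"

definition cusp_form :: "int \<Rightarrow> (complex \<Rightarrow> complex) \<Rightarrow> bool" where
  "cusp_form k f \<longleftrightarrow> modular_form k f \<and> fourier_coeff f 0 = 0"

text \<open>
  The Hecke operator $T_n$ in weight $k$:
  $(T_n f)(z) = n^{k-1} \sum_{ad = n} d^{-k} \sum_{0 \le b < d} f((az+b)/d)$.
\<close>

definition hecke_operator ::
  "int \<Rightarrow> nat \<Rightarrow> (complex \<Rightarrow> complex) \<Rightarrow> complex \<Rightarrow> complex" where
  "hecke_operator k n f z =
     of_nat n powi (k - 1) *
       (\<Sum>d | d dvd n. of_nat d powi (- k) *
          (\<Sum>b<d. f ((of_nat (n div d) * z + of_nat b) / of_nat d)))"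

text \<open>
  The normalization $a_f(1) = 1$ forces \<open>f\<close> to be nonzero.
\<close>

definition normalized_hecke_eigenform :: "int \<Rightarrow> (complex \<Rightarrow> complex) \<Rightarrow> bool" where
  "normalized_hecke_eigenform k f \<longleftrightarrow>
     (\<forall>n\<ge>1. \<exists>c. \<forall>z\<in>upper_half_plane. hecke_operator k n f z = c * f z) \<and>
     fourier_coeff f 1 = 1"

definition hecke_lambda :: "int \<Rightarrow> (complex \<Rightarrow> complex) \<Rightarrow> nat \<Rightarrow> complex" where
  "hecke_lambda k f n =
     fourier_coeff f n / of_real (real n powr ((real_of_int k - 1) / 2))"

definition is_entire_L :: "int \<Rightarrow> (complex \<Rightarrow> complex) \<Rightarrow> (complex \<Rightarrow> complex) \<Rightarrow> bool" where
  "is_entire_L k f L \<longleftrightarrow>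
     L holomorphic_on UNIV \<and>
     (\<forall>s. Re s > 1 \<longrightarrow>
        (\<lambda>n. hecke_lambda k f (Suc n) * of_nat (Suc n) powr (- s)) sums L s)"

definition cusp_L :: "int \<Rightarrow> (complex \<Rightarrow> complex) \<Rightarrow> complex \<Rightarrow> complex" where
  "cusp_L k f = (THE L. is_entire_L k f L)"

definition n_min :: "int \<Rightarrow> (complex \<Rightarrow> complex) \<Rightarrow> nat" where
  "n_min k f = (LEAST n. n > 1 \<and> hecke_lambda k f n \<noteq> 0)"

text \<open>
  Zeros are counted with multiplicity. A sum over an infinite set is \<open>0\<close>, so a positive
  value of this count includes the finiteness of the set of zeros.
\<close>

definition zero_count :: "(complex \<Rightarrow> complex) \<Rightarrow> real \<Rightarrow> real" where
  "zero_count g T = (\<Sum>s | g s = 0 \<and> 0 < Im s \<and> Im s \<le> T. real_of_int (zorder g s))"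

text \<open>Uniqueness of the objects selected by the definite descriptions above.\<close>

lemma is_entire_L_unique:
  assumes "is_entire_L k f L" "is_entire_L k f L'"
  shows "L = L'"
proof
  fix w
  let ?S = "{s::complex. Re s > 1}"
  have eq: "L s - L' s = 0" if "s \<in> ?S" for s
    using that assms sums_unique2 unfolding is_entire_L_def by fastforce
  have lim: "(2::complex) islimpt ?S"
    by (rule interior_limit_point) (simp add: interior_open open_halfspace_Re_gt)
  have "(\<lambda>s. L s - L' s) holomorphic_on UNIV"
    using assms unfolding is_entire_L_def by (auto intro!: holomorphic_intros)
  from analytic_continuation[OF this open_UNIV connected_UNIV subset_UNIV UNIV_I lim eq]
  show "L w = L' w" by simp
qed

lemma cusp_L_eqI: "is_entire_L k f L \<Longrightarrow> cusp_L k f = L"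
  unfolding cusp_L_def by (rule the_equality) (auto intro: is_entire_L_unique)

lemma has_q_expansion_unique:
  assumes "has_q_expansion f a" "has_q_expansion f b"
  shows "a = b"
proof -
  have key: "(\<lambda>n. (a n - b n) * q ^ n) sums 0" if q: "q \<noteq> 0" "norm q < 1" for q
  proof -
    define z where "z = Ln q / (2 * of_real pi * \<i>)"
    have "Im z = - Re (Ln q) / (2 * pi)"
      by (simp add: z_def Im_divide power2_eq_square field_simps)
    then have z: "z \<in> upper_half_plane"
      using q by (simp add: upper_half_plane_def divide_neg_pos)
    have ex: "exp (2 * of_real pi * \<i> * of_nat n * z) = q ^ n" for n
    proof -
      have "2 * of_real pi * \<i> * of_nat n * z = of_nat n * Ln q" by (simp add: z_def)
      then have "exp (2 * of_real pi * \<i> * of_nat n * z) = exp (of_nat n * Ln q)" by (rule arg_cong)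
      then show ?thesis using q by (simp add: exp_of_nat_mult)
    qed
    have "(\<lambda>n. a n * q ^ n) sums f z" "(\<lambda>n. b n * q ^ n) sums f z"
      using bspec[OF assms(1)[unfolded has_q_expansion_def] z]
        bspec[OF assms(2)[unfolded has_q_expansion_def] z] by (simp_all only: ex)
    from sums_diff[OF this] show ?thesis by (simp add: algebra_simps)
  qed
  define c where "c = (\<lambda>n. a n - b n)"
  have "c n = 0" for n
  proof (induction n rule: less_induct)
    case (less n)
    have s: "(\<lambda>i. c (i + n) * q ^ i) sums 0" if q: "q \<noteq> 0" "norm q < 1" for q
    proof -
      have "(\<lambda>i. c (i + n) * q ^ (i + n)) sums (0 - (\<Sum>i<n. c i * q ^ i))"
        using key[OF q] unfolding c_def by (subst sums_iff_shift) simp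
      moreover have "(\<Sum>i<n. c i * q ^ i) = 0" using less by simp
      ultimately have "(\<lambda>i. c (i + n) * q ^ i * q ^ n) sums (0 * q ^ n)"
        by (simp add: power_add mult.assoc)
      then show ?thesis using q by (subst (asm) sums_mult2_iff) auto
    qed
    have "((\<lambda>q::complex. 0::complex) \<longlongrightarrow> c (0 + n)) (at 0)"
      by (rule powser_limit_0_strong[of 1]) (use s in auto)
    then show ?case by (simp add: tendsto_const_iff)
  qed
  then show ?thesis by (auto simp: c_def)
qed

lemma fourier_coeff_eqI: "has_q_expansion f a \<Longrightarrow> fourier_coeff f = a"
  unfolding fourier_coeff_def by (rule the_equality) (auto intro: has_q_expansion_unique)

end

theory Submission
  imports Defs "HOL-Real_Asymp.Real_Asymp"
begin

text \<open>
  The zeros of \<open>F = L\<^sup>(\<^sup>m\<^sup>)\<close> in the upper half-plane lie in a vertical strip, and the argument principle counts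
  them: \<open>2 \<pi> N(T)\<close> is the variation of \<open>arg F\<close> along the two vertical sides of the strip, while horizontal
  sides contribute \<open>O(log T)\<close> because \<open>F\<close> grows polynomially (Phragmen-Lindelof) and so has \<open>O(log T)\<close> zeros
  near a given height (Jensen).

  On the right side the Dirichlet series of \<open>F\<close> is dominated by its first nonzero term, which for \<open>m \<ge> 1\<close> has
  index \<open>n\<^sub>f\<close> and gives \<open>arg F = - t log n\<^sub>f + O(1)\<close>. On the left side the functional equation, obtained from
  the Mellin transform of \<open>f\<close>, reads \<open>L(s) = exp (g s) sin (\<pi>(s + \<kappa>))\<close> with \<open>\<kappa> = (k - 1) / 2\<close>, where \<open>g'\<close> tends to
  infinity as \<open>Re s\<close> tends to minus infinity; hence every differentiation essentially multiplies by \<open>g'\<close>, and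
  Stirling's formula gives the argument. The perturbed sine could still vanish slightly above the real
  axis. This is excluded by symmetry: Hecke eigenvalues are real since the Hecke operators are self-adjoint for the
  Petersson product, so zeros come in conjugate pairs, and there is only one zero near each zero
  of the sine.
\<close>

section \<open>Zeros in rectangles\<close>

text \<open>Once 1 / Gamma(s + \<kappa>) has been reflected, the functional equation contains two
  Gamma factors whose arguments descend as s climbs. Each contributes -(t log t - t) + O(log t) to
  arg F; together with (2 pi)^(2 s - 1) they produce (T / pi) log (T / (2 pi e)). The order m of the
  derivative changes only the right side, through the index of the dominating term, so m = 0 is
  covered as well and the second claim is a difference of two counts. The obstacle lies far to the
  left. The perturbed sine has a zero near each of infinitely many real points; if these moved above
  the real axis, the counted set would be infinite and \<open>zero_count\<close> would take its
  default value 0. No bound on the perturbation decides this, which is why realness of the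
  coefficients is proved at such length. Self-adjointness is reduced to one involution: the adjugate
  permutes a finite set of integral matrices, preserves the invariant measure and conjugates the
  integrand. Absolute convergence for Re s > 1 rests on a mean square of the coefficients, which
  follows from boundedness of |f| y^(k/2).\<close>

lemma entire_factor_zero:
  fixes F :: "complex \<Rightarrow> complex"
  assumes F: "F holomorphic_on UNIV" and z: "F \<rho> = 0" and nz: "F s0 \<noteq> 0"
  obtains n G where "n > (0::nat)" "G holomorphic_on UNIV" "G \<rho> \<noteq> 0" "\<And>s. F s = (s - \<rho>) ^ n * G s"
proof -
  have "\<not> F constant_on UNIV" using z nz by (metis UNIV_I constant_on_def)
  then obtain g r n where *: "0 < n" "0 < r" "g holomorphic_on ball \<rho> r"
      "\<And>w. w \<in> ball \<rho> r \<Longrightarrow> F w = (w - \<rho>)^n * g w" "\<And>w. w \<in> ball \<rho> r \<Longrightarrow> g w \<noteq> 0"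
    using holomorphic_factor_zero_nonconstant[OF F open_UNIV connected_UNIV UNIV_I z] by metis
  \<comment> \<open>The two formulas agree on the punctured ball, so the glued quotient is
    entire.\<close>
  define G where "G = (\<lambda>s. if s \<in> ball \<rho> r then g s else F s / (s - \<rho>) ^ n)"
  have "G holomorphic_on ball \<rho> r \<union> (- {\<rho>})"
    unfolding G_def
  proof (rule holomorphic_on_If_Un)
    show "(\<lambda>s. F s / (s - \<rho>) ^ n) holomorphic_on - {\<rho>}"
      by (intro holomorphic_intros holomorphic_on_subset[OF F]) auto
  qed (use * in \<open>auto simp: open_Compl\<close>)
  moreover have "ball \<rho> r \<union> (- {\<rho>}) = UNIV" using * by auto
  ultimately have "G holomorphic_on UNIV" by simp
  moreover have "G \<rho> \<noteq> 0" using * by (simp add: G_def)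
  moreover have "F s = (s - \<rho>) ^ n * G s" for s
    using * by (cases "s \<in> ball \<rho> r") (auto simp: G_def)
  ultimately show ?thesis using that *(1) by blast
qed

text \<open>The condition at \<open>s0\<close> passes to every quotient and keeps it from vanishing
  identically, so each zero has a finite order that can be split off.\<close>

lemma entire_factor_zeros:
  fixes F :: "complex \<Rightarrow> complex"
  assumes "finite A" and F: "F holomorphic_on UNIV" and nz: "F s0 \<noteq> 0" and z: "\<And>\<rho>. \<rho> \<in> A \<Longrightarrow> F \<rho> = 0"
  shows "\<exists>n G. G holomorphic_on UNIV \<and> (\<forall>\<rho>\<in>A. n \<rho> > (0::nat) \<and> G \<rho> \<noteq> 0) \<and>
           (\<forall>s. F s = (\<Prod>\<rho>\<in>A. (s - \<rho>) ^ n \<rho>) * G s)"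
  using assms(1) z
proof (induction A rule: finite_induct)
  case empty
  then show ?case using F by auto
next
  case (insert \<rho> A)
  then obtain n G where G: "G holomorphic_on UNIV" "\<forall>\<rho>\<in>A. n \<rho> > (0::nat) \<and> G \<rho> \<noteq> 0"
     "\<And>s. F s = (\<Prod>\<rho>\<in>A. (s - \<rho>) ^ n \<rho>) * G s" by auto
  have "F \<rho> = 0" using insert by auto
  moreover have "(\<Prod>\<sigma>\<in>A. (\<rho> - \<sigma>) ^ n \<sigma>) \<noteq> 0" using insert by auto
  ultimately have "G \<rho> = 0" using G(3)[of \<rho>] by simp
  moreover have "G s0 \<noteq> 0" using G(3)[of s0] nz by auto
  ultimately obtain m G' where G': "m > (0::nat)" "G' holomorphic_on UNIV" "G' \<rho> \<noteq> 0" "\<And>s. G s = (s - \<rho>) ^ m * G' s"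
    using entire_factor_zero[OF G(1)] by metis
  define n' where "n' = n(\<rho> := m)"
  have 1: "(\<Prod>\<sigma>\<in>insert \<rho> A. (s - \<sigma>) ^ n' \<sigma>) = (s - \<rho>) ^ m * (\<Prod>\<sigma>\<in>A. (s - \<sigma>) ^ n \<sigma>)" for s
  proof -
    have "(\<Prod>\<sigma>\<in>A. (s - \<sigma>) ^ n' \<sigma>) = (\<Prod>\<sigma>\<in>A. (s - \<sigma>) ^ n \<sigma>)"
      using insert by (intro prod.cong) (auto simp: n'_def)
    then show ?thesis using insert by (simp add: n'_def)
  qed
  show ?case
  proof (intro exI conjI allI ballI)
    show "G' holomorphic_on UNIV" by fact
    show "F s = (\<Prod>\<sigma>\<in>insert \<rho> A. (s - \<sigma>) ^ n' \<sigma>) * G' s" for s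
      unfolding 1 by (simp add: G(3) G'(4))
    show "0 < n' \<sigma>" "G' \<sigma> \<noteq> 0" if "\<sigma> \<in> insert \<rho> A" for \<sigma>
      using that G(2) G' by (auto simp: n'_def)
  qed
qed

text \<open>The map w |-> w / (2 M - w) takes the half-plane Re w < M into the unit disc and fixes
  0, so Schwarz's lemma applies to its composition with \<open>g\<close>. On half the radius it
  gives 1/2, which unwinds to 2 M.\<close>

lemma Borel_Caratheodory:
  fixes g :: "complex \<Rightarrow> complex"
  assumes g: "g holomorphic_on ball z0 R" and g0: "g z0 = 0" and R: "R > 0"
    and M: "\<And>z. z \<in> ball z0 R \<Longrightarrow> Re (g z) < M" and z: "z \<in> cball z0 (R / 2)"
  shows "norm (g z) \<le> 2 * M"
proof -
  have M0: "M > 0" using M[of z0] g0 R by simp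
  define h where "h = (\<lambda>w. g (z0 + of_real R * w) / (2 * of_real M - g (z0 + of_real R * w)))"
  have inb: "z0 + of_real R * w \<in> ball z0 R" if "norm w < 1" for w
    using that R by (simp add: dist_norm norm_mult)
  have nz: "2 * of_real M - g (z0 + of_real R * w) \<noteq> 0" if "norm w < 1" for w
    using M[OF inb[OF that]] M0 by (auto simp: complex_eq_iff)
  have lt: "norm (g u) < norm (2 * of_real M - g u)" if "u \<in> ball z0 R" for u
  proof -
    have "(Re (g u))\<^sup>2 < (2 * M - Re (g u))\<^sup>2"
      using M[OF that] M0 by (simp add: power2_eq_square algebra_simps)
    then show ?thesis by (simp add: cmod_def)
  qed
  have "(\<lambda>w. g (z0 + of_real R * w)) holomorphic_on ball 0 1"
    by (rule holomorphic_on_compose_gen[OF _ g, of "\<lambda>w. z0 + of_real R * w" "ball 0 1", unfolded o_def])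
       (use inb in \<open>auto intro!: holomorphic_intros\<close>)
  then have hol: "h holomorphic_on ball 0 1"
    unfolding h_def using nz by (intro holomorphic_intros) auto
  have h0: "h 0 = 0" by (simp add: h_def g0)
  have h1: "norm (h w) < 1" if "norm w < 1" for w
    using lt[OF inb[OF that]] nz[OF that] by (simp add: h_def norm_divide)
  define w where "w = (z - z0) / of_real R"
  have w: "norm w \<le> 1/2" using z R by (simp add: w_def norm_divide dist_norm norm_minus_commute field_simps)
  have zw: "z0 + of_real R * w = z" using R by (simp add: w_def)
  have "norm (h w) \<le> 1/2"
    using Schwarz_Lemma(1)[OF hol h0 h1, of w] w by auto
  then have "2 * norm (g z) \<le> norm (2 * of_real M - g z)"
    using nz[of w] w by (simp add: h_def zw norm_divide divide_simps split: if_splits)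
  also have "\<dots> \<le> 2 * M + norm (g z)"
    using norm_triangle_ineq4[of "2 * of_real M" "g z"] M0 by simp
  finally show ?thesis by simp
qed

text \<open>The imaginary part is the change of arg (s - \<rho>). A horizontal segment that misses
  \<rho> stays on one side of the horizontal line through \<rho>, or on one of its two rays, so a
  zero costs at most \<pi> however close it lies.\<close>

lemma Im_integral_horizontal_inverse:
  assumes ab: "Im a = Im b" and \<rho>: "\<rho> \<notin> closed_segment a b"
  shows "(\<lambda>s. 1 / (s - \<rho>)) contour_integrable_on linepath a b"
    and "\<bar>Im (contour_integral (linepath a b) (\<lambda>s. 1 / (s - \<rho>)))\<bar> \<le> pi"
proof -
  have seg: "Im s = Im a \<and> Re s \<in> closed_segment (Re a) (Re b)" if "s \<in> closed_segment a b" for s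
    using that closed_segment_same_Im[OF ab] by auto
  have seg': "s \<in> closed_segment a b" if "Im s = Im a" "Re s \<in> closed_segment (Re a) (Re b)" for s
    using that closed_segment_same_Im[OF ab] by auto
  have "\<exists>W. (\<forall>s\<in>closed_segment a b. (W has_field_derivative 1 / (s - \<rho>)) (at s)) \<and> \<bar>Im (W b - W a)\<bar> \<le> pi"
  proof -
    consider "Im \<rho> \<noteq> Im a \<or> (\<forall>s\<in>closed_segment a b. Re s > Re \<rho>)" | "Im \<rho> = Im a" "\<forall>s\<in>closed_segment a b. Re s < Re \<rho>"
    proof -
      have "(\<forall>s\<in>closed_segment a b. Re s > Re \<rho>) \<or> (\<forall>s\<in>closed_segment a b. Re s < Re \<rho>)" if "Im \<rho> = Im a"
      proof -
        have "Re \<rho> \<notin> closed_segment (Re a) (Re b)" using seg' \<rho> that by auto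
        then show ?thesis using seg by (fastforce simp: closed_segment_eq_real_ivl split: if_splits)
      qed
      then show ?thesis using that by blast
    qed
    then show ?thesis
    proof cases
      case 1
      have nr: "s - \<rho> \<notin> \<real>\<^sub>\<le>\<^sub>0" if "s \<in> closed_segment a b" for s
        using 1 seg[OF that] that by (auto simp: complex_nonpos_Reals_iff)
      show ?thesis
      proof (intro exI[of _ "\<lambda>s. Ln (s - \<rho>)"] conjI ballI)
        show "((\<lambda>s. Ln (s - \<rho>)) has_field_derivative 1 / (s - \<rho>)) (at s)" if "s \<in> closed_segment a b" for s
          using nr[OF that] by (auto intro!: derivative_eq_intros simp: field_simps)
        have nz: "a - \<rho> \<noteq> 0" "b - \<rho> \<noteq> 0" using \<rho> by auto
        have eq: "Im (a - \<rho>) = Im (b - \<rho>)" using ab by simp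
        show "\<bar>Im (Ln (b - \<rho>) - Ln (a - \<rho>))\<bar> \<le> pi"
        proof (cases "Im (a - \<rho>) < 0")
          case True
          then show ?thesis using mpi_less_Im_Ln[OF nz(1)] mpi_less_Im_Ln[OF nz(2)]
             Im_Ln_pos_le[OF nz(1)] Im_Ln_pos_le[OF nz(2)] Im_Ln_le_pi[OF nz(1)] Im_Ln_le_pi[OF nz(2)] eq
            by (smt (verit) minus_complex.sel(2))
        next
          case False
          then show ?thesis using Im_Ln_le_pi[OF nz(1)] Im_Ln_le_pi[OF nz(2)]
             Im_Ln_pos_le[OF nz(1)] Im_Ln_pos_le[OF nz(2)] eq by auto
        qed
      qed
    next
      \<comment> \<open>Here s - \<rho> runs along the branch cut. \<open>Ln (\<rho> - s)\<close>
        has the same derivative and is real on the segment.\<close>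
      case 2
      have nr: "\<rho> - s \<notin> \<real>\<^sub>\<le>\<^sub>0" if "s \<in> closed_segment a b" for s
        using 2 seg[OF that] that by (auto simp: complex_nonpos_Reals_iff)
      show ?thesis
      proof (intro exI[of _ "\<lambda>s. Ln (\<rho> - s)"] conjI ballI)
        show "((\<lambda>s. Ln (\<rho> - s)) has_field_derivative 1 / (s - \<rho>)) (at s)" if "s \<in> closed_segment a b" for s
          using nr[OF that] nr[OF that] by (auto intro!: derivative_eq_intros simp: field_simps divide_simps)
        have "Im (Ln (\<rho> - x)) = 0" if "x \<in> closed_segment a b" for x
        proof -
          have "\<rho> - x = of_real (Re \<rho> - Re x)" using seg[OF that] 2 by (auto simp: complex_eq_iff)
          moreover have "Ln (complex_of_real (Re \<rho> - Re x)) = of_real (ln (Re \<rho> - Re x))"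
            using 2 that by (intro Ln_of_real) auto
          ultimately show ?thesis by (simp only: Im_complex_of_real)
        qed
        then show "\<bar>Im (Ln (\<rho> - b) - Ln (\<rho> - a))\<bar> \<le> pi" by simp
      qed
    qed
  qed
  then obtain W where W: "\<And>s. s\<in>closed_segment a b \<Longrightarrow> (W has_field_derivative 1 / (s - \<rho>)) (at s)" "\<bar>Im (W b - W a)\<bar> \<le> pi"
    by blast
  have "((\<lambda>s. 1 / (s - \<rho>)) has_contour_integral W b - W a) (linepath a b)"
    using contour_integral_primitive[of "closed_segment a b" W "\<lambda>s. 1 / (s - \<rho>)" "linepath a b"] W(1)
    by (simp add: has_field_derivative_at_within)
  then show "(\<lambda>s. 1 / (s - \<rho>)) contour_integrable_on linepath a b"
    "\<bar>Im (contour_integral (linepath a b) (\<lambda>s. 1 / (s - \<rho>)))\<bar> \<le> pi"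
    using W(2) by (auto simp: contour_integral_unique contour_integrable_on_def)
qed

text \<open>
  Writing \<open>F = F s0 \<cdot> \<Prod>((s - \<rho>) / (s0 - \<rho>)) \<cdot> G\<close> over the zeros in a disc, the maximum principle on the
  disc of four times the radius bounds both the number of zeros and \<open>log |G|\<close> by \<open>ln K\<close>.
\<close>
lemma Im_integral_logderiv_horizontal:
  fixes F :: "complex \<Rightarrow> complex"
  assumes F: "F holomorphic_on UNIV" and R: "R > 0" and nz: "F s0 \<noteq> 0" and K: "K > 1"
    and bd: "\<And>s. s \<in> cball s0 (4 * R) \<Longrightarrow> norm (F s) \<le> K * norm (F s0)"
    and ab: "Im a = Im b" "a \<in> cball s0 (R / 2)" "b \<in> cball s0 (R / 2)"
    and seg: "\<And>s. s \<in> closed_segment a b \<Longrightarrow> F s \<noteq> 0"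
  shows "\<bar>Im (contour_integral (linepath a b) (\<lambda>s. deriv F s / F s))\<bar> \<le> 20 * ln K"
proof -
  define A where "A = {\<rho> \<in> cball s0 R. F \<rho> = 0}"
  have finA: "finite A"
  proof (cases "F constant_on UNIV")
    case True
    then have "F s \<noteq> 0" for s using nz by (auto simp: constant_on_def)
    then show ?thesis by (simp add: A_def)
  next
    case False
    then show ?thesis unfolding A_def
      by (intro holomorphic_compact_finite_zeros[OF F]) auto
  qed
  have "\<exists>n G. G holomorphic_on UNIV \<and> (\<forall>\<rho>\<in>A. n \<rho> > (0::nat) \<and> G \<rho> \<noteq> 0) \<and>
           (\<forall>s. F s = (\<Prod>\<rho>\<in>A. (s - \<rho>) ^ n \<rho>) * G s)"
    by (rule entire_factor_zeros[OF finA F nz]) (simp add: A_def)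
  then obtain n G where G: "G holomorphic_on UNIV" "\<And>\<rho>. \<rho>\<in>A \<Longrightarrow> n \<rho> > (0::nat) \<and> G \<rho> \<noteq> 0"
      and FG: "\<And>s. F s = (\<Prod>\<rho>\<in>A. (s - \<rho>) ^ n \<rho>) * G s"
    by blast
  define N where "N = (\<Sum>\<rho>\<in>A. n \<rho>)"
  define P where "P = (\<lambda>s. (\<Prod>\<rho>\<in>A. (s - \<rho>) ^ n \<rho>))"
  have FP: "F s = P s * G s" for s by (simp add: FG P_def)
  have P0: "P s0 \<noteq> 0" using nz FP by auto
  have G0: "G s0 \<noteq> 0" using nz FP by auto
  \<comment> \<open>Each zero is at distance at most R from \<open>s0\<close> and at least 3 R from
    the circle of radius 4 R. Every linear factor therefore grows at least threefold, and
    \<open>G\<close> gains the factor 3 ^ N.\<close>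
  have K0: "norm (G s) \<le> K * norm (G s0) / 3 ^ N" if "s \<in> cball s0 (4 * R)" for s
  proof (rule maximum_modulus_frontier[of G "cball s0 (4*R)"])
    show "G holomorphic_on interior (cball s0 (4 * R))" using G(1) holomorphic_on_subset by blast
    show "continuous_on (closure (cball s0 (4 * R))) G"
      using G(1) holomorphic_on_imp_continuous_on continuous_on_subset by blast
    show "s \<in> cball s0 (4 * R)" by fact
    fix z assume "z \<in> frontier (cball s0 (4 * R))"
    then have z: "dist s0 z = 4 * R" using R by (simp add: frontier_cball)
    have le: "norm (P s0) * 3 ^ N \<le> norm (P z)"
    proof -
      have "norm (P s0) * 3 ^ N = (\<Prod>\<rho>\<in>A. (3 * norm (s0 - \<rho>)) ^ n \<rho>)"
        by (simp add: P_def N_def prod_norm[symmetric] norm_power power_mult_distrib prod.distrib power_sum)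
      also have "\<dots> \<le> (\<Prod>\<rho>\<in>A. (norm (z - \<rho>)) ^ n \<rho>)"
      proof (intro prod_mono conjI power_mono)
        fix \<rho> assume "\<rho> \<in> A"
        then have *: "norm (s0 - \<rho>) \<le> R" by (simp add: A_def dist_norm)
        have "4 * R = norm ((s0 - \<rho>) - (z - \<rho>))" using z by (simp add: dist_norm)
        also have "\<dots> \<le> norm (s0 - \<rho>) + norm (z - \<rho>)" by (rule norm_triangle_ineq4)
        finally show "3 * norm (s0 - \<rho>) \<le> norm (z - \<rho>)" using * by linarith
      qed auto
      also have "\<dots> = norm (P z)" by (simp add: P_def prod_norm[symmetric] norm_power)
      finally show ?thesis .
    qed
    have "norm (P s0) * 3 ^ N * norm (G z) \<le> norm (P z) * norm (G z)"
      using le by (intro mult_right_mono) auto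
    also have "\<dots> = norm (F z)" by (simp add: FP norm_mult)
    also have "\<dots> \<le> K * norm (F s0)" using bd[of z] z by simp
    also have "\<dots> = norm (P s0) * (K * norm (G s0))" by (simp add: FP norm_mult)
    finally have "3 ^ N * norm (G z) \<le> K * norm (G s0)"
      using P0 by (simp add: mult.assoc)
    then show "norm (G z) \<le> K * norm (G s0) / 3 ^ N" by (simp add: field_simps)
  qed auto
  \<comment> \<open>Evaluation at the centre forces 3 ^ N <= K.\<close>
  have N: "real N \<le> ln K"
  proof -
    have "norm (G s0) \<le> K * norm (G s0) / 3 ^ N" using K0[of s0] R by simp
    then have "3 ^ N \<le> K" using G0 by (simp add: field_simps)
    then have "ln (3 ^ N) \<le> ln K" using K by (subst ln_le_cancel_iff) auto
    then have "real N * ln 3 \<le> ln K" by (simp add: ln_realpow)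
    moreover have "ln (3::real) \<ge> 1" using ln3_gt_1 by simp
    ultimately show ?thesis by (smt (verit) mult_le_cancel_left1 of_nat_0_le_iff mult_left_le)
  qed
  have Gnz: "G s \<noteq> 0" if "s \<in> ball s0 R" for s
  proof
    assume "G s = 0"
    then have "s \<in> A" using FP that by (simp add: A_def)
    then show False using G(2) \<open>G s = 0\<close> by blast
  qed
  have "\<exists>g. g holomorphic_on ball s0 R \<and> (\<forall>s\<in>ball s0 R. exp (g s) = G s / G s0) \<and> g s0 = 0"
  proof -
    have hol: "(\<lambda>s. G s / G s0) holomorphic_on ball s0 R"
      using G0 by (intro holomorphic_intros holomorphic_on_subset[OF G(1)]) auto
    obtain g where g: "g holomorphic_on ball s0 R" "\<And>s. s\<in>ball s0 R \<Longrightarrow> exp (g s) = G s / G s0"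
      using holomorphic_logarithm_exists[OF convex_ball open_ball hol, of s0] Gnz G0 R by auto
    have "exp (g s0) = 1" using g(2)[of s0] R G0 by simp
    then have "exp (g s - g s0) = G s / G s0" if "s \<in> ball s0 R" for s
      using g(2)[OF that] by (simp add: exp_diff)
    moreover have "(\<lambda>s. g s - g s0) holomorphic_on ball s0 R"
      using g by (intro holomorphic_intros)
    ultimately show ?thesis by (intro exI[of _ "\<lambda>s. g s - g s0"]) auto
  qed
  then obtain g where g: "g holomorphic_on ball s0 R" "\<And>s. s\<in>ball s0 R \<Longrightarrow> exp (g s) = G s / G s0" "g s0 = 0"
    by blast
  \<comment> \<open>The true bound is ln K; the factor 2 makes it strict, as the Borel-Caratheodory
    estimate requires.\<close>
  have Reg: "Re (g s) < 2 * ln K" if "s \<in> ball s0 R" for s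
  proof -
    have "exp (Re (g s)) = norm (G s) / norm (G s0)" using g(2)[OF that] norm_exp_eq_Re[of "g s"] by (simp add: norm_divide)
    also have "\<dots> \<le> K / 3 ^ N" using K0[of s] that G0 R by (simp add: field_simps)
    also have "\<dots> \<le> K" using K by (simp add: field_simps)
    finally have "Re (g s) \<le> ln K" using K by (subst ln_ge_iff) auto
    then show ?thesis using K by (smt (verit) ln_gt_zero)
  qed
  have gb: "norm (g s) \<le> 4 * ln K" if "s \<in> cball s0 (R / 2)" for s
    using Borel_Caratheodory[OF g(1,3) R Reg that] by simp
  have sub: "closed_segment a b \<subseteq> cball s0 (R / 2)"
    using ab by (intro closed_segment_subset) auto
  have sub': "closed_segment a b \<subseteq> ball s0 R" using sub R by auto
  have ld: "deriv F s / F s = (\<Sum>\<rho>\<in>A. of_nat (n \<rho>) * (1 / (s - \<rho>))) + deriv g s" if "s \<in> closed_segment a b" for s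
  proof -
    have s: "s \<in> ball s0 R" using that sub' by auto
    have ne: "s \<noteq> \<rho>" if "\<rho> \<in> A" for \<rho> using seg[OF \<open>s \<in> closed_segment a b\<close>] that by (auto simp: A_def)
    have dg: "(g has_field_derivative deriv g s) (at s)"
      using g(1) s holomorphic_derivI open_ball by blast
    have dP: "(P has_field_derivative P s * (\<Sum>\<rho>\<in>A. of_nat (n \<rho>) * (1 / (s - \<rho>)))) (at s)"
    proof -
      have "(P has_field_derivative P s * (\<Sum>\<rho>\<in>A. (of_nat (n \<rho>) * (s - \<rho>) ^ (n \<rho> - 1)) / (s - \<rho>) ^ n \<rho>)) (at s)"
        unfolding P_def
        by (rule has_field_derivative_prod') (use ne in \<open>auto intro!: derivative_eq_intros\<close>)
      also have "(\<Sum>\<rho>\<in>A. (of_nat (n \<rho>) * (s - \<rho>) ^ (n \<rho> - 1)) / (s - \<rho>) ^ n \<rho>) = (\<Sum>\<rho>\<in>A. of_nat (n \<rho>) * (1 / (s - \<rho>)))"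
      proof (rule sum.cong)
        fix \<rho> assume r: "\<rho> \<in> A"
        then have "(s - \<rho>) ^ n \<rho> = (s - \<rho>) * (s - \<rho>) ^ (n \<rho> - 1)"
          using G(2)[OF r] by (metis power_minus_mult mult.commute)
        then show "(of_nat (n \<rho>) * (s - \<rho>) ^ (n \<rho> - 1)) / (s - \<rho>) ^ n \<rho> = of_nat (n \<rho>) * (1 / (s - \<rho>))"
          using ne[OF r] by simp
      qed simp
      finally show ?thesis .
    qed
    have "((\<lambda>s. P s * (G s0 * exp (g s))) has_field_derivative
        P s * (\<Sum>\<rho>\<in>A. of_nat (n \<rho>) * (1 / (s - \<rho>))) * (G s0 * exp (g s)) + P s * (G s0 * (exp (g s) * deriv g s))) (at s)"
      by (rule derivative_eq_intros dP dg refl | simp)+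
    then have "(F has_field_derivative
        P s * (\<Sum>\<rho>\<in>A. of_nat (n \<rho>) * (1 / (s - \<rho>))) * (G s0 * exp (g s)) + P s * (G s0 * (exp (g s) * deriv g s))) (at s)"
      by (rule has_field_derivative_transform_within_open[OF _ open_ball s]) (use g(2) G0 FP in auto)
    then have "deriv F s = P s * (\<Sum>\<rho>\<in>A. of_nat (n \<rho>) * (1 / (s - \<rho>))) * (G s0 * exp (g s)) + P s * (G s0 * (exp (g s) * deriv g s))"
      by (rule DERIV_imp_deriv)
    also have "\<dots> = F s * ((\<Sum>\<rho>\<in>A. of_nat (n \<rho>) * (1 / (s - \<rho>))) + deriv g s)"
      using g(2)[OF s] G0 by (simp add: FP algebra_simps)
    finally show ?thesis using seg[OF that] by simp
  qed
  have ig: "(deriv g has_contour_integral g b - g a) (linepath a b)"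
    using contour_integral_primitive[of "ball s0 R" g "deriv g" "linepath a b"] g(1) sub'
    by (simp add: has_field_derivative_at_within holomorphic_derivI[OF _ open_ball])
  have nin: "\<rho> \<notin> closed_segment a b" if "\<rho> \<in> A" for \<rho> using seg that by (auto simp: A_def)
  have "((\<lambda>s. (\<Sum>\<rho>\<in>A. of_nat (n \<rho>) * (1 / (s - \<rho>))) + deriv g s) has_contour_integral
      (\<Sum>\<rho>\<in>A. of_nat (n \<rho>) * contour_integral (linepath a b) (\<lambda>s. 1 / (s - \<rho>))) + (g b - g a)) (linepath a b)"
    using Im_integral_horizontal_inverse(1)[OF ab(1) nin]
    by (intro has_contour_integral_add ig has_contour_integral_sum finA has_contour_integral_lmul)
       (auto intro: has_contour_integral_integral)
  then have "contour_integral (linepath a b) (\<lambda>s. deriv F s / F s) =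
      (\<Sum>\<rho>\<in>A. of_nat (n \<rho>) * contour_integral (linepath a b) (\<lambda>s. 1 / (s - \<rho>))) + (g b - g a)" (is "?I = ?J")
    using ld by (subst contour_integral_eq[where g = "\<lambda>s. (\<Sum>\<rho>\<in>A. of_nat (n \<rho>) * (1 / (s - \<rho>))) + deriv g s"])
      (auto intro: contour_integral_unique)
  then have "Im ?I = (\<Sum>\<rho>\<in>A. real (n \<rho>) * Im (contour_integral (linepath a b) (\<lambda>s. 1 / (s - \<rho>)))) + Im (g b - g a)"
    by simp
  also have "\<bar>\<dots>\<bar> \<le> (\<Sum>\<rho>\<in>A. \<bar>real (n \<rho>) * Im (contour_integral (linepath a b) (\<lambda>s. 1 / (s - \<rho>)))\<bar>) + \<bar>Im (g b - g a)\<bar>"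
    by (intro order_trans[OF abs_triangle_ineq] add_mono sum_abs order_refl)
  also have "\<dots> \<le> (\<Sum>\<rho>\<in>A. real (n \<rho>) * pi) + 8 * ln K"
  proof (intro add_mono sum_mono)
    show "\<bar>real (n \<rho>) * Im (contour_integral (linepath a b) (\<lambda>s. 1 / (s - \<rho>)))\<bar> \<le> real (n \<rho>) * pi" if "\<rho> \<in> A" for \<rho>
      using Im_integral_horizontal_inverse(2)[OF ab(1) nin[OF that]] by (simp add: abs_mult mult_left_mono)
    have "\<bar>Im (g b - g a)\<bar> \<le> norm (g b) + norm (g a)"
      using abs_Im_le_cmod[of "g b - g a"] norm_triangle_ineq4[of "g b" "g a"] by linarith
    then show "\<bar>Im (g b - g a)\<bar> \<le> 8 * ln K" using gb[OF ab(2)] gb[OF ab(3)] by linarith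
  qed
  also have "(\<Sum>\<rho>\<in>A. real (n \<rho>) * pi) = real N * pi" by (simp add: N_def sum_distrib_right)
  also have "real N * pi \<le> ln K * 4"
    using N pi_less_4 by (intro mult_mono) (auto simp: K less_imp_le)
  \<comment> \<open>At most \<pi> < 4 for each of at most ln K zeros, and 8 ln K from the two values
    of \<open>g\<close>: in total 12 ln K.\<close>
  also have "ln K * 4 + 8 * ln K \<le> 20 * ln K" using K by (simp add: less_imp_le)
  finally show ?thesis by simp
qed

text \<open>\<open>Q\<close> and \<open>P\<close> serve as logarithms of F along the two vertical
  lines, so their increments are the vertical integrals. \<open>gr\<close> and \<open>low\<close>
  feed the estimate on the top side, carried out in a disc of radius 8 (\<beta> - \<alpha>) about
  \<beta> + i T. Continuity of \<open>p\<close> and \<open>q\<close> settles those heights that meet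
  a zero, as limits from above.\<close>

lemma zero_count_asymp:
  fixes F Q P :: "complex \<Rightarrow> complex" and p q :: "real \<Rightarrow> real"
  assumes F: "F holomorphic_on UNIV" and ab: "\<alpha> < \<beta>" and t0: "t0 > 0"
    and zf: "\<And>s. F s = 0 \<Longrightarrow> Im s > 0 \<Longrightarrow> \<alpha> < Re s \<and> Re s < \<beta>"
    and Q: "\<And>t. t \<ge> t0 \<Longrightarrow> (Q has_field_derivative deriv F (Complex \<alpha> t) / F (Complex \<alpha> t)) (at (Complex \<alpha> t))"
    and P: "\<And>t. t \<ge> t0 \<Longrightarrow> (P has_field_derivative deriv F (Complex \<beta> t) / F (Complex \<beta> t)) (at (Complex \<beta> t))"
    and gr: "\<And>s. Im s \<ge> t0 \<Longrightarrow> \<bar>Re s - \<beta>\<bar> \<le> 8 * (\<beta> - \<alpha>) \<Longrightarrow> norm (F s) \<le> C * Im s ^ n"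
    and low: "\<And>t. t \<ge> t0 \<Longrightarrow> norm (F (Complex \<beta> t)) \<ge> c" and c: "c > 0"
    and q: "(\<lambda>t. Im (Q (Complex \<alpha> t)) - q t) \<in> O[at_top](\<lambda>t. ln t)" and contq: "\<And>t. t > t0 \<Longrightarrow> isCont q t"
    and p: "(\<lambda>t. Im (P (Complex \<beta> t)) - p t) \<in> O[at_top](\<lambda>t. ln t)" and contp: "\<And>t. t > t0 \<Longrightarrow> isCont p t"
  shows "(\<lambda>T. zero_count F T - (p T - q T) / (2 * pi)) \<in> O[at_top](\<lambda>T. ln T)"
proof -
  define Z where "Z = (\<lambda>T. {s. F s = 0 \<and> 0 < Im s \<and> Im s \<le> T})"
  have nc: "\<not> F constant_on UNIV" if "s \<in> Z T" for s T
  proof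
    assume "F constant_on UNIV"
    moreover have "F s = 0" using that by (simp add: Z_def)
    ultimately have "F (Complex \<beta> t0) = 0" by (metis UNIV_I constant_on_def)
    then show False using low[of t0] c by simp
  qed
  have finZ: "finite (Z T)" for T
  proof (cases "Z T = {}")
    case False
    then have "finite {z \<in> cbox (Complex \<alpha> 0) (Complex \<beta> T). F z = 0}"
      using nc by (intro holomorphic_compact_finite_zeros[OF F]) auto
    moreover have "Z T \<subseteq> {z \<in> cbox (Complex \<alpha> 0) (Complex \<beta> T). F z = 0}"
      using zf by (force simp: Z_def in_cbox_complex_iff)
    ultimately show ?thesis by (rule rev_finite_subset)
  qed simp
  have zc: "zero_count F T = (\<Sum>s\<in>Z T. real_of_int (zorder F s))" for T
    by (simp add: zero_count_def Z_def)
  \<comment> \<open>A bottom side that avoids the finitely many zeros; it contributes a constant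
    only.\<close>
  obtain t1 where t1: "t0 < t1" "t1 < t0 + 1" "\<And>s. F s = 0 \<Longrightarrow> Im s \<noteq> t1"
  proof -
    have "infinite {t0<..<t0+1}" by simp
    moreover have "finite (Im ` Z (t0 + 1))" using finZ by simp
    ultimately obtain t where t: "t \<in> {t0<..<t0+1}" "t \<notin> Im ` Z (t0 + 1)"
      by (meson finite_subset subsetI)
    have "Im s \<noteq> t" if "F s = 0" for s
    proof
      assume "Im s = t"
      then have "s \<in> Z (t0 + 1)" using t that t0 by (simp add: Z_def)
      then show False using t \<open>Im s = t\<close> by auto
    qed
    then show ?thesis using that t by auto
  qed
  have Fnz: "F (Complex \<alpha> t) \<noteq> 0 \<and> F (Complex \<beta> t) \<noteq> 0" if "t > 0" for t
    using zf[of "Complex \<alpha> t"] zf[of "Complex \<beta> t"] that by auto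
  define LD where "LD = (\<lambda>s. deriv F s / F s)"
  have dF: "deriv F holomorphic_on UNIV" using F by (simp add: holomorphic_deriv)
  have ctg: "LD contour_integrable_on linepath a b" if "\<And>s. s \<in> closed_segment a b \<Longrightarrow> F s \<noteq> 0" for a b
    unfolding LD_def using that
    by (intro contour_integrable_continuous_linepath continuous_intros
        holomorphic_on_imp_continuous_on holomorphic_on_subset[OF F] holomorphic_on_subset[OF dF]) auto
  define Ib where "Ib = contour_integral (linepath (Complex \<alpha> t1) (Complex \<beta> t1)) LD"
  have main: "zero_count F T = zero_count F t1 + (1 / (2 * pi)) * (Im Ib
     + (Im (P (Complex \<beta> T)) - Im (P (Complex \<beta> t1))) + Im (contour_integral (linepath (Complex \<beta> T) (Complex \<alpha> T)) LD)
     + (Im (Q (Complex \<alpha> t1)) - Im (Q (Complex \<alpha> T))))"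
    if T: "T > t1" "\<And>s. F s = 0 \<Longrightarrow> Im s \<noteq> T" for T
  proof -
    let ?r = "rectpath (Complex \<alpha> t1) (Complex \<beta> T)"
    \<comment> \<open>A bounded open box around the rectangle, so that the argument principle sees
      finitely many zeros. Those outside the rectangle have winding number 0.\<close>
    define B where "B = box (Complex (\<alpha> - 1) 0) (Complex (\<beta> + 1) (T + 1))"
    define pz where "pz = {w\<in>B. F w = 0 \<or> w \<in> {}}"
    have pz: "pz \<subseteq> Z (T + 1)" by (auto simp: pz_def B_def Z_def in_box_complex_iff)
    have seg: "F s \<noteq> 0" if "s \<in> path_image ?r" for s
      using that T t1 t0 ab zf[of s] by (subst (asm) path_image_rectpath) auto
    have *: "contour_integral ?r (\<lambda>x. deriv F x * 1 / F x) = 2 * pi * \<i> *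
          (\<Sum>w\<in>pz. winding_number ?r w * 1 * zorder F w)"
      unfolding pz_def
    proof (rule argument_principle)
      show "F holomorphic_on B - {}" using F holomorphic_on_subset by blast
      show "path_image ?r \<subseteq> B - {w \<in> B. F w = 0 \<or> w \<in> {}}"
      proof
        fix x assume x: "x \<in> path_image ?r"
        have "x \<in> cbox (Complex \<alpha> t1) (Complex \<beta> T)"
          using path_image_rectpath_subset_cbox[of "Complex \<alpha> t1" "Complex \<beta> T"] x T ab by auto
        then show "x \<in> B - {w \<in> B. F w = 0 \<or> w \<in> {}}"
          using seg[OF x] t1 t0 by (simp add: B_def in_box_complex_iff in_cbox_complex_iff)
      qed
      show "finite {w \<in> B. F w = 0 \<or> w \<in> {}}"
        using pz finZ finite_subset unfolding pz_def by blast
      show "\<forall>z. z \<notin> B \<longrightarrow> winding_number ?r z = 0"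
      proof (intro allI impI)
        fix z assume "z \<notin> B"
        then show "winding_number ?r z = 0"
          using T t1 t0 ab by (intro winding_number_rectpath_outside) (auto simp: B_def in_box_complex_iff in_cbox_complex_iff)
      qed
    qed (auto simp: B_def convex_connected)
    have "(\<Sum>w\<in>pz. winding_number ?r w * 1 * zorder F w) = (\<Sum>w\<in>pz. if t1 < Im w \<and> Im w \<le> T then of_int (zorder F w) else 0)"
    proof (intro sum.cong refl)
      fix w assume w: "w \<in> pz"
      then have z: "F w = 0" "Im w > 0" by (auto simp: pz_def B_def in_box_complex_iff)
      have re: "\<alpha> < Re w" "Re w < \<beta>" using zf[OF z] by auto
      have ne: "Im w \<noteq> t1" "Im w \<noteq> T" using t1 T z by auto
      show "winding_number ?r w * 1 * zorder F w = (if t1 < Im w \<and> Im w \<le> T then of_int (zorder F w) else 0)"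
      proof (cases "t1 < Im w \<and> Im w \<le> T")
        case True
        then have "winding_number ?r w = 1"
          using re ne by (intro winding_number_rectpath) (auto simp: in_box_complex_iff)
        then show ?thesis using True by simp
      next
        case False
        then have "winding_number ?r w = 0"
          using re ne T ab by (intro winding_number_rectpath_outside) (auto simp: in_cbox_complex_iff)
        then show ?thesis using False by auto
      qed
    qed
    also have "\<dots> = (\<Sum>w\<in>{w\<in>pz. t1 < Im w \<and> Im w \<le> T}. of_int (zorder F w))"
      using finite_subset[OF pz finZ] by (intro sum.inter_filter[symmetric])
    also have "{w\<in>pz. t1 < Im w \<and> Im w \<le> T} = Z T - Z t1"
      using zf t1 t0 T by (fastforce simp: pz_def Z_def B_def in_box_complex_iff)
    also have "(\<Sum>w\<in>Z T - Z t1. of_int (zorder F w)) = complex_of_real (\<Sum>w\<in>Z T - Z t1. real_of_int (zorder F w))"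
      by simp
    also have "(\<Sum>w\<in>Z T - Z t1. real_of_int (zorder F w)) = zero_count F T - zero_count F t1"
      unfolding zc using T by (intro sum_diff finZ) (auto simp: Z_def)
    finally have I1: "contour_integral ?r LD = 2 * pi * \<i> * of_real (zero_count F T - zero_count F t1)"
      using * by (simp add: LD_def)
    have pim: "path_image ?r = closed_segment (Complex \<alpha> t1) (Complex \<beta> t1) \<union> closed_segment (Complex \<beta> t1) (Complex \<beta> T)
       \<union> closed_segment (Complex \<beta> T) (Complex \<alpha> T) \<union> closed_segment (Complex \<alpha> T) (Complex \<alpha> t1)"
      by (simp add: rectpath_def Let_def path_image_join Un_assoc)
    have right: "(LD has_contour_integral P (Complex \<beta> T) - P (Complex \<beta> t1)) (linepath (Complex \<beta> t1) (Complex \<beta> T))"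
    proof -
      have "(P has_field_derivative LD s) (at s)" if "s \<in> closed_segment (Complex \<beta> t1) (Complex \<beta> T)" for s
      proof -
        have "s = Complex \<beta> (Im s)" "Im s \<ge> t0" using that T t1
          by (auto simp: closed_segment_same_Re closed_segment_eq_real_ivl complex_eq_iff)
        then show ?thesis using P[of "Im s"] by (simp add: LD_def)
      qed
      then show ?thesis
        using contour_integral_primitive[of "closed_segment (Complex \<beta> t1) (Complex \<beta> T)" P LD "linepath (Complex \<beta> t1) (Complex \<beta> T)"]
        by (simp add: has_field_derivative_at_within)
    qed
    have left: "(LD has_contour_integral Q (Complex \<alpha> t1) - Q (Complex \<alpha> T)) (linepath (Complex \<alpha> T) (Complex \<alpha> t1))"
    proof -
      have "(Q has_field_derivative LD s) (at s)" if "s \<in> closed_segment (Complex \<alpha> T) (Complex \<alpha> t1)" for s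
      proof -
        have "s = Complex \<alpha> (Im s)" "Im s \<ge> t0" using that T t1
          by (auto simp: closed_segment_same_Re closed_segment_eq_real_ivl complex_eq_iff)
        then show ?thesis using Q[of "Im s"] by (simp add: LD_def)
      qed
      then show ?thesis
        using contour_integral_primitive[of "closed_segment (Complex \<alpha> T) (Complex \<alpha> t1)" Q LD "linepath (Complex \<alpha> T) (Complex \<alpha> t1)"]
        by (simp add: has_field_derivative_at_within)
    qed
    have cb: "LD contour_integrable_on linepath (Complex \<alpha> t1) (Complex \<beta> t1)"
      and ct: "LD contour_integrable_on linepath (Complex \<beta> T) (Complex \<alpha> T)"
      using seg pim by (auto intro!: ctg)
    have "(LD has_contour_integral (Ib + ((P (Complex \<beta> T) - P (Complex \<beta> t1)) +
       (contour_integral (linepath (Complex \<beta> T) (Complex \<alpha> T)) LD + (Q (Complex \<alpha> t1) - Q (Complex \<alpha> T)))))) ?r"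
      unfolding rectpath_def Let_def complex.sel Ib_def
      by (intro has_contour_integral_join right left has_contour_integral_integral cb ct valid_path_join valid_path_linepath) auto
    then have "2 * pi * \<i> * of_real (zero_count F T - zero_count F t1) = Ib + ((P (Complex \<beta> T) - P (Complex \<beta> t1)) +
       (contour_integral (linepath (Complex \<beta> T) (Complex \<alpha> T)) LD + (Q (Complex \<alpha> t1) - Q (Complex \<alpha> T))))"
      using I1 contour_integral_unique by metis
    from arg_cong[OF this, of Im] show ?thesis by (simp add: field_simps)
  qed
  obtain M1 where M1: "eventually (\<lambda>t. \<bar>Im (Q (Complex \<alpha> t)) - q t\<bar> \<le> M1 * \<bar>ln t\<bar>) at_top"
    using q by (auto elim!: landau_o.bigE)
  obtain M2 where M2: "eventually (\<lambda>t. \<bar>Im (P (Complex \<beta> t)) - p t\<bar> \<le> M2 * \<bar>ln t\<bar>) at_top"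
    using p by (auto elim!: landau_o.bigE)
  \<comment> \<open>Upper bound over lower bound: |F| on the disc is at most D T^n times its value
    at the centre. The power of 2 comes from Im s <= 2 T, and the summand 2 ensures D T^n >
    1.\<close>
  define D where "D = \<bar>C\<bar> * 2 ^ n / c + 2"
  have D2: "D \<ge> 2" using c by (simp add: D_def)
  have top: "\<bar>Im (contour_integral (linepath (Complex \<beta> T) (Complex \<alpha> T)) LD)\<bar> \<le> 20 * (ln D + n * ln T)"
    if T: "T \<ge> t0 + 8 * (\<beta> - \<alpha>) + 1" "\<And>s. F s = 0 \<Longrightarrow> Im s \<noteq> T" for T
  proof -
    have T1: "T \<ge> 1" "T \<ge> t0" "T > 0" using T t0 ab by auto
    have K: "D * T ^ n > 1"
    proof -
      have "1 \<le> T ^ n" using T1 by simp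
      then have "2 * 1 \<le> D * T ^ n" using D2 by (intro mult_mono) auto
      then show ?thesis by simp
    qed
    have "\<bar>Im (contour_integral (linepath (Complex \<beta> T) (Complex \<alpha> T)) (\<lambda>s. deriv F s / F s))\<bar> \<le> 20 * ln (D * T ^ n)"
    \<comment> \<open>With this R, the radius R / 2 just reaches the left corner, while 4 R is the
      distance up to which \<open>gr\<close> controls F.\<close>
    proof (rule Im_integral_logderiv_horizontal[OF F, where R = "2 * (\<beta> - \<alpha>)" and ?s0.0 = "Complex \<beta> T"])
      show "F (Complex \<beta> T) \<noteq> 0" using Fnz T1 by simp
      fix s assume s: "s \<in> cball (Complex \<beta> T) (4 * (2 * (\<beta> - \<alpha>)))"
      have 1: "\<bar>Re s - \<beta>\<bar> \<le> 8 * (\<beta> - \<alpha>)" "\<bar>Im s - T\<bar> \<le> 8 * (\<beta> - \<alpha>)"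
        using s abs_Re_le_cmod[of "s - Complex \<beta> T"] abs_Im_le_cmod[of "s - Complex \<beta> T"]
        by (auto simp: dist_norm norm_minus_commute)
      then have 2: "Im s \<ge> t0" "Im s \<le> 2 * T" using T t0 by auto
      have "norm (F s) \<le> C * Im s ^ n" using gr 1 2 by auto
      also have "\<dots> \<le> \<bar>C\<bar> * (2 * T) ^ n" using 2 t0 by (intro mult_mono power_mono) auto
      also have "\<dots> = (\<bar>C\<bar> * 2 ^ n / c) * T ^ n * c" using c by (simp add: power_mult_distrib)
      also have "\<dots> \<le> D * T ^ n * norm (F (Complex \<beta> T))"
        using c low[of T] T1 by (intro mult_mono) (auto simp: D_def)
      finally show "norm (F s) \<le> D * T ^ n * norm (F (Complex \<beta> T))" .
    next
      fix s assume "s \<in> closed_segment (Complex \<beta> T) (Complex \<alpha> T)"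
      then have "Im s = T" by (simp add: closed_segment_same_Im)
      then show "F s \<noteq> 0" using T by auto
    next
      show "Complex \<alpha> T \<in> cball (Complex \<beta> T) (2 * (\<beta> - \<alpha>) / 2)"
        using ab by (simp add: dist_norm cmod_def)
    qed (use ab K in auto)
    then show ?thesis using D2 T1 by (simp add: LD_def ln_mult ln_realpow)
  qed
  define c0 where "c0 = \<bar>zero_count F t1\<bar> + \<bar>Im Ib\<bar> + \<bar>Im (P (Complex \<beta> t1))\<bar> + \<bar>Im (Q (Complex \<alpha> t1))\<bar> + 20 * ln D"
  define M where "M = c0 + 20 * n + \<bar>M1\<bar> + \<bar>M2\<bar>"
  have lnD: "ln D \<ge> 0" using D2 by simp
  have "eventually (\<lambda>T. T \<ge> exp 1 \<and> T \<ge> t0 + 8 * (\<beta> - \<alpha>) + 1 \<and> T > t1 \<and>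
     \<bar>Im (Q (Complex \<alpha> T)) - q T\<bar> \<le> M1 * \<bar>ln T\<bar> \<and> \<bar>Im (P (Complex \<beta> T)) - p T\<bar> \<le> M2 * \<bar>ln T\<bar>) at_top"
    by (intro eventually_conj M1 M2 eventually_ge_at_top eventually_gt_at_top)
  then obtain T0 where T0: "\<And>T. T \<ge> T0 \<Longrightarrow> T \<ge> exp 1 \<and> T \<ge> t0 + 8 * (\<beta> - \<alpha>) + 1 \<and> T > t1 \<and>
     \<bar>Im (Q (Complex \<alpha> T)) - q T\<bar> \<le> M1 * \<bar>ln T\<bar> \<and> \<bar>Im (P (Complex \<beta> T)) - p T\<bar> \<le> M2 * \<bar>ln T\<bar>"
    by (auto simp: eventually_at_top_linorder)
  have bound: "\<bar>zero_count F T - (p T - q T) / (2 * pi)\<bar> \<le> M * ln T" if T: "T \<ge> T0" "\<And>s. F s = 0 \<Longrightarrow> Im s \<noteq> T" for T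
  proof -
    have *: "T \<ge> exp 1" "T \<ge> t0 + 8 * (\<beta> - \<alpha>) + 1" "T > t1"
     "\<bar>Im (Q (Complex \<alpha> T)) - q T\<bar> \<le> M1 * \<bar>ln T\<bar>" "\<bar>Im (P (Complex \<beta> T)) - p T\<bar> \<le> M2 * \<bar>ln T\<bar>"
      using T0[OF T(1)] by auto
    have Tpos: "T > 0" using *(1) exp_gt_zero[of "1::real"] by linarith
    have ln1: "ln T \<ge> 1" using *(1) Tpos by (subst ln_ge_iff) auto
    define It where "It = Im (contour_integral (linepath (Complex \<beta> T) (Complex \<alpha> T)) LD)"
    have It: "\<bar>It\<bar> \<le> 20 * (ln D + n * ln T)" unfolding It_def by (rule top) (use * T in auto)
    define X where "X = (Im Ib - Im (P (Complex \<beta> t1)) + Im (Q (Complex \<alpha> t1))) + It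
         + (Im (P (Complex \<beta> T)) - p T) - (Im (Q (Complex \<alpha> T)) - q T)"
    have "zero_count F T - (p T - q T) / (2 * pi) = zero_count F t1 + (1 / (2 * pi)) * X"
      using main[OF *(3) T(2)] by (simp add: X_def It_def add_divide_distrib diff_divide_distrib)
    also have "\<bar>\<dots>\<bar> \<le> \<bar>zero_count F t1\<bar> + \<bar>X\<bar>"
    proof -
      have "1 / (2 * pi) * \<bar>X\<bar> \<le> 1 * \<bar>X\<bar>" using pi_gt3 by (intro mult_right_mono) (auto simp: field_simps)
      then show ?thesis by (intro order_trans[OF abs_triangle_ineq]) (simp add: abs_mult)
    qed
    also have "\<dots> \<le> c0 + 20 * n * ln T + \<bar>M1\<bar> * ln T + \<bar>M2\<bar> * ln T"
    proof -
      have "M1 * \<bar>ln T\<bar> \<le> \<bar>M1\<bar> * ln T" "M2 * \<bar>ln T\<bar> \<le> \<bar>M2\<bar> * ln T"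
        using ln1 by (auto intro!: mult_right_mono)
      moreover have "\<bar>X\<bar> \<le> \<bar>Im Ib\<bar> + \<bar>Im (P (Complex \<beta> t1))\<bar> + \<bar>Im (Q (Complex \<alpha> t1))\<bar> + \<bar>It\<bar>
          + \<bar>Im (P (Complex \<beta> T)) - p T\<bar> + \<bar>Im (Q (Complex \<alpha> T)) - q T\<bar>"
        unfolding X_def by linarith
      ultimately show ?thesis using *(4,5) It unfolding c0_def distrib_left mult.assoc by linarith
    qed
    also have "c0 \<le> c0 * ln T"
      using mult_left_mono[of 1 "ln T" c0] ln1 lnD by (simp add: c0_def)
    finally show ?thesis by (simp add: M_def algebra_simps)
  qed
  \<comment> \<open>Zeros at height T itself are counted, so the count is constant just to the right
    of T; the bound at nearby heights without zeros passes to the limit.\<close>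
  have bound': "\<bar>zero_count F T - (p T - q T) / (2 * pi)\<bar> \<le> M * ln T" if T: "T \<ge> T0" "T > 0" "T > t0" for T
  proof -
    have fin: "finite (Im ` Z (T + 1) \<inter> {T<..})" using finZ by simp
    have "eventually (\<lambda>T'. T' < x) (at_right T)" if "x \<in> Im ` Z (T + 1) \<inter> {T<..}" for x
      using that by (auto simp: eventually_at_right_field)
    then have ev1: "eventually (\<lambda>T'. \<forall>x\<in>Im ` Z (T + 1) \<inter> {T<..}. T' < x) (at_right T)"
      using fin by (simp add: eventually_ball_finite_distrib)
    have ev2: "eventually (\<lambda>T'. T < T' \<and> T' < T + 1) (at_right T)"
      by (simp add: eventually_at_right_field exI[of _ "T + 1"])
    have "eventually (\<lambda>T'. \<bar>zero_count F T - (p T' - q T') / (2 * pi)\<bar> \<le> M * ln T') (at_right T)"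
      using ev1 ev2
    proof eventually_elim
      case (elim T')
      have "Im s \<le> T" if "s \<in> Z T'" for s
      proof (rule ccontr)
        assume "\<not> Im s \<le> T"
        then have "Im s \<in> Im ` Z (T + 1) \<inter> {T<..}" using that elim by (auto simp: Z_def)
        then have "T' < Im s" using elim(1) by blast
        then show False using that by (simp add: Z_def)
      qed
      then have "Z T' = Z T" using elim by (auto simp: Z_def)
      then have "zero_count F T = zero_count F T'" by (simp add: zc)
      moreover have "Im s \<noteq> T'" if "F s = 0" for s using elim that T by (force simp: Z_def)
      ultimately show ?case using bound[of T'] elim T by auto
    qed
    moreover have "((\<lambda>T'. \<bar>zero_count F T - (p T' - q T') / (2 * pi)\<bar>) \<longlongrightarrow> \<bar>zero_count F T - (p T - q T) / (2 * pi)\<bar>) (at_right T)"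
    proof -
      have "(p \<longlongrightarrow> p T) (at_right T)" "(q \<longlongrightarrow> q T) (at_right T)"
        using contp[OF T(3)] contq[OF T(3)] by (auto simp: isCont_def intro: tendsto_within_subset)
      then show ?thesis by (intro tendsto_intros) auto
    qed
    moreover have "((\<lambda>T'. M * ln T') \<longlongrightarrow> M * ln T) (at_right T)"
      using T by (intro tendsto_intros) auto
    ultimately show ?thesis
      by (intro tendsto_le[OF trivial_limit_at_right_real]) auto
  qed
  show ?thesis
  proof (rule bigoI[where c = M])
    have "eventually (\<lambda>T. T \<ge> T0 \<and> T > 0 \<and> T > t0 \<and> T > 1) at_top"
      by (intro eventually_conj eventually_ge_at_top eventually_gt_at_top)
    then show "eventually (\<lambda>T. norm (zero_count F T - (p T - q T) / (2 * pi)) \<le> M * norm (ln T)) at_top"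
      by eventually_elim (use bound' in auto)
  qed
qed

section \<open>Asymptotics of the Gamma function\<close>

text \<open>Both u and 1 + 1 / u lie in the right half-plane, so their arguments add up to less than
  \<pi> in absolute value and no multiple of 2 \<pi> i intervenes.\<close>

lemma Ln_add_1_over:
  assumes "Re u > 0"
  shows "Ln (u + 1) - Ln u = Ln (1 + 1 / u)"
proof -
  have u: "u \<noteq> 0" using assms by auto
  have v: "Re (1 + 1 / u) > 0"
    using assms by (simp add: Re_divide add_pos_nonneg)
  have v0: "1 + 1 / u \<noteq> 0" using v by (metis less_irrefl zero_complex.sel(1))
  have "\<bar>Im (Ln u)\<bar> < pi / 2" using Re_Ln_pos_lt[OF u] assms by simp
  moreover have "\<bar>Im (Ln (1 + 1 / u))\<bar> < pi / 2" using Re_Ln_pos_lt[OF v0] v by simp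
  ultimately have "Ln (u * (1 + 1 / u)) = Ln u + Ln (1 + 1 / u)"
    using u v0 by (intro Ln_times_simple) (auto simp: abs_less_iff)
  moreover have "u * (1 + 1 / u) = u + 1" using u by (simp add: field_simps)
  ultimately show ?thesis by simp
qed

text \<open>Telescoping Ln against the limit formula for Digamma leaves the sum of the
  \<open>a n\<close>, each of order 1 / |z + n|^2. For Re z >= 0 the size of z + n is comparable to
  |z| + n, so the sum is O(1 / |z|).\<close>

lemma Digamma_Ln_bound:
  assumes z: "Re z \<ge> 2"
  shows "norm (Digamma z - Ln z) \<le> 8 / norm z"
proof -
  have z0: "z \<noteq> 0" using z by auto
  have nz: "norm z \<ge> 2" using z complex_Re_le_cmod[of z] by linarith
  define a where "a = (\<lambda>n::nat. Ln (z + of_nat (Suc n)) - Ln (z + of_nat n) - 1 / (z + of_nat n))"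
  have an: "norm (a n) \<le> 4 * (1 / (norm z - 1 + n) - 1 / (norm z - 1 + Suc n))" for n
  proof -
    define u where "u = z + of_nat n"
    have u: "Re u \<ge> 2" using z by (simp add: u_def)
    have nu: "norm u \<ge> 2" using u complex_Re_le_cmod[of u] by linarith
    have c1: "norm (1 / u) \<le> 1 / 2" unfolding norm_divide using nu frac_le[of 1 1 2 "norm u"] by simp
    have sq: "(norm z + n)\<^sup>2 \<le> 2 * (norm u)\<^sup>2"
    proof -
      have "(norm u)\<^sup>2 = (norm z)\<^sup>2 + (real n)\<^sup>2 + 2 * (real n * Re z)"
        unfolding u_def cmod_power2 by (simp add: power2_eq_square algebra_simps)
      moreover have "real n * Re z \<ge> 0" using z by simp
      moreover have "(norm z + n)\<^sup>2 \<le> 2 * ((norm z)\<^sup>2 + (real n)\<^sup>2)"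
        using sum_squares_bound[of "norm z" "real n"] by (simp add: power2_eq_square algebra_simps)
      moreover have "2 * ((norm z)\<^sup>2 + (real n)\<^sup>2) \<le> 2 * (norm u)\<^sup>2" using calculation by simp
      ultimately show ?thesis by (meson order_trans)
    qed
    have "a n = Ln (1 + 1 / u) - 1 / u"
      using Ln_add_1_over[of u] u by (simp add: a_def u_def algebra_simps)
    also have "norm \<dots> \<le> (norm (1 / u))\<^sup>2 / (1 - norm (1 / u))"
      using c1 by (intro Ln_approx_linear) linarith
    also have "\<dots> \<le> (norm (1 / u))\<^sup>2 / (1 / 2)"
      using c1 by (intro divide_left_mono) auto
    also have "\<dots> = 2 / (norm u)\<^sup>2" by (simp add: norm_divide power_divide)
    also have "\<dots> \<le> 4 / (norm z + n)\<^sup>2"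
    proof -
      have "4 / (2 * (norm u)\<^sup>2) \<le> 4 / (norm z + n)\<^sup>2"
        using sq nu nz by (intro divide_left_mono mult_pos_pos zero_less_power add_pos_nonneg) auto
      then show ?thesis by simp
    qed
    \<comment> \<open>The inequality 1 / x^2 <= 1 / (x - 1) - 1 / x makes the sum over n
      telescope.\<close>
    also have "\<dots> \<le> 4 * (1 / (norm z - 1 + n) - 1 / (norm z - 1 + Suc n))"
    proof -
      define x where "x = norm z + n"
      have x: "x \<ge> 2" using nz by (simp add: x_def)
      have "1 / (x - 1) - 1 / x = 1 / (x * (x - 1))" using x by (simp add: field_simps)
      moreover have "1 / x\<^sup>2 \<le> 1 / (x * (x - 1))"
        using x by (intro divide_left_mono mult_pos_pos) (auto simp: power2_eq_square)
      ultimately show ?thesis by (simp add: x_def algebra_simps)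
    qed
    finally show ?thesis .
  qed
  have S: "norm (\<Sum>n<m. a n) \<le> 8 / norm z" for m
  proof -
    have "norm (\<Sum>n<m. a n) \<le> (\<Sum>n<m. 4 * (1 / (norm z - 1 + n) - 1 / (norm z - 1 + Suc n)))"
      by (intro sum_norm_le an)
    also have "\<dots> = 4 * (\<Sum>n<m. 1 / (norm z - 1 + n) - 1 / (norm z - 1 + Suc n))"
      by (rule sum_distrib_left[symmetric])
    also have "\<dots> = 4 * (1 / (norm z - 1 + 0) - 1 / (norm z - 1 + m))"
      using sum_lessThan_telescope'[of "\<lambda>n. 1 / (norm z - 1 + real n)" m] by simp
    also have "\<dots> \<le> 4 * (1 / (norm z - 1))" using nz by simp
    also have "\<dots> \<le> 8 / norm z"
    proof -
      define x where "x = norm z"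
      have "x \<ge> 2" using nz by (simp add: x_def)
      then show ?thesis unfolding x_def[symmetric] by (simp add: field_simps)
    qed
    finally show ?thesis .
  qed
  have S_eq: "(\<Sum>n<m. a n) = Ln (z + of_nat m) - Ln z - (\<Sum>n<m. inverse (z + of_nat n))" for m
  proof -
    have "(\<Sum>n<m. a n) = (\<Sum>n<m. Ln (z + of_nat (Suc n)) - Ln (z + of_nat n)) - (\<Sum>n<m. inverse (z + of_nat n))"
      by (simp add: a_def sum_subtractf inverse_eq_divide)
    then show ?thesis using sum_lessThan_telescope[of "\<lambda>n. Ln (z + of_nat n)" m] by simp
  qed
  have lim: "(\<lambda>m. of_real (ln (real m)) - Ln (z + of_nat m)) \<longlonglongrightarrow> 0"
  proof -
    have "(\<lambda>m. - Ln (1 + z / of_nat m)) \<longlonglongrightarrow> - Ln (1 + 0)"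
      by (intro tendsto_intros lim_const_over_n) (auto simp: complex_nonpos_Reals_iff)
    moreover have "eventually (\<lambda>m. - Ln (1 + z / of_nat m) = of_real (ln (real m)) - Ln (z + of_nat m)) sequentially"
      using eventually_gt_at_top[of 0]
    proof eventually_elim
      case (elim m)
      have "Re z / m \<ge> 0" using z by simp
      then have "Re (1 + z / of_nat m) > 0" by (simp add: Re_divide_of_nat)
      then have "1 + z / of_nat m \<noteq> 0" by (metis less_irrefl zero_complex.sel(1))
      then have "Ln (of_real (real m) * (1 + z / of_nat m)) = of_real (ln (real m)) + Ln (1 + z / of_nat m)"
        using elim Ln_times_of_real[of "real m" "1 + z / of_nat m"] by simp
      moreover have "of_real (real m) * (1 + z / of_nat m) = z + of_nat m" using elim by (simp add: field_simps)
      ultimately show ?case by simp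
    qed
    ultimately show ?thesis by (simp add: tendsto_cong)
  qed
  have "(\<lambda>m. (of_real (ln (real m)) - (\<Sum>n<m. inverse (z + of_nat n))) - Ln z
      - (of_real (ln (real m)) - Ln (z + of_nat m))) \<longlonglongrightarrow> Digamma z - Ln z - 0"
    by (intro tendsto_intros Digamma_LIMSEQ z0 lim)
  then have "(\<lambda>m. \<Sum>n<m. a n) \<longlonglongrightarrow> Digamma z - Ln z"
    by (simp add: S_eq algebra_simps)
  then have "(\<lambda>m. norm (\<Sum>n<m. a n)) \<longlonglongrightarrow> norm (Digamma z - Ln z)"
    by (rule tendsto_norm)
  then show ?thesis by (rule LIMSEQ_le_const2) (use S in auto)
qed

text \<open>Integrated Stirling: \<open>h\<close>, the difference of \<open>ln_Gamma z\<close> and z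
  Ln z - z, has derivative of size O(1 / t) along the line, hence grows by O(log T). The line runs
  downwards because 1 - s does when s climbs.\<close>

lemma Im_ln_Gamma_asymp:
  assumes B: "B \<ge> 2"
  shows "(\<lambda>T. Im (ln_Gamma (Complex B (- T))) + (T * ln T - T)) \<in> O[at_top](\<lambda>T. ln T)"
proof -
  define z where "z = (\<lambda>t. Complex B (- t))"
  define h where "h = (\<lambda>t. ln_Gamma (z t) - (z t * Ln (z t) - z t))"
  have znr: "z t \<notin> \<real>\<^sub>\<le>\<^sub>0" "z t \<noteq> 0" "Re (z t) \<ge> 2" for t
    using B by (auto simp: z_def complex_nonpos_Reals_iff complex_eq_iff)
  have zeq: "z = (\<lambda>t. of_real B - \<i> * of_real t)" by (auto simp: z_def complex_eq_iff)
  have dz: "(z has_vector_derivative - \<i>) (at t)" for t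
    unfolding zeq by (auto intro!: derivative_eq_intros)
  have dh: "(h has_vector_derivative (- \<i> * (Digamma (z t) - Ln (z t)))) (at t)" for t
  proof -
    have "((\<lambda>w. ln_Gamma w - (w * Ln w - w)) has_field_derivative (Digamma (z t) - Ln (z t))) (at (z t))"
      using znr[of t] by (auto intro!: derivative_eq_intros)
    from field_vector_diff_chain_at[OF dz this] show ?thesis by (simp add: h_def o_def)
  qed
  have hb: "norm (h T - h 1) \<le> 8 * ln T" if T: "T > 1" for T
  proof -
    have "norm (h T - h 1) \<le> 8 * ln T - 8 * ln 1"
    proof (rule differentiable_bound_general[where \<phi>' = "\<lambda>t. 8 / t" and f' = "\<lambda>t. - \<i> * (Digamma (z t) - Ln (z t))"])
      show "continuous_on {1..T} h" using dh by (intro continuous_at_imp_continuous_on) (auto intro: has_vector_derivative_continuous)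
      show "continuous_on {1..T} (\<lambda>t. 8 * ln t)" by (intro continuous_intros) auto
      fix t assume t: "1 < t" "t < T"
      show "((\<lambda>t. 8 * ln t) has_vector_derivative 8 / t) (at t)"
        using t by (auto intro!: derivative_eq_intros simp flip: has_real_derivative_iff_has_vector_derivative)
      have "norm (Digamma (z t) - Ln (z t)) \<le> 8 / norm (z t)" using Digamma_Ln_bound znr by blast
      also have "\<dots> \<le> 8 / t"
        using t abs_Im_le_cmod[of "z t"] by (intro divide_left_mono mult_pos_pos) (auto simp: z_def)
      finally show "norm (- \<i> * (Digamma (z t) - Ln (z t))) \<le> 8 / t" by (simp add: norm_mult)
    qed (use T dh in auto)
    then show ?thesis by simp
  qed
  \<comment> \<open>The part B arg z is bounded, and ln |z| differs from ln T by O(1 / T^2)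
    only.\<close>
  have zb: "\<bar>Im (z T * Ln (z T) - z T) + (T * ln T - T)\<bar> \<le> B * pi + B\<^sup>2" if T: "T > 1" for T
  proof -
    have n2: "(norm (z T))\<^sup>2 = T\<^sup>2 + B\<^sup>2" by (simp add: z_def cmod_power2)
    have lo: "norm (z T) \<ge> T" using abs_Im_le_cmod[of "z T"] T by (simp add: z_def)
    have l1: "ln (norm (z T)) - ln T \<ge> 0" using lo T znr(2)[of T] by simp
    have "2 * (ln (norm (z T)) - ln T) = ln ((norm (z T))\<^sup>2 / T\<^sup>2)"
      using lo T znr(2)[of T] by (simp add: ln_div ln_realpow)
    also have "(norm (z T))\<^sup>2 / T\<^sup>2 = 1 + B\<^sup>2 / T\<^sup>2" using T by (simp add: n2 field_simps)
    also have "ln (1 + B\<^sup>2 / T\<^sup>2) \<le> B\<^sup>2 / T\<^sup>2" by (intro ln_add_one_self_le_self) auto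
    finally have "T * (2 * (ln (norm (z T)) - ln T)) \<le> T * (B\<^sup>2 / T\<^sup>2)" using T by (intro mult_left_mono) auto
    also have "\<dots> = B\<^sup>2 / T" using T by (simp add: power2_eq_square)
    also have "\<dots> \<le> B\<^sup>2" using T by (simp add: divide_le_eq mult_le_cancel_left1)
    finally have "2 * (T * (ln (norm (z T)) - ln T)) \<le> B\<^sup>2" by (simp only: mult.left_commute)
    moreover have l3: "T * (ln (norm (z T)) - ln T) \<ge> 0" using l1 T by simp
    ultimately have l2: "T * (ln (norm (z T)) - ln T) \<le> B\<^sup>2" by linarith
    have "\<bar>B * Im (Ln (z T))\<bar> \<le> B * pi"
      using Im_Ln_le_pi[OF znr(2)[of T]] mpi_less_Im_Ln[OF znr(2)[of T]] B by (simp add: abs_mult mult_left_mono)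
    moreover have "Im (z T * Ln (z T) - z T) + (T * ln T - T) = B * Im (Ln (z T)) - T * (ln (norm (z T)) - ln T)"
      using znr(2)[of T] by (simp add: z_def Re_Ln algebra_simps)
    ultimately show ?thesis using l2 l3 by linarith
  qed
  show ?thesis
  proof (rule bigoI[where c = "8 + B * pi + B\<^sup>2 + norm (h 1)"])
    show "eventually (\<lambda>T. norm (Im (ln_Gamma (Complex B (- T))) + (T * ln T - T)) \<le> (8 + B * pi + B\<^sup>2 + norm (h 1)) * norm (ln T)) at_top"
      using eventually_gt_at_top[of "exp 1"]
    proof eventually_elim
      case (elim T)
      have T1: "T > 1" using elim exp_gt_one[of "1::real"] by linarith
      have ln1: "ln T \<ge> 1" using elim T1 by (subst ln_ge_iff) auto
      define E where "E = B * pi + B\<^sup>2 + norm (h 1)"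
      have E: "E \<ge> 0" using B by (simp add: E_def)
      have "Im (ln_Gamma (Complex B (- T))) + (T * ln T - T) = Im (h T - h 1) + Im (h 1) + (Im (z T * Ln (z T) - z T) + (T * ln T - T))"
        by (simp add: h_def z_def)
      then have "\<bar>Im (ln_Gamma (Complex B (- T))) + (T * ln T - T)\<bar> \<le> 8 * ln T + E"
        using abs_Im_le_cmod[of "h T - h 1"] abs_Im_le_cmod[of "h 1"] hb[OF T1] zb[OF T1] by (simp add: E_def)
      also have "\<dots> \<le> 8 * ln T + E * ln T" using mult_left_mono[OF ln1 E] by simp
      finally show ?case using ln1 by (simp add: E_def algebra_simps)
    qed
  qed
qed

section \<open>Growth of the Gamma function and the Phragmen-Lindelof principle\<close>

lemma norm_Gamma_le:
  assumes "Re z > 0"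
  shows "norm (Gamma z) \<le> Gamma (Re z)"
proof -
  have 1: "((\<lambda>t. complex_of_real t powr (z - 1) / of_real (exp t)) has_integral Gamma z) {0..}"
    using Gamma_integral_complex[OF assms] .
  have 2: "((\<lambda>t. t powr (Re z - 1) / exp t) has_integral Gamma (Re z)) {0..}"
    using Gamma_integral_real[OF assms] .
  have "norm (integral {0..} (\<lambda>t. complex_of_real t powr (z - 1) / of_real (exp t))) \<le> integral {0..} (\<lambda>t. t powr (Re z - 1) / exp t)"
    using 1 2 by (intro integral_norm_bound_integral) (auto simp: norm_divide norm_powr_real_powr has_integral_integrable)
  then show ?thesis using 1 2 by (simp add: integral_unique)
qed

lemma norm_sin_complex_le: "norm (sin (w::complex)) \<le> exp \<bar>Im w\<bar>"
proof -
  have "norm (sin w) = norm (exp (\<i> * w) - exp (- (\<i> * w))) / 2"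
    by (simp add: sin_exp_eq norm_divide norm_mult)
  also have "\<dots> \<le> (norm (exp (\<i> * w)) + norm (exp (- (\<i> * w)))) / 2"
    by (intro divide_right_mono norm_triangle_ineq4) auto
  also have "\<dots> \<le> (exp \<bar>Im w\<bar> + exp \<bar>Im w\<bar>) / 2"
    by (intro divide_right_mono add_mono) auto
  finally show ?thesis by simp
qed

lemma norm_pochhammer_ge_1:
  assumes "\<bar>Im z\<bar> \<ge> 1"
  shows "norm (pochhammer (z::complex) n) \<ge> 1"
proof -
  have "1 \<le> norm (z + of_nat i)" for i
    using assms abs_Im_le_cmod[of "z + of_nat i"] by simp
  then have "(\<Prod>i<n. 1) \<le> (\<Prod>i<n. norm (z + of_nat i))" by (intro prod_mono) auto
  then show ?thesis by (simp add: pochhammer_prod prod_norm lessThan_atLeast0)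
qed

text \<open>Shifting z to the left by j multiplies \<open>rGamma\<close> by a Pochhammer product of
  norm at least 1. In the left half-plane the reflection formula leaves a sine, responsible for the
  exponential, and a Gamma value bounded by Gamma on a compact real interval.\<close>

lemma rGamma_exp_bound:
  obtains C where "C > 0" "\<And>z. a \<le> Re z \<Longrightarrow> Re z \<le> b \<Longrightarrow> \<bar>Im z\<bar> \<ge> 1 \<Longrightarrow> norm (rGamma z :: complex) \<le> C * exp (pi * \<bar>Im z\<bar>)"
proof -
  define j where "j = nat \<lceil>\<bar>b\<bar>\<rceil>"
  have j: "b \<le> j" "b \<le> real j" by (auto simp: j_def) linarith+
  have "compact (Gamma ` {1 - b + j..1 - a + j :: real})"
    using j by (intro compact_continuous_image continuous_on_Gamma) (auto simp: nonpos_Ints_def)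
  then have "bounded (Gamma ` {1 - b + j..1 - a + j :: real})" by (rule compact_imp_bounded)
  then obtain C where "\<forall>y\<in>Gamma ` {1 - b + j..1 - a + j :: real}. norm y \<le> C"
    unfolding bounded_iff by blast
  then have C: "\<And>x. x \<in> {1 - b + j..1 - a + j} \<Longrightarrow> \<bar>Gamma x\<bar> \<le> C" by simp
  show thesis
  proof (rule that[of "\<bar>C\<bar> + 1"])
    fix z assume z: "a \<le> Re z" "Re z \<le> b" "\<bar>Im z\<bar> \<ge> 1"
    define w where "w = z - of_nat j"
    have w: "Re w \<le> 0" "Im w = Im z" using z j by (auto simp: w_def)
    have "rGamma w = pochhammer w j * rGamma z" using pochhammer_rGamma[of w j] by (simp add: w_def)
    then have "norm (rGamma w) = norm (pochhammer w j) * norm (rGamma z)" by (simp add: norm_mult)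
    moreover have "1 * norm (rGamma z) \<le> norm (pochhammer w j) * norm (rGamma z)"
      using norm_pochhammer_ge_1[of w j] z w by (intro mult_right_mono) auto
    ultimately have 1: "norm (rGamma z) \<le> norm (rGamma w)" by simp
    have ni: "1 - w \<notin> \<int>\<^sub>\<le>\<^sub>0" using w z by (auto simp: complex_eq_iff elim!: nonpos_Ints_cases)
    then have "rGamma w = Gamma (1 - w) * sin (of_real pi * w) / of_real pi"
    proof -
      have "Gamma (1 - w) \<noteq> 0" using ni by (simp add: Gamma_eq_zero_iff)
      moreover have "rGamma (1 - w) = inverse (Gamma (1 - w))" by (simp add: rGamma_inverse_Gamma)
      ultimately have "rGamma w = (rGamma w * rGamma (1 - w)) * Gamma (1 - w)" by simp
      then show ?thesis by (simp add: rGamma_reflection_complex)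
    qed
    then have "norm (rGamma w) = norm (Gamma (1 - w)) * norm (sin (of_real pi * w)) / pi"
      by (simp add: norm_mult norm_divide)
    also have "\<dots> \<le> norm (Gamma (1 - w)) * norm (sin (of_real pi * w)) / 1"
      using pi_gt3 by (intro divide_left_mono) auto
    also have "\<dots> \<le> (\<bar>C\<bar> + 1) * exp (pi * \<bar>Im z\<bar>)"
    proof -
      have "norm (Gamma (1 - w)) \<le> Gamma (Re (1 - w))" using w by (intro norm_Gamma_le) auto
      also have "\<dots> \<le> C" using C[of "Re (1 - w)"] z by (auto simp: w_def)
      finally have "norm (Gamma (1 - w)) \<le> \<bar>C\<bar> + 1" by simp
      moreover have "norm (sin (of_real pi * w)) \<le> exp (pi * \<bar>Im z\<bar>)"
        using norm_sin_complex_le[of "of_real pi * w"] w by (simp add: abs_mult)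
      ultimately show ?thesis using mult_mono[of "norm (Gamma (1 - w))" "\<bar>C\<bar> + 1"] by simp
    qed
    finally show "norm (rGamma z) \<le> (\<bar>C\<bar> + 1) * exp (pi * \<bar>Im z\<bar>)" using 1 by simp
  qed simp
qed

text \<open>Since |Gamma w| = |Gamma (cnj w)|, the Gamma quotient of the functional equation is
  exactly of polynomial size on vertical lines with integral real part; this is how
  \<open>Lfun_edge_bound\<close> uses it.\<close>

lemma norm_rGamma_mult_Gamma_cnj:
  assumes "w \<notin> \<int>\<^sub>\<le>\<^sub>0"
  shows "norm (rGamma w) * norm (Gamma (cnj w + of_nat n)) = norm (pochhammer (cnj w) n)"
proof -
  have ni: "cnj w \<notin> \<int>\<^sub>\<le>\<^sub>0" using assms by (metis complex_cnj_cnj complex_cnj_of_int nonpos_Ints_cases nonpos_Ints_of_int)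
  have "norm (Gamma w) = norm (Gamma (cnj w))" by (metis cnj_Gamma complex_mod_cnj)
  moreover have "Gamma w \<noteq> 0" using assms by (simp add: Gamma_eq_zero_iff)
  ultimately show ?thesis
    using pochhammer_Gamma[OF ni, of n] by (simp add: norm_divide rGamma_inverse_Gamma norm_inverse norm_mult divide_inverse mult.commute)
qed

text \<open>In the strip exp (\<epsilon> s^2) decays like exp (- \<epsilon> (Im s)^2), which beats
  exponential growth. The maximum principle on a tall rectangle then gives a bound independent of
  its height, and \<epsilon> tends to 0.\<close>

lemma phragmen_lindelof_half_strip:
  fixes F :: "complex \<Rightarrow> complex"
  assumes F: "F holomorphic_on UNIV"
    and growth: "\<And>s. a \<le> Re s \<Longrightarrow> Re s \<le> b \<Longrightarrow> Im s \<ge> 1 \<Longrightarrow> norm (F s) \<le> A * exp (A * Im s)"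
    and edge: "\<And>s. Re s = a \<or> Re s = b \<Longrightarrow> Im s \<ge> 1 \<Longrightarrow> norm (F s) \<le> B * norm s ^ n"
  shows "\<exists>C. \<forall>s. a \<le> Re s \<longrightarrow> Re s \<le> b \<longrightarrow> Im s \<ge> 1 \<longrightarrow> norm (F s) \<le> C * norm s ^ n"
proof -
  define c where "c = \<bar>a\<bar> + \<bar>b\<bar>"
  define C where "C = \<bar>A\<bar> * exp \<bar>A\<bar> + \<bar>B\<bar> + 1"
  have C: "C > 0" by (simp add: C_def add_nonneg_pos)
  have nge: "norm s \<ge> 1" if "Im s \<ge> 1" for s :: complex using that abs_Im_le_cmod[of s] by linarith
  have Re2: "Re (s\<^sup>2) \<le> c\<^sup>2 - (Im s)\<^sup>2" if "a \<le> Re s" "Re s \<le> b" for s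
  proof -
    have "\<bar>Re s\<bar> \<le> c" using that by (auto simp: c_def)
    then have "(Re s)\<^sup>2 \<le> c\<^sup>2" by (metis abs_ge_zero power2_abs power_mono)
    then show ?thesis by (simp add: Re_power2)
  qed
  have key: "norm (F s) / norm s ^ n * exp (\<epsilon> * Re (s\<^sup>2)) \<le> C * exp (\<epsilon> * c\<^sup>2)"
    if e: "\<epsilon> > 0" and s: "a \<le> Re s" "Re s \<le> b" "Im s \<ge> 1" for \<epsilon> s
  proof -
    \<comment> \<open>The rectangle ends at a height \<open>h\<close> where the Gaussian factor
      outweighs |A| exp (|A| h), so its top side obeys the common bound.\<close>
    have "filterlim (\<lambda>h::real. \<epsilon> * h\<^sup>2 - \<bar>A\<bar> * h) at_top at_top" using e by real_asymp
    then have "eventually (\<lambda>h. \<epsilon> * h\<^sup>2 - \<bar>A\<bar> * h \<ge> ln (\<bar>A\<bar> + 1)) at_top"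
      by (simp add: filterlim_at_top)
    then have "eventually (\<lambda>h. \<epsilon> * h\<^sup>2 - \<bar>A\<bar> * h \<ge> ln (\<bar>A\<bar> + 1) \<and> h > Im s) at_top"
      by (intro eventually_conj eventually_gt_at_top)
    then obtain h where h: "\<epsilon> * h\<^sup>2 - \<bar>A\<bar> * h \<ge> ln (\<bar>A\<bar> + 1)" "h > Im s"
      using eventually_happens trivial_limit_at_top_linorder by blast
    define R where "R = cbox (Complex a 1) (Complex b h)"
    define \<Phi> where "\<Phi> = (\<lambda>s. F s / s ^ n * exp (of_real \<epsilon> * s\<^sup>2))"
    have nP: "norm (\<Phi> w) = norm (F w) / norm w ^ n * exp (\<epsilon> * Re (w\<^sup>2))" for w
      by (simp add: \<Phi>_def norm_mult norm_divide norm_power)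
    have sR: "s \<in> R" using s h by (simp add: R_def in_cbox_complex_iff)
    have R1: "a \<le> Re w" "Re w \<le> b" "1 \<le> Im w" "Im w \<le> h" if "w \<in> R" for w
      using that by (auto simp: R_def in_cbox_complex_iff)
    have hol: "\<Phi> holomorphic_on R"
      unfolding \<Phi>_def using R1 by (intro holomorphic_intros holomorphic_on_subset[OF F]) fastforce+
    have "norm (\<Phi> s) \<le> C * exp (\<epsilon> * c\<^sup>2)"
    proof (rule maximum_modulus_frontier[of \<Phi> R])
      show "\<Phi> holomorphic_on interior R" using hol holomorphic_on_subset interior_subset by blast
      show "continuous_on (closure R) \<Phi>" using hol holomorphic_on_imp_continuous_on by (simp add: R_def)
      show "bounded R" by (simp add: R_def)
      show "s \<in> R" by fact
      fix w assume "w \<in> frontier R"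
      then have w: "w \<in> R" "Re w = a \<or> Re w = b \<or> Im w = 1 \<or> Im w = h"
        by (auto simp: R_def frontier_cbox in_cbox_complex_iff in_box_complex_iff)
      have r: "a \<le> Re w" "Re w \<le> b" "1 \<le> Im w" "norm w \<ge> 1" using R1[OF w(1)] nge by auto
      have pw: "norm w ^ n \<ge> 1" using r by simp
      show "norm (\<Phi> w) \<le> C * exp (\<epsilon> * c\<^sup>2)"
      proof (cases "Im w = h")
        case True
        have "norm (F w) / norm w ^ n \<le> \<bar>A\<bar> * exp (\<bar>A\<bar> * h)"
        proof -
          have "norm (F w) / norm w ^ n \<le> norm (F w) / 1" using pw by (intro divide_left_mono) auto
          also have "\<dots> \<le> A * exp (A * Im w)" using growth r by simp
          also have "\<dots> \<le> \<bar>A\<bar> * exp (\<bar>A\<bar> * h)"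
            using True r by (intro mult_mono) (auto intro!: mult_right_mono)
          finally show ?thesis .
        qed
        moreover have "exp (\<epsilon> * Re (w\<^sup>2)) \<le> exp (\<epsilon> * c\<^sup>2 - \<epsilon> * h\<^sup>2)"
          using Re2[OF r(1,2)] e True by (simp add: right_diff_distrib[symmetric])
        ultimately have "norm (\<Phi> w) \<le> \<bar>A\<bar> * exp (\<bar>A\<bar> * h) * exp (\<epsilon> * c\<^sup>2 - \<epsilon> * h\<^sup>2)"
          unfolding nP by (intro mult_mono) auto
        also have "\<dots> = \<bar>A\<bar> * exp (- (\<epsilon> * h\<^sup>2 - \<bar>A\<bar> * h)) * exp (\<epsilon> * c\<^sup>2)"
          by (simp add: exp_add[symmetric] mult.assoc algebra_simps)
        also have "\<dots> \<le> \<bar>A\<bar> * exp (- ln (\<bar>A\<bar> + 1)) * exp (\<epsilon> * c\<^sup>2)"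
          using h by (intro mult_right_mono mult_left_mono) auto
        also have "exp (- ln (\<bar>A\<bar> + 1)) = 1 / (\<bar>A\<bar> + 1)" by (simp add: exp_minus inverse_eq_divide)
        also have "\<bar>A\<bar> * (1 / (\<bar>A\<bar> + 1)) * exp (\<epsilon> * c\<^sup>2) \<le> C * exp (\<epsilon> * c\<^sup>2)"
        proof (rule mult_right_mono)
          have "\<bar>A\<bar> * (1 / (\<bar>A\<bar> + 1)) \<le> 1" by simp
          moreover have "C \<ge> 1" by (simp add: C_def)
          ultimately show "\<bar>A\<bar> * (1 / (\<bar>A\<bar> + 1)) \<le> C" by linarith
        qed simp
        finally show ?thesis .
      next
        case False
        have "norm (F w) \<le> C * norm w ^ n"
        proof (cases "Re w = a \<or> Re w = b")
          case True
          then have "norm (F w) \<le> B * norm w ^ n" using edge r by blast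
          also have "\<dots> \<le> C * norm w ^ n" by (intro mult_right_mono) (auto simp: C_def intro: add_nonneg_nonneg order_trans[of _ "\<bar>B\<bar>"])
          finally show ?thesis .
        next
          case 2: False
          then have "Im w = 1" using w False by auto
          then have "norm (F w) \<le> A * exp A" using growth[of w] r by simp
          also have "\<dots> \<le> \<bar>A\<bar> * exp \<bar>A\<bar>" by (intro mult_mono) auto
          also have "\<dots> \<le> C * 1" by (simp add: C_def)
          also have "\<dots> \<le> C * norm w ^ n" using C pw by (intro mult_left_mono) auto
          finally show ?thesis .
        qed
        then have "norm (F w) / norm w ^ n \<le> C" using pw by (simp add: divide_le_eq)
        moreover have "exp (\<epsilon> * Re (w\<^sup>2)) \<le> exp (\<epsilon> * c\<^sup>2)"
          using Re2[OF r(1,2)] e by (smt (verit) exp_le_cancel_iff mult_left_mono zero_le_power2)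
        ultimately show ?thesis unfolding nP using C by (intro mult_mono) auto
      qed
    qed
    then show ?thesis by (simp add: nP)
  qed
  show ?thesis
  proof (intro exI[of _ C] allI impI)
    fix s assume s: "a \<le> Re s" "Re s \<le> b" "Im s \<ge> 1"
    have "((\<lambda>\<epsilon>. norm (F s) / norm s ^ n * exp (\<epsilon> * Re (s\<^sup>2))) \<longlongrightarrow> norm (F s) / norm s ^ n * exp (0 * Re (s\<^sup>2))) (at_right 0)"
      by (intro tendsto_intros)
    moreover have "((\<lambda>\<epsilon>. C * exp (\<epsilon> * c\<^sup>2)) \<longlongrightarrow> C * exp (0 * c\<^sup>2)) (at_right 0)"
      by (intro tendsto_intros)
    moreover have "eventually (\<lambda>\<epsilon>. norm (F s) / norm s ^ n * exp (\<epsilon> * Re (s\<^sup>2)) \<le> C * exp (\<epsilon> * c\<^sup>2)) (at_right 0)"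
      using eventually_at_right_less[of "0::real"] by eventually_elim (use key s in auto)
    ultimately have "norm (F s) / norm s ^ n * exp (0 * Re (s\<^sup>2)) \<le> C * exp (0 * c\<^sup>2)"
      by (intro tendsto_le[OF trivial_limit_at_right_real])
    moreover have "norm s ^ n > 0" using nge[OF s(3)] by (intro zero_less_power) linarith
    ultimately show "norm (F s) \<le> C * norm s ^ n" by (simp add: divide_le_eq)
  qed
qed

section \<open>Cusp forms of level one\<close>

type_synonym mat2 = "int \<times> int \<times> int \<times> int"

fun mdet :: "mat2 \<Rightarrow> int" where "mdet (p, q, r, s) = p * s - q * r"
fun mob :: "mat2 \<Rightarrow> complex \<Rightarrow> complex" where
  "mob (p, q, r, s) z = (of_int p * z + of_int q) / (of_int r * z + of_int s)"
fun jfac :: "mat2 \<Rightarrow> complex \<Rightarrow> complex" where "jfac (p, q, r, s) z = of_int r * z + of_int s"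

lemma int_pair_eq_0_iff:
  assumes "Im z > 0"
  shows "of_int r * z + of_int s = 0 \<longleftrightarrow> r = 0 \<and> s = 0"
  using assms by (auto simp: complex_eq_iff)

lemma jfac_nonzero: "mdet \<alpha> \<noteq> 0 \<Longrightarrow> Im z > 0 \<Longrightarrow> jfac \<alpha> z \<noteq> 0"
  by (cases \<alpha> rule: mdet.cases) (auto simp: int_pair_eq_0_iff)

lemma Im_mob: "Im (mob \<alpha> z) = of_int (mdet \<alpha>) * Im z / (norm (jfac \<alpha> z))\<^sup>2"
proof (cases \<alpha> rule: mdet.cases)
  case (1 p q r s)
  have "Im ((of_int p * z + of_int q) * cnj (of_int r * z + of_int s)) = of_int (p * s - q * r) * Im z"
    by (simp add: algebra_simps)
  then show ?thesis
    by (simp add: 1 complex_div_cnj[of _ "of_int r * z + of_int s"] Im_divide_of_real del: complex_cnj_add complex_cnj_mult)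
qed

lemma Im_mob_pos: "mdet \<alpha> > 0 \<Longrightarrow> Im z > 0 \<Longrightarrow> Im (mob \<alpha> z) > 0"
  using jfac_nonzero[of \<alpha> z] by (simp add: Im_mob)

lemma finite_int_pairs_le:
  assumes z: "Im z > 0"
  shows "finite {(c, d :: int). norm (of_int c * z + of_int d) \<le> B}"
proof -
  define X where "X = {-\<lceil>B / Im z\<rceil>..\<lceil>B / Im z\<rceil>}"
  define D where "D = B + \<lceil>B / Im z\<rceil> * norm z"
  have "{(c, d :: int). norm (of_int c * z + of_int d) \<le> B} \<subseteq> X \<times> {-\<lceil>D\<rceil>..\<lceil>D\<rceil>}"
  proof (clarify, intro conjI)
    fix c d :: int assume le: "norm (of_int c * z + of_int d) \<le> B"
    have "\<bar>of_int c * Im z\<bar> \<le> B"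
      using abs_Im_le_cmod[of "of_int c * z + of_int d"] le by simp
    then have "\<bar>real_of_int c\<bar> \<le> B / Im z" using z by (simp add: abs_mult field_simps)
    then have c: "\<bar>c\<bar> \<le> \<lceil>B / Im z\<rceil>" by linarith
    have "norm (of_int d :: complex) = norm ((of_int c * z + of_int d) - of_int c * z)" by simp
    also have "\<dots> \<le> B + \<bar>of_int c\<bar> * norm z" using norm_triangle_ineq4[of "of_int c * z + of_int d" "of_int c * z"] le
      by (simp add: norm_mult)
    also have "\<dots> \<le> D" using c unfolding D_def by (intro add_left_mono mult_right_mono) (linarith, simp)
    finally have "\<bar>real_of_int d\<bar> \<le> D" by simp
    then show "c \<in> X" "d \<in> {-\<lceil>D\<rceil>..\<lceil>D\<rceil>}" using c by (auto simp: X_def) linarith+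
  qed
  then show ?thesis by (rule finite_subset) (simp add: X_def)
qed

text \<open>The closed standard fundamental domain of SL_2(Z): both halves of the boundary belong to
  it, so boundary orbits meet it repeatedly.\<close>

definition std_domain :: "complex set" where
  "std_domain = {z. \<bar>Re z\<bar> \<le> 1/2 \<and> norm z \<ge> 1 \<and> Im z > 0}"

text \<open>A convenient weakening of the sharp constant sqrt 3 / 2.\<close>

lemma std_domain_Im: "z \<in> std_domain \<Longrightarrow> Im z \<ge> 1/2"
proof -
  assume z: "z \<in> std_domain"
  have "\<bar>Re z\<bar>\<^sup>2 \<le> (1/2)\<^sup>2" using z by (intro power_mono) (auto simp: std_domain_def)
  moreover have "1 \<le> (Re z)\<^sup>2 + (Im z)\<^sup>2" using z by (simp add: std_domain_def flip: cmod_power2)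
  ultimately have "(Im z)\<^sup>2 \<ge> (1/2)\<^sup>2" by (simp add: power_divide)
  then show ?thesis using z power2_le_imp_le[of "1/2" "Im z"] by (simp add: std_domain_def)
qed

text \<open>
  The bottom row is chosen to minimise \<open>|cz + d|\<close> over all nonzero integer pairs; minimality gives both
  coprimality and \<open>|\<gamma>z| \<ge> 1\<close>.
\<close>
lemma exists_std_domain:
  assumes z: "Im z > 0"
  shows "\<exists>\<gamma>. mdet \<gamma> = 1 \<and> mob \<gamma> z \<in> std_domain"
proof -
  define N where "N = (\<lambda>(c, d). norm (of_int c * z + of_int d :: complex))"
  \<comment> \<open>Finite, and nonempty because (0, 1) has norm 1; pairs outside have norm above 1,
    so a minimum over this set is global.\<close>
  define A where "A = {(c, d :: int). norm (of_int c * z + of_int d) \<le> 1} - {(0, 0)}"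
  have "finite A" using finite_int_pairs_le[OF z] by (simp add: A_def)
  moreover have "(0, 1) \<in> A" by (simp add: A_def)
  ultimately obtain x where x: "x \<in> A" "\<And>y. y \<in> A \<Longrightarrow> N x \<le> N y"
    using ex_is_arg_min_if_finite[of A N] by (fastforce simp: is_arg_min_linorder)
  obtain c d where cd: "x = (c, d)" by (cases x)
  have min: "norm (of_int c * z + of_int d) \<le> norm (of_int c' * z + of_int d')" if "(c', d') \<noteq> (0, 0)" for c' d' :: int
  proof (cases "(c', d') \<in> A")
    case True
    then show ?thesis using x(2)[OF True] by (simp add: N_def cd)
  next
    case False
    then have "norm (of_int c' * z + of_int d') > 1" using that by (auto simp: A_def)
    moreover have "norm (of_int c * z + of_int d) \<le> 1" using x(1) by (auto simp: A_def cd)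
    ultimately show ?thesis by linarith
  qed
  have nz: "(c, d) \<noteq> (0, 0)" using x(1) by (simp add: A_def cd)
  define g where "g = gcd c d"
  have g1: "g = 1"
  proof (rule ccontr)
    assume "g \<noteq> 1"
    moreover have "g > 0" using nz by (auto simp: g_def)
    ultimately have g: "g \<ge> 2" by linarith
    obtain c' d' where c': "c = g * c'" "d = g * d'" unfolding g_def by (meson dvdE gcd_dvd1 gcd_dvd2)
    have "(c', d') \<noteq> (0, 0)" using nz c' by auto
    have "of_int c * z + of_int d = of_int g * (of_int c' * z + of_int d')" by (simp add: c' algebra_simps)
    then have "g * norm (of_int c' * z + of_int d') \<le> norm (of_int c' * z + of_int d')"
      using min[OF \<open>(c', d') \<noteq> (0, 0)\<close>] g by (simp add: norm_mult)
    moreover have "norm (of_int c' * z + of_int d') > 0"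
      using int_pair_eq_0_iff[OF z, of c' d'] \<open>(c', d') \<noteq> (0, 0)\<close> by simp
    ultimately show False using g by (simp add: mult_le_cancel_right1)
  qed
  obtain u v where uv: "u * c + v * d = 1" using bezout_int[of c d] g1 by (auto simp: g_def)
  define w0 where "w0 = mob (v, - u, c, d) z"
  \<comment> \<open>A translation keeps the bottom row, hence its minimality, and brings the real
    part to absolute value at most 1/2.\<close>
  define n where "n = round (Re w0)"
  define \<gamma> where "\<gamma> = (v - n * c, - u - n * d, c, d)"
  have det: "mdet \<gamma> = 1" using uv by (simp add: \<gamma>_def algebra_simps)
  have j0: "of_int c * z + of_int d \<noteq> 0" using int_pair_eq_0_iff[OF z] nz by auto
  have m: "mob \<gamma> z = w0 - of_int n"
    using j0 by (simp add: \<gamma>_def w0_def field_simps)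
  have re: "\<bar>Re (mob \<gamma> z)\<bar> \<le> 1/2"
    using of_int_round_abs_le[of "Re w0"] by (simp add: m n_def abs_minus_commute)
  \<comment> \<open>The top row is a nonzero pair too, so minimality makes the numerator at least as
    large as the denominator.\<close>
  have "(v - n * c, - u - n * d) \<noteq> (0, 0)" using det by (auto simp: \<gamma>_def)
  then have "norm (mob \<gamma> z) \<ge> 1"
    using min[of "v - n * c" "- u - n * d"] j0 by (simp add: \<gamma>_def norm_divide le_divide_eq)
  moreover have "Im (mob \<gamma> z) > 0" using det z by (intro Im_mob_pos) auto
  ultimately show ?thesis using det re by (intro exI[of _ \<gamma>]) (simp add: std_domain_def)
qed

section \<open>Bounds for a cusp form and mean squares of its coefficients\<close>

lemma powr_exp_bounded:
  obtains C :: real where "C > 0" "\<And>y. y \<ge> 1/2 \<Longrightarrow> y powr c * exp (- 2 * pi * y) \<le> C"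
proof -
  have "((\<lambda>y::real. y powr c * exp (- 2 * pi * y)) \<longlongrightarrow> 0) at_top" using pi_gt_zero by real_asymp
  then have "eventually (\<lambda>y::real. y powr c * exp (- 2 * pi * y) < 1) at_top"
    by (rule order_tendstoD) simp
  then obtain Y where Y: "\<And>y. y \<ge> Y \<Longrightarrow> y powr c * exp (- 2 * pi * y) < 1"
    by (auto simp: eventually_at_top_linorder)
  have "compact ((\<lambda>y::real. y powr c * exp (- 2 * pi * y)) ` {1/2..max Y 1})"
    by (intro compact_continuous_image continuous_intros) auto
  then obtain B where "\<forall>x\<in>(\<lambda>y::real. y powr c * exp (- 2 * pi * y)) ` {1/2..max Y 1}. norm x \<le> B"
    using compact_imp_bounded bounded_iff by blast
  then have B: "y powr c * exp (- 2 * pi * y) \<le> B" if "y \<in> {1/2..max Y 1}" for y using that by fastforce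
  show thesis
  proof (rule that[of "\<bar>B\<bar> + 1"])
    show "y powr c * exp (- 2 * pi * y) \<le> \<bar>B\<bar> + 1" if "y \<ge> 1/2" for y
    proof (cases "y \<ge> Y")
      case False
      then have "y \<in> {1/2..max Y 1}" using that by (auto simp: le_max_iff_disj)
      from B[OF this] show ?thesis by linarith
    qed (use Y[of y] in linarith)
  qed simp
qed

text \<open>Orthogonality of the M-th roots of unity. It plays the role of the Parseval integral
  over a period: f is sampled at M equally spaced points of a horizontal line.\<close>

lemma discrete_parseval:
  fixes c :: "nat \<Rightarrow> complex"
  assumes M: "M > 0"
  shows "(\<Sum>j<M. (norm (\<Sum>n<M. c n * cis (2 * pi * real n * real j / real M)))\<^sup>2) = real M * (\<Sum>n<M. (norm (c n))\<^sup>2)"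
proof -
  have orth: "(\<Sum>j<M. cis (2 * pi * real n * real j / real M) * cnj (cis (2 * pi * real m * real j / real M))) = (if n = m then of_nat M else 0)"
    if "n < M" "m < M" for n m
  proof (cases "n = m")
    case True
    then show ?thesis by (simp add: cis_cnj flip: cis_inverse)
  next
    case False
    define x where "x = cis (2 * pi * (real n - real m) / M)"
    have eq: "cis (2 * pi * real n * real j / real M) * cnj (cis (2 * pi * real m * real j / real M)) = x ^ j" for j
      unfolding x_def cis_cnj cis_mult Complex.DeMoivre by (rule arg_cong[of _ _ cis]) (use M in \<open>simp add: field_simps\<close>)
    have "x ^ M = 1"
    proof -
      have "x ^ M = cis (2 * pi * (of_int (int n - int m)))"
        unfolding x_def Complex.DeMoivre by (rule arg_cong[of _ _ cis]) (use M in \<open>simp add: field_simps\<close>)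
      also have "\<dots> = 1" by (rule cis_multiple_2pi) auto
      finally show ?thesis .
    qed
    moreover have "x \<noteq> 1"
    proof
      assume "x = 1"
      then have "cos (2 * pi * (real n - real m) / M) = 1" by (simp add: x_def cis.code complex_eq_iff)
      then obtain i :: int where "2 * pi * (real n - real m) / M = real_of_int i * 2 * pi"
        using cos_one_2pi_int[of "2 * pi * (real n - real m) / M"] by blast
      then have "2 * pi * (real n - real m) = 2 * pi * (i * M)" using M by (simp only: field_simps) (simp add: field_simps)
      then have "real n - real m = i * M" by (subst (asm) mult_cancel_left) simp
      then have "real_of_int (int n - int m) = real_of_int (i * int M)" by simp
      then have e: "int n - int m = i * int M" by (rule of_int_eq_iff[THEN iffD1])
      then have "i \<noteq> 0" using False by auto
      then have "1 * int M \<le> \<bar>i\<bar> * int M" by (intro mult_right_mono) auto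
      then have "\<bar>int n - int m\<bar> \<ge> int M" unfolding e abs_mult by simp
      then show False using that by linarith
    qed
    ultimately show ?thesis using False unfolding eq by (simp add: sum_gp_strict)
  qed
  have sq: "of_real ((norm w)\<^sup>2) = w * cnj w" for w by (rule complex_norm_square)
  have "complex_of_real (\<Sum>j<M. (norm (\<Sum>n<M. c n * cis (2 * pi * real n * real j / real M)))\<^sup>2)
    = (\<Sum>j<M. (\<Sum>n<M. c n * cis (2 * pi * real n * real j / real M)) * cnj (\<Sum>m<M. c m * cis (2 * pi * real m * real j / real M)))"
    by (simp only: of_real_sum sq)
  also have "\<dots> = (\<Sum>j<M. \<Sum>n<M. \<Sum>m<M. c n * cnj (c m) * (cis (2 * pi * real n * real j / real M) * cnj (cis (2 * pi * real m * real j / real M))))"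
    by (simp add: sum_product cnj_sum algebra_simps)
  also have "\<dots> = (\<Sum>n<M. \<Sum>m<M. \<Sum>j<M. c n * cnj (c m) * (cis (2 * pi * real n * real j / real M) * cnj (cis (2 * pi * real m * real j / real M))))"
    by (rule trans[OF sum.swap]) (intro sum.cong refl sum.swap)
  also have "\<dots> = (\<Sum>n<M. \<Sum>m<M. c n * cnj (c m) * (if n = m then of_nat M else 0))"
    by (intro sum.cong refl) (subst sum_distrib_left[symmetric], subst orth, auto)
  also have "\<dots> = (\<Sum>n<M. c n * cnj (c n) * of_nat M)"
    by (intro sum.cong refl) (simp add: if_distrib sum.delta' cong: if_cong)
  also have "\<dots> = complex_of_real (M * (\<Sum>n<M. (norm (c n))\<^sup>2))"
    by (simp add: sq[symmetric] sum_distrib_left mult.commute del: of_real_power)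
  finally show ?thesis by (simp only: of_real_eq_iff)
qed

text \<open>The weight is an arbitrary integer here and its sign is derived in
  \<open>k_nonneg\<close>. The Hecke property enters only with the extension
  \<open>hecke_eigenform\<close>.\<close>

locale level_one_cusp_form =
  fixes k :: int and f :: "complex \<Rightarrow> complex" and a :: "nat \<Rightarrow> complex"
  assumes hol: "f holomorphic_on upper_half_plane"
    and modular: "mdet \<gamma> = 1 \<Longrightarrow> Im z > 0 \<Longrightarrow> f (mob \<gamma> z) = jfac \<gamma> z powi k * f z"
    and q_exp: "has_q_expansion f a"
    and a0: "a 0 = 0"
    and a1: "a 1 = 1"
begin

text \<open>The shift from the variable s, with symmetry about 1/2, to the argument of the Gamma
  factor.\<close>

definition \<kappa> :: real where "\<kappa> = (of_int k - 1) / 2"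
definition lam :: "nat \<Rightarrow> complex" where "lam n = a n / of_real (real n powr \<kappa>)"

lemma exp_q: "exp (2 * of_real pi * \<i> * of_nat n * z) = exp (2 * of_real pi * \<i> * z) ^ n"
  by (simp add: exp_of_nat_mult[symmetric] mult_ac)

lemma f_sums: "Im z > 0 \<Longrightarrow> (\<lambda>n. a n * exp (2 * of_real pi * \<i> * z) ^ n) sums f z"
  using q_exp by (auto simp: has_q_expansion_def upper_half_plane_def exp_q)

text \<open>Convergence of the power series at height y / 2 makes it absolutely convergent at height
  y.\<close>

lemma summable_abs:
  assumes "y > 0"
  shows "summable (\<lambda>n. norm (a n) * exp (- 2 * pi * n * y))"
proof -
  define x where "x = exp (2 * of_real pi * \<i> * (\<i> * of_real (y / 2)))"
  have nx: "norm x = exp (- pi * y)" by (simp add: x_def)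
  have "summable (\<lambda>n. a n * x ^ n)"
    using f_sums[of "\<i> * of_real (y / 2)"] assms by (auto simp: x_def sums_iff)
  then have "summable (\<lambda>n. norm (a n * of_real (exp (- 2 * pi * y)) ^ n))"
    by (rule powser_insidea) (use assms nx in simp)
  also have "(\<lambda>n. norm (a n * of_real (exp (- 2 * pi * y)) ^ n)) = (\<lambda>n. norm (a n) * exp (- 2 * pi * n * y))"
    by (auto simp: norm_mult norm_power exp_of_nat_mult[symmetric] mult_ac fun_eq_iff simp del: of_real_exp)
  finally show ?thesis .
qed

text \<open>As a 0 = 0, every term contains at least the factor exp (- 2 pi (Im z - 1/4)); what is
  left is dominated by the absolutely convergent series at height 1/4.\<close>

lemma f_decay:
  obtains C where "C > 0" "\<And>z. Im z \<ge> 1/2 \<Longrightarrow> norm (f z) \<le> C * exp (- 2 * pi * Im z)"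
proof -
  define S where "S = (\<Sum>n. norm (a n) * exp (- 2 * pi * n * (1/4)))"
  have S0: "S \<ge> 0" unfolding S_def by (intro suminf_nonneg summable_abs) auto
  have "norm (f z) \<le> (S * exp (pi / 2)) * exp (- 2 * pi * Im z)" if z: "Im z \<ge> 1/2" for z
  proof -
    have trm: "norm (a n * exp (2 * of_real pi * \<i> * z) ^ n) \<le> norm (a n) * exp (- 2 * pi * n * (1/4)) * exp (- 2 * pi * (Im z - 1/4))" for n
    proof (cases "n = 0")
      case True
      then show ?thesis by (simp add: a0)
    next
      case False
      have "1 * (Im z - 1/4) \<le> real n * (Im z - 1/4)" using False z by (intro mult_right_mono) auto
      then have "2 * pi * ((Im z - 1/4)) \<le> 2 * pi * (real n * (Im z - 1/4))" by (intro mult_left_mono) auto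
      then have "- 2 * pi * Im z * n \<le> - 2 * pi * n * (1/4) + - 2 * pi * (Im z - 1/4)" by (simp add: algebra_simps)
      then have "exp (- 2 * pi * Im z * n) \<le> exp (- 2 * pi * n * (1/4)) * exp (- 2 * pi * (Im z - 1/4))"
        unfolding exp_add[symmetric] by simp
      moreover have "norm (exp (2 * of_real pi * \<i> * z) ^ n) = exp (- 2 * pi * Im z * n)"
        by (simp add: norm_power exp_of_nat_mult[symmetric] mult_ac)
      ultimately show ?thesis by (simp only: norm_mult mult.assoc) (intro mult_left_mono, auto simp: mult_ac)
    qed
    have sm: "summable (\<lambda>n. norm (a n) * exp (- 2 * pi * n * (1/4)) * exp (- 2 * pi * (Im z - 1/4)))"
      by (intro summable_mult2 summable_abs) simp
    have "norm (f z) = norm (\<Sum>n. a n * exp (2 * of_real pi * \<i> * z) ^ n)"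
      using f_sums[of z] z by (simp add: sums_iff)
    also have "\<dots> \<le> (\<Sum>n. norm (a n) * exp (- 2 * pi * n * (1/4)) * exp (- 2 * pi * (Im z - 1/4)))"
      by (rule norm_suminf_le[OF trm sm])
    also have "\<dots> = S * exp (- 2 * pi * (Im z - 1/4))"
      unfolding S_def by (intro suminf_mult2[symmetric] summable_abs) simp
    also have "\<dots> = S * exp (pi / 2) * exp (- 2 * pi * Im z)"
      by (simp add: mult.assoc exp_add[symmetric] algebra_simps)
    finally show ?thesis .
  qed
  then have "norm (f z) \<le> (S * exp (pi / 2) + 1) * exp (- 2 * pi * Im z)" if z: "Im z \<ge> 1/2" for z
    by (rule order_trans[OF _ mult_right_mono]) (use z in auto)
  moreover have "S * exp (pi / 2) + 1 > 0" using S0 by (intro add_nonneg_pos mult_nonneg_nonneg) auto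
  ultimately show thesis using that by blast
qed

lemma norm_f_mob:
  assumes "mdet \<gamma> = 1" "Im z > 0"
  shows "norm (f (mob \<gamma> z)) * Im (mob \<gamma> z) powr (k / 2) = norm (f z) * Im z powr (k / 2)"
proof -
  define J where "J = norm (jfac \<gamma> z)"
  have J: "J > 0" using jfac_nonzero[of \<gamma> z] assms by (simp add: J_def)
  have "Im (mob \<gamma> z) = Im z / J\<^sup>2" using assms by (simp add: Im_mob J_def)
  also have "\<dots> powr (k / 2) = Im z powr (k / 2) / (J\<^sup>2) powr (k / 2)"
    using assms J by (simp add: powr_divide)
  also have "(J\<^sup>2) powr (k / 2) = J powr k"
  proof -
    have "J\<^sup>2 = J powr 2" using J by simp
    then show ?thesis by (simp only: powr_powr) simp
  qed
  also have "J powr k = J powi k" using J by (subst powr_real_of_int') auto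
  finally show ?thesis using modular[OF assms] J
    by (simp add: norm_mult norm_power_int J_def[symmetric])
qed

text \<open>|f| y^(k/2) is invariant under the modular group, so it only has to be bounded on the
  standard domain, where the cuspidal decay wins against any power of y.\<close>

lemma f_bound:
  obtains C where "C > 0" "\<And>z. Im z > 0 \<Longrightarrow> norm (f z) * Im z powr (k / 2) \<le> C"
proof -
  obtain C1 where C1: "C1 > 0" "\<And>z. Im z \<ge> 1/2 \<Longrightarrow> norm (f z) \<le> C1 * exp (- 2 * pi * Im z)"
    using f_decay by blast
  obtain C2 where C2: "C2 > 0" "\<And>y. y \<ge> 1/2 \<Longrightarrow> y powr (k / 2) * exp (- 2 * pi * y) \<le> C2"
    using powr_exp_bounded by blast
  have "norm (f z) * Im z powr (k / 2) \<le> C1 * C2" if z: "Im z > 0" for z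
  proof -
    obtain \<gamma> where g: "mdet \<gamma> = 1" "mob \<gamma> z \<in> std_domain" using exists_std_domain[OF z] by blast
    define w where "w = mob \<gamma> z"
    have w: "Im w \<ge> 1/2" using std_domain_Im g by (simp add: w_def)
    have "norm (f z) * Im z powr (k / 2) = norm (f w) * Im w powr (k / 2)"
      using norm_f_mob[OF g(1) z] by (simp add: w_def)
    also have "\<dots> \<le> C1 * exp (- 2 * pi * Im w) * Im w powr (k / 2)"
      using C1(2)[OF w] by (intro mult_right_mono) auto
    also have "\<dots> = C1 * (Im w powr (k / 2) * exp (- 2 * pi * Im w))" by simp
    also have "\<dots> \<le> C1 * C2" using C2(2)[OF w] C1 by (intro mult_left_mono) auto
    finally show ?thesis .
  qed
  then show thesis using that[of "C1 * C2"] C1 C2 by simp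
qed

text \<open>Parseval at height y, where |f| <= C y^(-k/2). Truncation of the series to M terms costs
  a tail of \<open>b\<close> that vanishes as M grows.\<close>

lemma sum_norm_a_sq:
  obtains C where "C > 0" "\<And>y N. y > 0 \<Longrightarrow> (\<Sum>n<N. (norm (a n) * exp (- 2 * pi * n * y))\<^sup>2) \<le> C * y powr (- of_int k)"
proof -
  obtain C where C: "C > 0" "\<And>z. Im z > 0 \<Longrightarrow> norm (f z) * Im z powr (k / 2) \<le> C"
    using f_bound by blast
  have "(\<Sum>n<N. (norm (a n) * exp (- 2 * pi * n * y))\<^sup>2) \<le> C\<^sup>2 * y powr (- of_int k)" if y: "y > 0" for y N
  proof -
    define b where "b = (\<lambda>n. norm (a n) * exp (- 2 * pi * n * y))"
    define c where "c = (\<lambda>n. a n * of_real (exp (- 2 * pi * n * y)))"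
    have nc: "norm (c n) = b n" for n by (simp add: b_def c_def norm_mult del: of_real_exp)
    have sb: "summable b" unfolding b_def by (rule summable_abs[OF y])
    define K where "K = C * y powr (- k / 2)"
    have pt: "norm (\<Sum>n<M. c n * cis (2 * pi * real n * real j / real M)) \<le> K + (\<Sum>n. b (n + M))" if M: "M > 0" for M j
    proof -
      define z where "z = of_real (real j / real M) + \<i> * of_real y"
      have Imz: "Im z = y" by (simp add: z_def)
      have ct: "a n * exp (2 * of_real pi * \<i> * z) ^ n = c n * cis (2 * pi * real n * real j / real M)" for n
      proof -
        have "of_nat n * (2 * of_real pi * \<i> * z) = of_real (- 2 * pi * n * y) + \<i> * of_real (2 * pi * real n * real j / real M)"
          by (simp add: z_def algebra_simps)
        then have "exp (2 * of_real pi * \<i> * z) ^ n = of_real (exp (- 2 * pi * n * y)) * cis (2 * pi * real n * real j / real M)"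
          by (simp only: exp_of_nat_mult[symmetric] exp_add cis_conv_exp exp_of_real)
        then show ?thesis by (simp add: c_def mult.assoc)
      qed
      have s: "(\<lambda>n. c n * cis (2 * pi * real n * real j / real M)) sums f z"
        using f_sums[of z] y unfolding ct by (simp add: Imz)
      then have sm: "summable (\<lambda>n. c n * cis (2 * pi * real n * real j / real M))" by (rule sums_summable)
      have "(\<Sum>n<M. c n * cis (2 * pi * real n * real j / real M)) = f z - (\<Sum>n. c (n + M) * cis (2 * pi * real (n + M) * real j / real M))"
        using suminf_minus_initial_segment[OF sm, of M] s by (simp add: sums_iff)
      also have "norm \<dots> \<le> norm (f z) + norm (\<Sum>n. c (n + M) * cis (2 * pi * real (n + M) * real j / real M))"
        by (rule norm_triangle_ineq4)
      also have "norm (f z) \<le> K"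
        using C(2)[of z] y by (simp add: Imz K_def powr_minus field_simps)
      also have "norm (\<Sum>n. c (n + M) * cis (2 * pi * real (n + M) * real j / real M)) \<le> (\<Sum>n. b (n + M))"
        using sb by (intro norm_suminf_le) (auto simp: norm_mult nc summable_iff_shift)
      finally show ?thesis by simp
    qed
    have le: "(\<Sum>n<N. (b n)\<^sup>2) \<le> (K + (\<Sum>n. b (n + M)))\<^sup>2" if M: "M \<ge> N" "M > 0" for M
    proof -
      have "(\<Sum>n<N. (b n)\<^sup>2) \<le> (\<Sum>n<M. (b n)\<^sup>2)" using M by (intro sum_mono2) auto
      also have "M * (\<Sum>n<M. (b n)\<^sup>2) = (\<Sum>j<M. (norm (\<Sum>n<M. c n * cis (2 * pi * real n * real j / real M)))\<^sup>2)"
        using discrete_parseval[OF M(2), of c] by (simp add: nc)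
      also have "\<dots> \<le> (\<Sum>j<M. (K + (\<Sum>n. b (n + M)))\<^sup>2)"
        using pt[OF M(2)] by (intro sum_mono power_mono) auto
      also have "\<dots> = M * (K + (\<Sum>n. b (n + M)))\<^sup>2" by simp
      finally show ?thesis using M by simp
    qed
    have "(\<lambda>M. (K + (\<Sum>n. b (n + M)))\<^sup>2) \<longlonglongrightarrow> (K + 0)\<^sup>2"
      by (intro tendsto_intros suminf_exist_split2 sb)
    then have "(\<Sum>n<N. (b n)\<^sup>2) \<le> (K + 0)\<^sup>2"
      by (rule LIMSEQ_le_const) (use le in \<open>auto intro!: exI[of _ "Suc N"]\<close>)
    also have "(K + 0)\<^sup>2 = C\<^sup>2 * y powr (- of_int k)"
      using y by (simp add: K_def power_mult_distrib powr_powr flip: powr_realpow)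
    finally show ?thesis by (simp add: b_def)
  qed
  then show thesis using that[of "C\<^sup>2"] C by simp
qed

text \<open>For negative k the mean square bound would tend to 0 with y, while the term of index 1
  alone tends to 1.\<close>

lemma k_nonneg: "k \<ge> 0"
proof (rule ccontr)
  assume k: "\<not> k \<ge> 0"
  obtain C where C: "C > 0" "\<And>y N. y > 0 \<Longrightarrow> (\<Sum>n<N. (norm (a n) * exp (- 2 * pi * n * y))\<^sup>2) \<le> C * y powr (- of_int k)"
    using sum_norm_a_sq by blast
  have le: "(exp (- 2 * pi * y))\<^sup>2 \<le> C * y powr (- of_int k)" if "y > 0" for y
    using C(2)[OF that, of "Suc (Suc 0)"] by (simp add: a0 a1[unfolded One_nat_def] lessThan_Suc)
  have "((\<lambda>y. (exp (- 2 * pi * y))\<^sup>2) \<longlongrightarrow> (exp (- 2 * pi * 0))\<^sup>2) (at_right 0)"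
    by (intro tendsto_intros)
  moreover have "((\<lambda>y. C * y powr (- of_int k)) \<longlongrightarrow> C * 0 powr (- of_int k)) (at_right 0)"
    using k by (intro tendsto_intros tendsto_powr') (auto simp: eventually_at_right_less eventually_at_filter)
  moreover have "eventually (\<lambda>y. (exp (- 2 * pi * y))\<^sup>2 \<le> C * y powr (- of_int k)) (at_right 0)"
    using eventually_at_right_less[of "0::real"] by eventually_elim (use le in auto)
  ultimately have "(exp (- 2 * pi * 0))\<^sup>2 \<le> C * 0 powr (- of_int k)"
    by (intro tendsto_le[OF trivial_limit_at_right_real])
  then show False by simp
qed

lemma kappa_ge: "\<kappa> \<ge> - 1/2" using k_nonneg by (simp add: \<kappa>_def)

text \<open>Otherwise f z = exp (2 pi i z), and modularity between i y and i / y would equate a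
  quantity tending to 1 with one tending to 0. This makes the minimum defining n_f
  meaningful.\<close>

lemma exists_lam_nonzero: "\<exists>n>1. lam n \<noteq> 0"
proof (rule ccontr)
  assume *: "\<not> (\<exists>n>1. lam n \<noteq> 0)"
  have an: "a n = (if n = 1 then 1 else 0)" for n
    using * a0 a1 by (cases "n = 0"; cases "n = 1") (auto simp: lam_def)
  have fz: "f z = exp (2 * of_real pi * \<i> * z)" if "Im z > 0" for z
  proof -
    have "(\<lambda>n. a n * exp (2 * of_real pi * \<i> * z) ^ n) = (\<lambda>n. if n = 1 then exp (2 * of_real pi * \<i> * z) ^ n else 0)"
      by (auto simp: an)
    then have "(\<lambda>n. a n * exp (2 * of_real pi * \<i> * z) ^ n) sums exp (2 * of_real pi * \<i> * z) ^ 1"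
      using sums_single[of 1 "\<lambda>n. exp (2 * of_real pi * \<i> * z) ^ n"] by simp
    then show ?thesis using f_sums[OF that] sums_unique2 by fastforce
  qed
  have eq: "exp (- 2 * pi / y) = y powr of_int k * exp (- 2 * pi * y)" if y: "y > 0" for y
  proof -
    have m: "mob (0, -1, 1, 0) (\<i> * of_real y) = \<i> * of_real (1 / y)" using y by (simp add: divide_simps)
    have "norm (f (\<i> * of_real (1 / y))) = norm (\<i> * of_real y) powi k * norm (f (\<i> * of_real y))"
      using modular[of "(0, -1, 1, 0)" "\<i> * of_real y"] y unfolding m by (simp add: norm_mult norm_power_int)
    moreover have "y powi k = y powr of_int k" using y by (subst powr_real_of_int') auto
    ultimately show ?thesis using y by (simp add: fz norm_mult)
  qed
  have lim0: "((\<lambda>y. y powr of_int k * exp (- 2 * pi * y)) \<longlongrightarrow> 0) at_top" by real_asymp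
  have "((\<lambda>y. exp (- 2 * pi / y)) \<longlongrightarrow> 1) at_top" by real_asymp
  moreover have "eventually (\<lambda>y. exp (- 2 * pi / y) = y powr of_int k * exp (- 2 * pi * y)) at_top"
    using eventually_gt_at_top[of 0] by eventually_elim (use eq in auto)
  ultimately have "((\<lambda>y. y powr of_int k * exp (- 2 * pi * y)) \<longlongrightarrow> 1) at_top"
    by (subst (asm) tendsto_cong)
  with lim0 show False using tendsto_unique[OF trivial_limit_at_top_linorder] by fastforce
qed

lemma lam_1: "lam (Suc 0) = 1" using a1 by (simp add: lam_def)

text \<open>The mean square with y = 1 / N bounds the sum of |a n|^2 over n < N by a multiple of
  N^k. Dyadic blocks give convergence of the sum of |lam n|^2 n^(-\<sigma>), and |lam n| <= 1 + |lam
  n|^2 passes to first powers.\<close>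

lemma summable_lam:
  assumes \<sigma>: "\<sigma> > 1"
  shows "summable (\<lambda>n. norm (lam n) * real n powr (- \<sigma>))"
proof -
  obtain C where C: "C > 0" "\<And>y N. y > 0 \<Longrightarrow> (\<Sum>n<N. (norm (a n) * exp (- 2 * pi * n * y))\<^sup>2) \<le> C * y powr (- of_int k)"
    using sum_norm_a_sq by blast
  define C' where "C' = C * exp (4 * pi)"
  have C'0: "C' > 0" using C by (simp add: C'_def)
  \<comment> \<open>For n < N the damping exp (- 4 pi n / N) is at least exp (- 4 pi), which is the
    constant absorbed into \<open>C'\<close>.\<close>
  have part: "(\<Sum>n<N. (norm (a n))\<^sup>2) \<le> C' * N powr (of_int k)" if N: "N > 0" for N
  proof -
    have "(\<Sum>n<N. (norm (a n))\<^sup>2) \<le> (\<Sum>n<N. exp (4 * pi) * (norm (a n) * exp (- 2 * pi * n * (1 / N)))\<^sup>2)"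
    proof (intro sum_mono)
      fix n assume n: "n \<in> {..<N}"
      have "real n / N \<le> 1" using n by simp
      then have "4 * pi * (real n / N) \<le> 4 * pi * 1" by (intro mult_left_mono) auto
      then have "1 \<le> exp (4 * pi + (- 2 * pi * n * (1 / N) + - 2 * pi * n * (1 / N)))" by simp
      then have "1 \<le> exp (4 * pi) * (exp (- 2 * pi * n * (1 / N)))\<^sup>2"
        unfolding exp_add power2_eq_square .
      then have "(norm (a n))\<^sup>2 * 1 \<le> (norm (a n))\<^sup>2 * (exp (4 * pi) * (exp (- 2 * pi * n * (1 / N)))\<^sup>2)"
        by (intro mult_left_mono) auto
      then show "(norm (a n))\<^sup>2 \<le> exp (4 * pi) * (norm (a n) * exp (- 2 * pi * n * (1 / N)))\<^sup>2"
        by (simp add: power_mult_distrib mult_ac)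
    qed
    also have "\<dots> \<le> exp (4 * pi) * (C * (1 / N) powr (- of_int k))"
      using C(2)[of "1 / N" N] N by (simp add: sum_distrib_left[symmetric])
    also have "(1 / N) powr (- of_int k) = N powr (of_int k)" using N by (simp add: powr_divide powr_minus_divide)
    finally show ?thesis by (simp add: C'_def mult_ac)
  qed
  \<comment> \<open>Chosen so that |a n|^2 n^(-e) equals |lam n|^2 n^(-\<sigma>); it is positive
    because k >= 0. The ratio \<open>r\<close> below governs consecutive dyadic blocks.\<close>
  define e where "e = of_int k - 1 + \<sigma>"
  have e0: "e > 0" using \<sigma> k_nonneg by (simp add: e_def)
  define r where "r = (2::real) powr (- (\<sigma> - 1))"
  have "r < 2 powr (0 :: real)" unfolding r_def using \<sigma> by (intro powr_less_mono) auto
  then have r: "0 < r" "r < 1" by (auto simp: r_def)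
  define b where "b = (\<lambda>n. (norm (a n))\<^sup>2 * real n powr (- e))"
  have blk: "(\<Sum>n=2^j..<2^(j+1). b n) \<le> C' * 2 powr of_int k * r ^ j" for j :: nat
  proof -
    have "(\<Sum>n=2^j..<2^(j+1). b n) \<le> (\<Sum>n=2^j..<2^(j+1). (norm (a n))\<^sup>2 * (2 ^ j) powr (- e))"
      unfolding b_def using e0 by (intro sum_mono mult_left_mono powr_mono2') (auto simp flip: of_nat_power)
    also have "\<dots> \<le> (\<Sum>n<2^(j+1). (norm (a n))\<^sup>2) * (2 ^ j) powr (- e)"
      unfolding sum_distrib_right[symmetric] by (intro mult_right_mono sum_mono2) auto
    also have "\<dots> \<le> C' * real (2^(j+1)) powr (of_int k) * (2 ^ j) powr (- e)"
      using part[of "2^(j+1)"] by (intro mult_right_mono) auto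
    also have "\<dots> = C' * (2 powr of_int k * r ^ j)"
    proof -
      have "real (2^(j+1)) powr (of_int k) * (2 ^ j) powr (- e) = 2 powr ((j + 1) * of_int k - j * e)"
      proof -
        have "real (2^(j+1)) = 2 powr (real j + 1)" "(2::real) ^ j = 2 powr real j"
          by (simp_all add: powr_add powr_realpow)
        then show ?thesis by (simp only: powr_powr powr_add[symmetric]) (simp add: algebra_simps)
      qed
      also have "(j + 1) * of_int k - j * e = of_int k + (- (\<sigma> - 1)) * j" by (simp add: e_def algebra_simps)
      also have "2 powr \<dots> = 2 powr of_int k * r ^ j"
        unfolding powr_add r_def by (simp add: powr_powr flip: powr_realpow)
      finally show ?thesis by (simp add: mult.assoc)
    qed
    finally show ?thesis by (simp add: mult.assoc)
  qed
  have pow2: "(\<Sum>n<2^J. b n) \<le> b 0 + C' * 2 powr of_int k * (\<Sum>j<J. r ^ j)" for J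
  proof (induction J)
    case 0
    then show ?case by simp
  next
    case (Suc J)
    have "(\<Sum>n<2^(Suc J). b n) = (\<Sum>n<2^J. b n) + (\<Sum>n=2^J..<2^(J+1). b n)"
      using sum.atLeastLessThan_concat[of 0 "2^J" "2^(J+1)" b] by (simp add: lessThan_atLeast0)
    then show ?case using Suc blk[of J] by (simp add: algebra_simps)
  qed
  have bs: "summable b"
  proof (rule summableI_nonneg_bounded)
    show "b n \<ge> 0" for n by (simp add: b_def)
    fix n
    have "(\<Sum>i<n. b i) \<le> (\<Sum>i<2^n. b i)"
      by (intro sum_mono2) (auto simp: b_def less_exp intro: less_trans)
    also have "\<dots> \<le> b 0 + C' * 2 powr of_int k * (\<Sum>j<n. r ^ j)" by (rule pow2)
    also have "\<dots> \<le> b 0 + C' * 2 powr of_int k * (1 / (1 - r))"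
    proof -
      have "(\<Sum>j<n. r ^ j) \<le> (\<Sum>j. r ^ j)" using r by (intro sum_le_suminf summable_geometric) auto
      also have "\<dots> = 1 / (1 - r)" using r by (intro suminf_geometric) auto
      finally show ?thesis using C'0 by (intro add_left_mono mult_left_mono) auto
    qed
    finally show "(\<Sum>i<n. b i) \<le> b 0 + C' * 2 powr of_int k * (1 / (1 - r))" .
  qed
  have "summable (\<lambda>n. real n powr (- \<sigma>))"
    using \<sigma> by (simp add: summable_real_powr_iff)
  then have "summable (\<lambda>n. real n powr (- \<sigma>) + b n)" using bs by (rule summable_add)
  then show ?thesis
  proof (rule summable_comparison_test'[where N = 1])
    fix n :: nat assume n: "n \<ge> 1"
    define l where "l = norm (lam n)"
    have "2 * l \<le> l\<^sup>2 + 1" using sum_squares_bound[of l 1] by simp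
    moreover have "0 \<le> l\<^sup>2" by simp
    ultimately have "l \<le> 1 + l\<^sup>2" by linarith
    then have "l * real n powr (- \<sigma>) \<le> (1 + l\<^sup>2) * real n powr (- \<sigma>)" by (intro mult_right_mono) auto
    also have "l\<^sup>2 * real n powr (- \<sigma>) = b n"
    proof -
      have "l\<^sup>2 = (norm (a n))\<^sup>2 / real n powr (of_int k - 1)"
      proof -
        have "\<kappa> + \<kappa> = of_int k - 1" by (simp add: \<kappa>_def field_simps)
        then have "(real n powr \<kappa>)\<^sup>2 = real n powr (of_int k - 1)" by (simp add: power2_eq_square flip: powr_add)
        then show ?thesis by (simp add: l_def lam_def norm_divide power_divide)
      qed
      then show ?thesis using n by (simp add: b_def e_def powr_diff powr_add powr_minus divide_inverse mult_ac)
    qed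
    then have "(1 + l\<^sup>2) * real n powr (- \<sigma>) = real n powr (- \<sigma>) + b n" by (simp add: algebra_simps)
    finally show "norm (norm (lam n) * real n powr (- \<sigma>)) \<le> real n powr (- \<sigma>) + b n"
      by (simp add: l_def)
  qed
qed

end

section \<open>The completed L-function\<close>

lemma integrable_exp_minus_abs: "integrable lborel (\<lambda>u::real. exp (- \<bar>u\<bar>))"
proof -
  have "((\<lambda>x::real. exp (- 1 * x)) has_integral exp (- 1 * 0) / 1) {0..}"
    by (rule has_integral_exp_minus_to_infinity) simp
  then have "(\<lambda>x::real. exp (- 1 * x)) absolutely_integrable_on {0..}"
    by (intro nonnegative_absolutely_integrable_1) (auto simp: has_integral_integrable)
  then have 1: "integrable lborel (\<lambda>x::real. indicator {0..} x * exp (- x))"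
    unfolding set_integrable_def by (subst (asm) integrable_completion) auto
  have 2: "integrable lborel (\<lambda>x::real. indicator {0..} (- x) * exp x)"
    using lborel_integrable_real_affine[OF 1, of "-1" 0] by simp
  show ?thesis
    by (rule Bochner_Integration.integrable_bound[OF Bochner_Integration.integrable_add[OF 1 2]])
       (auto simp: indicator_def)
qed

text \<open>Euler's integral under t = c exp u. The logarithmic variable turns Mellin integrals into
  integrals over the whole line.\<close>

lemma Gamma_integral_exp:
  fixes w :: complex and c :: real
  assumes w: "Re w > 0" and c: "c > 0"
  shows "has_bochner_integral lborel (\<lambda>u. of_real (exp (- c * exp u)) * exp (of_real u * w)) (of_real c powr (- w) * Gamma w)"
proof -
  let ?f = "\<lambda>t. complex_of_real t powr (w - 1) / of_real (exp t)"
  let ?g = "\<lambda>u. \<bar>c * exp u\<bar> *\<^sub>R ?f (c * exp u)"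
  have img: "(\<lambda>u. c * exp u) ` UNIV = {0<..}"
  proof safe
    fix x :: real assume "0 < x"
    then have "x = c * exp (ln (x / c))" using c by simp
    then show "x \<in> range (\<lambda>u. c * exp u)" by blast
  qed (use c in auto)
  have "?g absolutely_integrable_on UNIV \<and> integral UNIV ?g = Gamma w"
  proof (subst has_absolute_integral_change_of_variables_real[where g = "\<lambda>u. c * exp u"])
    show "((\<lambda>u. c * exp u) has_field_derivative c * exp u) (at u within UNIV)" for u
      by (auto intro!: derivative_eq_intros)
    show "inj (\<lambda>u. c * exp u)" using c by (auto simp: inj_def)
    show "?f absolutely_integrable_on range (\<lambda>u. c * exp u) \<and> integral (range (\<lambda>u. c * exp u)) ?f = Gamma w"
      unfolding img using absolutely_integrable_Gamma_integral'[OF w] Gamma_integral_complex'[OF w]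
      by (simp add: integral_unique)
  qed auto
  moreover have geq: "?g = (\<lambda>u. of_real c powr w * (of_real (exp (- c * exp u)) * exp (of_real u * w)))"
  proof
    fix u
    have L: "Ln (of_real (c * exp u)) = of_real (ln c) + of_real u"
      using c by (subst Ln_of_real) (auto simp: ln_mult)
    have "?g u = of_real (c * exp u) * (of_real (c * exp u) powr (w - 1)) / of_real (exp (c * exp u))"
      using c by (simp add: scaleR_conv_of_real abs_mult)
    also have "of_real (c * exp u) * (of_real (c * exp u) powr (w - 1)) = of_real (c * exp u) powr w"
      using c by (simp add: powr_diff)
    also have "\<dots> = exp (w * (of_real (ln c) + of_real u))"
      using c by (subst powr_def) (simp add: L[symmetric])
    also have "\<dots> = of_real c powr w * exp (of_real u * w)"
      using c by (simp add: powr_def Ln_of_real exp_add[symmetric] algebra_simps)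
    finally show "?g u = of_real c powr w * (of_real (exp (- c * exp u)) * exp (of_real u * w))"
      by (simp add: exp_minus divide_inverse mult_ac)
  qed
  let ?h = "\<lambda>u. of_real (exp (- c * exp u)) * exp (of_real u * w)"
  have hm: "?h \<in> borel_measurable borel"
    by (intro borel_measurable_continuous_onI continuous_intros)
  have cw: "of_real c powr w \<noteq> 0" using c by simp
  have ai: "?g absolutely_integrable_on UNIV" and gi: "integral UNIV ?g = Gamma w" using calculation by auto
  have "integrable lebesgue ?g" using ai by (simp add: set_integrable_def)
  then have "integrable lebesgue (\<lambda>u. inverse (of_real c powr w) * ?g u)" by (rule integrable_mult_right)
  moreover have "inverse (of_real c powr w) * ?g u = ?h u" for u
    unfolding fun_cong[OF geq, of u] mult.assoc[symmetric] using cw by simp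
  ultimately have "integrable lebesgue ?h" by (simp only:)
  then have hi: "integrable lborel ?h" using integrable_completion[of ?h lborel] hm by simp
  have "integral\<^sup>L lborel ?h = integral UNIV ?h"
    by (rule integral_lborel[OF hi, symmetric])
  moreover have "integral UNIV ?g = of_real c powr w * integral UNIV ?h" unfolding geq by simp
  ultimately have "integral\<^sup>L lborel ?h = of_real c powr (- w) * Gamma w"
    using gi cw by (simp add: powr_minus field_simps)
  then show ?thesis using hi by (simp add: has_bochner_integral_iff)
qed

lemma Gamma_integral_exp_real:
  fixes x c :: real
  assumes x: "x > 0" and c: "c > 0"
  shows "has_bochner_integral lborel (\<lambda>u. exp (- c * exp u) * exp (u * x)) (c powr (- x) * Gamma x)"
proof -
  have "has_bochner_integral lborel (\<lambda>u. complex_of_real (exp (- c * exp u) * exp (u * x))) (of_real (c powr (- x) * Gamma x))"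
    using Gamma_integral_exp[of "of_real x" c] x c
    by (simp add: exp_of_real[symmetric] powr_of_real[symmetric] Gamma_complex_of_real)
  then show ?thesis
    by (simp only: has_bochner_integral_iff complex_of_real_integrable_eq integral_complex_of_real of_real_eq_iff)
qed

section \<open>The Mellin transform of a cusp form and its functional equation\<close>

context level_one_cusp_form
begin

text \<open>The form on the imaginary axis in the variable y = exp u, weighted so that z |-> -1 / z
  becomes u |-> - u.\<close>

definition \<phi> :: "real \<Rightarrow> complex" where
  "\<phi> u = f (\<i> * of_real (exp u)) * of_real (exp (u * k / 2))"

text \<open>The completed L-function, that is the integral of f (i y) y^(s + \<kappa>) dy /
  y.\<close>

definition \<Lambda> :: "complex \<Rightarrow> complex" where
  "\<Lambda> s = (LINT u|lborel. \<phi> u * exp (of_real u * (s - 1/2)))"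

text \<open>Dividing by Gamma is written as a product with the entire function
  \<open>rGamma\<close>, so that entireness is immediate.\<close>

definition Lfun :: "complex \<Rightarrow> complex" where
  "Lfun s = of_real (2 * pi) powr (s + of_real \<kappa>) * rGamma (s + of_real \<kappa>) * \<Lambda> s"

lemma phi_minus: "\<phi> (- u) = \<i> powi k * \<phi> u"
proof -
  have m: "mob (0, -1, 1, 0) (\<i> * of_real (exp u)) = \<i> * of_real (exp (- u))"
    by (simp add: exp_minus divide_simps)
  have "f (\<i> * of_real (exp (- u))) = (\<i> * of_real (exp u)) powi k * f (\<i> * of_real (exp u))"
    using modular[of "(0, -1, 1, 0)" "\<i> * of_real (exp u)"] unfolding m by simp
  also have "(\<i> * of_real (exp u)) powi k = \<i> powi k * of_real (exp (u * k))"
  proof -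
    have "exp u powi k = exp (u * k)"
      using powr_real_of_int'[of "exp u" k] by (simp add: powr_def mult.commute)
    then show ?thesis by (simp add: power_int_mult_distrib flip: of_real_power_int)
  qed
  finally have "\<phi> (- u) = \<i> powi k * f (\<i> * of_real (exp u)) * of_real (exp (u * k) * exp (- u * k / 2))"
    by (simp add: \<phi>_def)
  also have "exp (u * k) * exp (- u * k / 2) = exp (u * k / 2)" by (simp add: exp_add[symmetric])
  finally show ?thesis by (simp add: \<phi>_def)
qed

lemma continuous_phi: "continuous_on UNIV \<phi>"
  unfolding \<phi>_def
  by (intro continuous_intros continuous_on_compose2[OF holomorphic_on_imp_continuous_on[OF hol]])
     (auto simp: upper_half_plane_def)

lemma measurable_phi [measurable]: "\<phi> \<in> borel_measurable borel"
  using continuous_phi by (rule borel_measurable_continuous_onI)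

text \<open>For u >= 0 the cuspidal decay in exp u beats every exponential in u;
  \<open>phi_minus\<close> carries this to u < 0.\<close>

lemma phi_bound:
  obtains D where "D > 0" "\<And>u. norm (\<phi> u) \<le> D * exp (- c * \<bar>u\<bar>)"
proof -
  obtain C1 where C1: "C1 > 0" "\<And>z. Im z \<ge> 1/2 \<Longrightarrow> norm (f z) \<le> C1 * exp (- 2 * pi * Im z)"
    using f_decay by blast
  obtain C2 where C2: "C2 > 0" "\<And>y. y \<ge> 1/2 \<Longrightarrow> y powr (k / 2 + c) * exp (- 2 * pi * y) \<le> C2"
    using powr_exp_bounded by blast
  have pos: "norm (\<phi> u) \<le> C1 * C2 * exp (- c * \<bar>u\<bar>)" if u: "u \<ge> 0" for u
  proof -
    have e1: "exp u \<ge> 1/2" using u exp_ge_add_one_self[of u] by linarith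
    have "norm (\<phi> u) = norm (f (\<i> * of_real (exp u))) * exp (u * k / 2)" by (simp add: \<phi>_def norm_mult del: of_real_exp)
    also have "\<dots> \<le> C1 * exp (- 2 * pi * exp u) * exp (u * k / 2)"
      using C1(2)[of "\<i> * of_real (exp u)"] e1 by (intro mult_right_mono) (auto simp del: of_real_exp)
    also have "exp (u * k / 2) = exp u powr (k / 2 + c) * exp (- c * u)"
      by (simp add: powr_def exp_add[symmetric] algebra_simps)
    also have "C1 * exp (- 2 * pi * exp u) * (exp u powr (k / 2 + c) * exp (- c * u)) = C1 * (exp u powr (k / 2 + c) * exp (- 2 * pi * exp u)) * exp (- c * u)"
      by simp
    also have "\<dots> \<le> C1 * C2 * exp (- c * u)" using C2(2)[OF e1] C1 by (intro mult_right_mono mult_left_mono) auto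
    finally show ?thesis using u by simp
  qed
  have "norm (\<phi> u) \<le> C1 * C2 * exp (- c * \<bar>u\<bar>)" for u
  proof (cases "u \<ge> 0")
    case False
    then show ?thesis using pos[of "- u"] by (simp add: phi_minus norm_mult norm_power_int)
  qed (use pos in auto)
  then show thesis using that[of "C1 * C2"] C1 C2 by simp
qed

text \<open>The rate 2 is meant to be split: one factor exp (- |u|) ensures integrability, the other
  measures the error of truncating at |u| = N.\<close>

lemma Lambda_integrand_bound:
  obtains D where "D > 0" "\<And>s u. \<bar>Re s - 1/2\<bar> \<le> K \<Longrightarrow> norm (\<phi> u * exp (of_real u * (s - 1/2))) \<le> D * exp (- 2 * \<bar>u\<bar>)"
proof -
  obtain D where D: "D > 0" "\<And>u. norm (\<phi> u) \<le> D * exp (- (K + 2) * \<bar>u\<bar>)" using phi_bound by blast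
  have "norm (\<phi> u * exp (of_real u * (s - 1/2))) \<le> D * exp (- 2 * \<bar>u\<bar>)" if s: "\<bar>Re s - 1/2\<bar> \<le> K" for s u
  proof -
    have "u * (Re s - 1/2) \<le> \<bar>u\<bar> * \<bar>Re s - 1/2\<bar>" by (metis abs_ge_self abs_mult)
    also have "\<dots> \<le> \<bar>u\<bar> * K" using s by (intro mult_left_mono) auto
    finally have le: "u * (Re s - 1/2) \<le> K * \<bar>u\<bar>" by (simp add: mult.commute)
    have "norm (\<phi> u * exp (of_real u * (s - 1/2))) = norm (\<phi> u) * exp (u * (Re s - 1/2))"
      by (simp add: norm_mult)
    also have "\<dots> \<le> D * exp (- (K + 2) * \<bar>u\<bar>) * exp (K * \<bar>u\<bar>)"
      using D le by (intro mult_mono) auto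
    also have "\<dots> = D * exp (- 2 * \<bar>u\<bar>)" by (simp add: mult.assoc exp_add[symmetric] algebra_simps)
    finally show ?thesis .
  qed
  then show thesis using that D by blast
qed

lemma integrable_Lambda: "integrable lborel (\<lambda>u. \<phi> u * exp (of_real u * (s - 1/2)))"
proof -
  obtain D where D: "D > 0" "\<And>s' u. \<bar>Re s' - 1/2\<bar> \<le> \<bar>Re s - 1/2\<bar> \<Longrightarrow> norm (\<phi> u * exp (of_real u * (s' - 1/2))) \<le> D * exp (- 2 * \<bar>u\<bar>)"
    using Lambda_integrand_bound by blast
  show ?thesis
  proof (rule Bochner_Integration.integrable_bound)
    show "integrable lborel (\<lambda>u::real. D * exp (- \<bar>u\<bar>))"
      by (intro integrable_mult_right integrable_exp_minus_abs)
    show "AE u in lborel. norm (\<phi> u * exp (of_real u * (s - 1/2))) \<le> norm (D * exp (- \<bar>u\<bar>))"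
    proof (rule AE_I2)
      fix u
      have "norm (\<phi> u * exp (of_real u * (s - 1/2))) \<le> D * exp (- 2 * \<bar>u\<bar>)" using D by blast
      also have "\<dots> \<le> D * exp (- \<bar>u\<bar>)" using D by simp
      finally show "norm (\<phi> u * exp (of_real u * (s - 1/2))) \<le> norm (D * exp (- \<bar>u\<bar>))" using D by simp
    qed
  qed measurable
qed

lemma Lambda_bound:
  obtains M where "M > 0" "\<And>s. \<bar>Re s - 1/2\<bar> \<le> K \<Longrightarrow> norm (\<Lambda> s) \<le> M"
proof -
  obtain D where D: "D > 0" "\<And>s u. \<bar>Re s - 1/2\<bar> \<le> K \<Longrightarrow> norm (\<phi> u * exp (of_real u * (s - 1/2))) \<le> D * exp (- 2 * \<bar>u\<bar>)"
    using Lambda_integrand_bound by blast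
  define I where "I = (LINT u|lborel. exp (- \<bar>u\<bar> :: real))"
  have I0: "I \<ge> 0" unfolding I_def by (intro Bochner_Integration.integral_nonneg) auto
  have "norm (\<Lambda> s) \<le> D * I" if s: "\<bar>Re s - 1/2\<bar> \<le> K" for s
  proof -
    have "norm (\<Lambda> s) \<le> (LINT u|lborel. D * exp (- \<bar>u\<bar>))"
      unfolding \<Lambda>_def
    proof (rule Bochner_Integration.integral_norm_bound_integral[OF integrable_Lambda])
      show "integrable lborel (\<lambda>u::real. D * exp (- \<bar>u\<bar>))"
        by (intro integrable_mult_right integrable_exp_minus_abs)
      fix u
      have "D * exp (- 2 * \<bar>u\<bar>) \<le> D * exp (- \<bar>u\<bar>)" using D by simp
      then show "norm (\<phi> u * exp (of_real u * (s - 1/2))) \<le> D * exp (- \<bar>u\<bar>)" using D(2)[OF s, of u] by linarith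
    qed
    then show ?thesis by (simp add: I_def)
  qed
  then have "norm (\<Lambda> s) \<le> D * I + 1" if s: "\<bar>Re s - 1/2\<bar> \<le> K" for s using that by fastforce
  moreover have "D * I + 1 > 0" using D I0 by (intro add_nonneg_pos) auto
  ultimately show thesis using that by blast
qed

lemma Lambda_reflect: "\<Lambda> (1 - s) = \<i> powi k * \<Lambda> s"
proof -
  have "\<Lambda> (1 - s) = (LINT u|lborel. \<phi> (- u) * exp (of_real (- u) * ((1 - s) - 1/2)))"
    unfolding \<Lambda>_def
    using lborel_integral_real_affine[of "-1" "\<lambda>u. \<phi> u * exp (of_real u * ((1 - s) - 1/2))" 0] by simp
  also have "\<dots> = (LINT u|lborel. \<i> powi k * (\<phi> u * exp (of_real u * (s - 1/2))))"
    by (intro Bochner_Integration.integral_cong refl) (simp add: phi_minus algebra_simps)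
  also have "\<dots> = \<i> powi k * \<Lambda> s" by (simp add: \<Lambda>_def)
  finally show ?thesis .
qed

text \<open>The truncated integrals are holomorphic by the Leibniz rule and converge uniformly on
  unit discs, with error O(exp (- N)).\<close>

lemma Lambda_holomorphic: "\<Lambda> holomorphic_on UNIV"
proof (rule holomorphic_uniform_sequence)
  define P where "P = (\<lambda>N s. integral (cbox (- real N) N) (\<lambda>u. \<phi> u * exp (of_real u * (s - 1/2))))"
  show "P N holomorphic_on UNIV" for N
    unfolding P_def
  proof (rule leibniz_rule_holomorphic[where fx = "\<lambda>s u. \<phi> u * (of_real u * exp (of_real u * (s - 1/2)))"])
    show "((\<lambda>s. \<phi> u * exp (of_real u * (s - 1/2))) has_field_derivative \<phi> u * (of_real u * exp (of_real u * (s - 1/2)))) (at s within UNIV)" for s u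
      by (auto intro!: derivative_eq_intros)
    have cont: "continuous_on A (\<lambda>x. \<phi> (g x))" if "continuous_on A g" for A :: "'x::topological_space set" and g
      by (rule continuous_on_compose2[OF continuous_phi that]) auto
    show "(\<lambda>u. \<phi> u * exp (of_real u * (s - 1/2))) integrable_on cbox (- real N) N" for s
      by (intro integrable_continuous continuous_intros cont)
    show "continuous_on (UNIV \<times> cbox (- real N) N) (\<lambda>(s, u). \<phi> u * (of_real u * exp (of_real u * (s - 1/2))))"
      unfolding case_prod_unfold by (intro continuous_intros cont)
  qed simp
  fix s0 :: complex
  define K where "K = \<bar>Re s0 - 1/2\<bar> + 1"
  obtain D where D: "D > 0" "\<And>s u. \<bar>Re s - 1/2\<bar> \<le> K \<Longrightarrow> norm (\<phi> u * exp (of_real u * (s - 1/2))) \<le> D * exp (- 2 * \<bar>u\<bar>)"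
    using Lambda_integrand_bound by blast
  define I where "I = (LINT u|lborel. exp (- \<bar>u\<bar> :: real))"
  have bd: "norm (\<Lambda> s - P N s) \<le> D * exp (- real N) * I" if s: "s \<in> cball s0 1" for s N
  proof -
    let ?g = "\<lambda>u. \<phi> u * exp (of_real u * (s - 1/2))"
    have K: "\<bar>Re s - 1/2\<bar> \<le> K"
      using s abs_Re_le_cmod[of "s - s0"] by (simp add: K_def dist_norm norm_minus_commute)
    have si: "set_integrable lborel {- real N..real N} ?g"
      unfolding set_integrable_def by (intro integrable_mult_indicator integrable_Lambda) auto
    have "P N s = (LINT u:{- real N..real N}|lborel. ?g u)"
      using set_borel_integral_eq_integral(2)[OF si] by (simp add: P_def)
    also have "\<dots> = (LINT u|lborel. indicator {- real N..real N} u *\<^sub>R ?g u)" by (simp add: set_lebesgue_integral_def)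
    finally have "\<Lambda> s - P N s = (LINT u|lborel. ?g u - indicator {- real N..real N} u *\<^sub>R ?g u)"
      using si integrable_Lambda[of s] unfolding \<Lambda>_def set_integrable_def by simp
    also have "norm \<dots> \<le> (LINT u|lborel. D * exp (- real N) * exp (- \<bar>u\<bar>))"
    proof (rule Bochner_Integration.integral_norm_bound_integral)
      show "integrable lborel (\<lambda>u. ?g u - indicator {- real N..real N} u *\<^sub>R ?g u)"
        using si integrable_Lambda[of s] unfolding set_integrable_def by simp
      show "integrable lborel (\<lambda>u::real. D * exp (- real N) * exp (- \<bar>u\<bar>))"
        by (intro integrable_mult_right integrable_exp_minus_abs)
      fix u :: real
      show "norm (?g u - indicator {- real N..real N} u *\<^sub>R ?g u) \<le> D * exp (- real N) * exp (- \<bar>u\<bar>)"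
      proof (cases "u \<in> {- real N..real N}")
        case True
        then show ?thesis using D by simp
      next
        case False
        then have "exp (- 2 * \<bar>u\<bar>) \<le> exp (- real N) * exp (- \<bar>u\<bar>)" unfolding exp_add[symmetric] by auto
        then have "D * exp (- 2 * \<bar>u\<bar>) \<le> D * (exp (- real N) * exp (- \<bar>u\<bar>))" using D by (intro mult_left_mono) auto
        then show ?thesis using D(2)[OF K, of u] False by simp
      qed
    qed
    also have "\<dots> = D * exp (- real N) * I" by (simp add: I_def)
    finally show ?thesis .
  qed
  have "uniform_limit (cball s0 1) P \<Lambda> sequentially"
  proof (rule uniform_limitI)
    fix e :: real assume e: "e > 0"
    have "(\<lambda>N. D * exp (- real N) * I) \<longlonglongrightarrow> 0" by real_asymp
    then have "eventually (\<lambda>N. D * exp (- real N) * I < e) sequentially" by (rule order_tendstoD) (rule e)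
    then show "eventually (\<lambda>N. \<forall>s\<in>cball s0 1. dist (P N s) (\<Lambda> s) < e) sequentially"
    proof eventually_elim
      case (elim N)
      show ?case
      proof
        fix s assume "s \<in> cball s0 1"
        then have "norm (\<Lambda> s - P N s) < e" using bd[of s N] elim by linarith
        then show "dist (P N s) (\<Lambda> s) < e" by (simp add: dist_norm norm_minus_commute)
      qed
    qed
  qed
  then show "\<exists>d. 0 < d \<and> cball s0 d \<subseteq> UNIV \<and> uniform_limit (cball s0 d) P \<Lambda> sequentially"
    by (intro exI[of _ 1]) auto
qed auto

lemma Lfun_holomorphic: "Lfun holomorphic_on UNIV"
  unfolding Lfun_def
  by (intro holomorphic_intros holomorphic_on_compose_gen[OF _ holomorphic_rGamma, unfolded o_def] Lambda_holomorphic) auto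

text \<open>Termwise integration of the Fourier series. The absolute values of the terms integrate
  to a constant times |lam n| n^(- Re s), so \<open>summable_lam\<close> permits the
  exchange.\<close>

lemma Lambda_sums:
  assumes s: "Re s > 1"
  shows "(\<lambda>n. lam (Suc n) * of_nat (Suc n) powr (- s)) sums Lfun s"
proof -
  define w where "w = s + of_real \<kappa>"
  have w: "Re w > 0" using s kappa_ge by (simp add: w_def)
  define t where "t = (\<lambda>n u. a (Suc n) * (of_real (exp (- (2 * pi * real (Suc n)) * exp u)) * exp (of_real u * w)))"
  have hb: "has_bochner_integral lborel (t n) (a (Suc n) * (of_real (2 * pi * Suc n) powr (- w) * Gamma w))" for n
    unfolding t_def by (intro has_bochner_integral_mult_right Gamma_integral_exp w) simp
  have nhb: "has_bochner_integral lborel (\<lambda>u. norm (t n u)) (norm (a (Suc n)) * ((2 * pi * Suc n) powr (- Re w) * Gamma (Re w)))" for n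
  proof -
    have "(\<lambda>u. norm (t n u)) = (\<lambda>u. norm (a (Suc n)) * (exp (- (2 * pi * real (Suc n)) * exp u) * exp (u * Re w)))"
      by (simp add: t_def norm_mult fun_eq_iff del: of_real_exp)
    then show ?thesis by (simp only:) (intro has_bochner_integral_mult_right Gamma_integral_exp_real w, simp)
  qed
  have lamn: "norm (a (Suc n)) * real (Suc n) powr (- Re w) = norm (lam (Suc n)) * real (Suc n) powr (- Re s)" for n
  proof -
    have "real (Suc n) powr (- Re w) = real (Suc n) powr (- Re s) / real (Suc n) powr \<kappa>"
      by (subst powr_diff[symmetric]) (simp add: w_def algebra_simps)
    then show ?thesis by (simp add: lam_def norm_divide)
  qed
  have phi_eq: "(\<lambda>n. t n u) sums (\<phi> u * exp (of_real u * (s - 1/2)))" for u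
  proof -
    define z where "z = \<i> * of_real (exp u)"
    have "(\<lambda>n. a n * exp (2 * of_real pi * \<i> * z) ^ n) sums f z" by (rule f_sums) (simp add: z_def del: of_real_exp)
    then have "(\<lambda>n. a (Suc n) * exp (2 * of_real pi * \<i> * z) ^ Suc n) sums f z"
      using sums_Suc_iff[of "\<lambda>n. a n * exp (2 * of_real pi * \<i> * z) ^ n" "f z"] a0 by simp
    then have "(\<lambda>n. (a (Suc n) * exp (2 * of_real pi * \<i> * z) ^ Suc n) * exp (of_real u * w)) sums (f z * exp (of_real u * w))"
      by (rule sums_mult2)
    also have "(\<lambda>n. (a (Suc n) * exp (2 * of_real pi * \<i> * z) ^ Suc n) * exp (of_real u * w)) = (\<lambda>n. t n u)"
    proof
      fix n
      have "exp (2 * of_real pi * \<i> * z) ^ Suc n = exp (of_real (- (2 * pi * real (Suc n)) * exp u))"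
        unfolding exp_of_nat_mult[symmetric] by (simp add: z_def algebra_simps)
      then show "(a (Suc n) * exp (2 * of_real pi * \<i> * z) ^ Suc n) * exp (of_real u * w) = t n u"
        by (simp only: t_def exp_of_real mult.assoc)
    qed
    also have "f z * exp (of_real u * w) = \<phi> u * exp (of_real u * (s - 1/2))"
    proof -
      have "of_real u * w = of_real (u * k / 2) + of_real u * (s - 1/2)"
        by (simp add: w_def \<kappa>_def field_simps)
      then show ?thesis by (simp only: \<phi>_def z_def exp_add exp_of_real mult.assoc)
    qed
    finally show ?thesis .
  qed
  have "(\<lambda>n. LINT u|lborel. t n u) sums (LINT u|lborel. (\<Sum>n. t n u))"
  proof (rule sums_integral)
    show "integrable lborel (t n)" for n using hb by (simp add: has_bochner_integral_iff)
    have "(\<lambda>n. LINT u|lborel. norm (t n u)) = (\<lambda>n. (norm (lam (Suc n)) * real (Suc n) powr (- Re s)) * ((2 * pi) powr (- Re w) * Gamma (Re w)))"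
    proof
      fix n
      have "(LINT u|lborel. norm (t n u)) = norm (a (Suc n)) * ((2 * pi * Suc n) powr (- Re w) * Gamma (Re w))"
        using nhb by (simp only: has_bochner_integral_iff)
      also have "\<dots> = (norm (a (Suc n)) * real (Suc n) powr (- Re w)) * ((2 * pi) powr (- Re w) * Gamma (Re w))"
        by (subst powr_mult) simp
      finally show "(LINT u|lborel. norm (t n u)) = (norm (lam (Suc n)) * real (Suc n) powr (- Re s)) * ((2 * pi) powr (- Re w) * Gamma (Re w))"
        unfolding lamn .
    qed
    moreover have "summable (\<lambda>n. norm (lam (Suc n)) * real (Suc n) powr (- Re s))"
      using summable_lam[OF s] by (subst summable_Suc_iff[where f = "\<lambda>n. norm (lam n) * real n powr (- Re s)"])
    ultimately show "summable (\<lambda>n. LINT u|lborel. norm (t n u))" by (simp only: summable_mult2)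
    have nt: "norm (t n u) = norm (a (Suc n)) * exp (- 2 * pi * Suc n * exp u) * exp (u * Re w)" for n u
      by (simp add: t_def norm_mult del: of_real_exp)
    have "summable (\<lambda>n. norm (t n u))" for u
      unfolding nt using summable_abs[of "exp u"]
      by (intro summable_mult2) (subst summable_Suc_iff[where f = "\<lambda>n. norm (a n) * exp (- 2 * pi * real n * exp u)"], simp)
    then show "AE u in lborel. summable (\<lambda>n. norm (t n u))" by simp
  qed
  also have "(LINT u|lborel. (\<Sum>n. t n u)) = \<Lambda> s"
    unfolding \<Lambda>_def using phi_eq by (simp add: sums_iff)
  also have "(\<lambda>n. LINT u|lborel. t n u) = (\<lambda>n. a (Suc n) * (of_real (2 * pi * Suc n) powr (- w) * Gamma w))"
    using hb by (simp add: has_bochner_integral_iff)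
  finally have "(\<lambda>n. a (Suc n) * (of_real (2 * pi * Suc n) powr (- w) * Gamma w)) sums \<Lambda> s" .
  then have "(\<lambda>n. (of_real (2 * pi) powr w * rGamma w) * (a (Suc n) * (of_real (2 * pi * Suc n) powr (- w) * Gamma w))) sums
     ((of_real (2 * pi) powr w * rGamma w) * \<Lambda> s)"
    by (rule sums_mult)
  also have "(of_real (2 * pi) powr w * rGamma w) * \<Lambda> s = Lfun s" by (simp add: Lfun_def w_def)
  also have "(\<lambda>n. (of_real (2 * pi) powr w * rGamma w) * (a (Suc n) * (of_real (2 * pi * Suc n) powr (- w) * Gamma w)))
     = (\<lambda>n. lam (Suc n) * of_nat (Suc n) powr (- s))"
  proof
    fix n
    have G: "rGamma w * Gamma w = 1"
    proof -
      have "w \<notin> \<int>\<^sub>\<le>\<^sub>0" using w by (auto elim!: nonpos_Ints_cases)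
      then show ?thesis by (simp add: rGamma_inverse_Gamma Gamma_eq_zero_iff)
    qed
    have p1: "of_real (2 * pi * Suc n) powr (- w) = of_real (2 * pi) powr (- w) * of_nat (Suc n) powr (- w)"
      using powr_times_real[of "of_real (2 * pi)" "of_nat (Suc n)" "- w"] by simp
    have p2: "of_real (2 * pi) powr w * of_real (2 * pi) powr (- w) = (1 :: complex)"
      by (simp add: powr_minus)
    have p3: "of_nat (Suc n) powr (- w) = of_nat (Suc n) powr (- s) / complex_of_real (real (Suc n) powr \<kappa>)"
    proof -
      have "- w = - s - of_real \<kappa>" by (simp add: w_def)
      moreover have "of_nat (Suc n) powr (complex_of_real \<kappa>) = complex_of_real (real (Suc n) powr \<kappa>)"
        using powr_of_real[of "real (Suc n)" \<kappa>] by simp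
      ultimately show ?thesis by (simp only: powr_diff)
    qed
    have "(of_real (2 * pi) powr w * rGamma w) * (a (Suc n) * (of_real (2 * pi * Suc n) powr (- w) * Gamma w))
       = (of_real (2 * pi) powr w * of_real (2 * pi) powr (- w)) * (rGamma w * Gamma w) * (a (Suc n) * of_nat (Suc n) powr (- w))"
      unfolding p1 by (simp only: mult_ac)
    also have "\<dots> = lam (Suc n) * of_nat (Suc n) powr (- s)"
      unfolding G p2 p3 by (simp add: lam_def)
    finally show "(of_real (2 * pi) powr w * rGamma w) * (a (Suc n) * (of_real (2 * pi * Suc n) powr (- w) * Gamma w))
      = lam (Suc n) * of_nat (Suc n) powr (- s)" .
  qed
  finally show ?thesis .
qed

lemma cusp_L_eq: "cusp_L k f = Lfun"
proof (rule cusp_L_eqI)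
  have "hecke_lambda k f = lam"
    unfolding fun_eq_iff hecke_lambda_def lam_def \<kappa>_def fourier_coeff_eqI[OF q_exp] by simp
  then show "is_entire_L k f Lfun"
    using Lfun_holomorphic Lambda_sums by (simp add: is_entire_L_def)
qed

end

section \<open>Integral matrices and the invariant measure\<close>

lemma mdet_nonzero_jfac: "mdet \<alpha> > 0 \<Longrightarrow> Im z > 0 \<Longrightarrow> jfac \<alpha> z \<noteq> 0"
  using jfac_nonzero[of \<alpha> z] by simp

fun mmul :: "mat2 \<Rightarrow> mat2 \<Rightarrow> mat2" where
  "mmul (p, q, r, s) (p', q', r', s') = (p * p' + q * r', p * q' + q * s', r * p' + s * r', r * q' + s * s')"
text \<open>The adjugate stays integral and acts as the inverse on the upper half-plane, since
  scalar matrices act trivially.\<close>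

fun madj :: "mat2 \<Rightarrow> mat2" where "madj (p, q, r, s) = (s, - q, - r, p)"

lemma mdet_mmul: "mdet (mmul \<alpha> \<beta>) = mdet \<alpha> * mdet \<beta>"
  by (cases \<alpha> rule: mdet.cases; cases \<beta> rule: mdet.cases) (simp add: algebra_simps)

lemma mdet_madj [simp]: "mdet (madj \<alpha>) = mdet \<alpha>"
  by (cases \<alpha> rule: mdet.cases) (simp add: algebra_simps)

lemma madj_madj [simp]: "madj (madj \<alpha>) = \<alpha>"
  by (cases \<alpha> rule: mdet.cases) simp

lemma mmul_assoc: "mmul (mmul \<alpha> \<beta>) \<gamma> = mmul \<alpha> (mmul \<beta> \<gamma>)"
  by (cases \<alpha> rule: mdet.cases; cases \<beta> rule: mdet.cases; cases \<gamma> rule: mdet.cases) (simp add: algebra_simps)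

lemma jfac_mmul:
  assumes "jfac \<beta> z \<noteq> 0"
  shows "jfac (mmul \<alpha> \<beta>) z = jfac \<alpha> (mob \<beta> z) * jfac \<beta> z"
  using assms by (cases \<alpha> rule: mdet.cases; cases \<beta> rule: mdet.cases) (simp add: field_simps)

lemma mob_mmul:
  assumes "jfac \<beta> z \<noteq> 0"
  shows "mob (mmul \<alpha> \<beta>) z = mob \<alpha> (mob \<beta> z)"
proof (cases \<alpha> rule: mdet.cases; cases \<beta> rule: mdet.cases)
  fix p q r s p' q' r' s' assume [simp]: "\<alpha> = (p, q, r, s)" "\<beta> = (p', q', r', s')"
  define D where "D = of_int r' * z + of_int s'"
  define N where "N = of_int p' * z + of_int q'"
  have D: "D \<noteq> 0" using assms by (simp add: D_def)
  have "mob \<alpha> (mob \<beta> z) = (of_int p * (N / D) + of_int q) / (of_int r * (N / D) + of_int s)"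
    by (simp add: N_def D_def)
  also have "\<dots> = ((of_int p * (N / D) + of_int q) * D) / ((of_int r * (N / D) + of_int s) * D)"
    using D by simp
  also have "(of_int p * (N / D) + of_int q) * D = of_int p * N + of_int q * D" using D by (simp add: algebra_simps)
  also have "(of_int r * (N / D) + of_int s) * D = of_int r * N + of_int s * D" using D by (simp add: algebra_simps)
  finally show ?thesis by (simp add: N_def D_def algebra_simps)
qed

lemma mob_madj:
  assumes "mdet \<alpha> > 0" "Im z > 0"
  shows "mob \<alpha> (mob (madj \<alpha>) z) = z" "mob (madj \<alpha>) (mob \<alpha> z) = z"
    "jfac \<alpha> (mob (madj \<alpha>) z) * jfac (madj \<alpha>) z = of_int (mdet \<alpha>)"
proof -
  have nz: "jfac \<alpha> z \<noteq> 0" "jfac (madj \<alpha>) z \<noteq> 0" using assms mdet_nonzero_jfac[of \<alpha> z] mdet_nonzero_jfac[of "madj \<alpha>" z] by simp_all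
  have e: "mmul \<alpha> (madj \<alpha>) = (mdet \<alpha>, 0, 0, mdet \<alpha>)" "mmul (madj \<alpha>) \<alpha> = (mdet \<alpha>, 0, 0, mdet \<alpha>)"
    by (cases \<alpha> rule: mdet.cases; simp add: algebra_simps)+
  have "mob (mdet \<alpha>, 0, 0, mdet \<alpha>) z = z" using assms by simp
  then show "mob \<alpha> (mob (madj \<alpha>) z) = z" "mob (madj \<alpha>) (mob \<alpha> z) = z"
    using mob_mmul[OF nz(2), of \<alpha>] mob_mmul[OF nz(1), of "madj \<alpha>"] e by simp_all
  show "jfac \<alpha> (mob (madj \<alpha>) z) * jfac (madj \<alpha>) z = of_int (mdet \<alpha>)"
    using jfac_mmul[OF nz(2), of \<alpha>] e by simp
qed

lemma has_field_derivative_mob: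
  assumes "jfac \<alpha> z \<noteq> 0"
  shows "(mob \<alpha> has_field_derivative of_int (mdet \<alpha>) / (jfac \<alpha> z)\<^sup>2) (at z)"
proof (cases \<alpha> rule: mdet.cases)
  case (1 p q r s)
  have "mob \<alpha> = (\<lambda>z. (of_int p * z + of_int q) / (of_int r * z + of_int s))" by (auto simp: 1)
  then show ?thesis using assms unfolding 1
    by (auto intro!: derivative_eq_intros simp: power2_eq_square field_simps)
qed

lemma measurable_mob [measurable]: "mob \<alpha> \<in> borel_measurable borel"
proof (cases \<alpha> rule: mdet.cases)
  case (1 p q r s)
  have "mob \<alpha> = (\<lambda>z. (of_int p * z + of_int q) / (of_int r * z + of_int s))" by (auto simp: 1)
  then show ?thesis by simp
qed

lemma std_domain_measurable [measurable]: "std_domain \<in> sets borel"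
proof -
  have eq: "std_domain = {z. \<bar>Re z\<bar> \<le> 1/2} \<inter> {z. norm z \<ge> 1} \<inter> {z. Im z > 0}" by (auto simp: std_domain_def)
  show ?thesis unfolding eq
    by (intro sets.Int borel_closed borel_open closed_Collect_le open_Collect_less continuous_intros)
qed

text \<open>
  The library states the change of variables theorem for maps of \<open>real ^ 'n\<close>, so integrals against
  \<open>dx dy / y\<^sup>2\<close> are transported there.
\<close>

definition iota :: "real^2 \<Rightarrow> complex" where "iota v = Complex (v $ 1) (v $ 2)"
definition iota_inv :: "complex \<Rightarrow> real^2" where "iota_inv z = (\<chi> i. if i = 1 then Re z else Im z)"
definition H2 :: "(real^2) set" where "H2 = {v. v $ 2 > 0}"
definition hdens :: "(complex \<Rightarrow> real) \<Rightarrow> real^2 \<Rightarrow> real" where "hdens K v = K (iota v) / (v $ 2)\<^sup>2"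

lemma iota_simps [simp]: "Re (iota v) = v $ 1" "Im (iota v) = v $ 2" "iota (iota_inv z) = z" "iota_inv (iota v) = v"
  "iota_inv z $ 1 = Re z" "iota_inv z $ 2 = Im z"
  by (auto simp: iota_def iota_inv_def vec_eq_iff forall_2 complex_eq_iff)

lemma linear_iota: "linear iota" "linear iota_inv"
  by (auto intro!: linearI simp: complex_eq_iff vec_eq_iff forall_2)

lemma bounded_linear_iota: "bounded_linear iota" "bounded_linear iota_inv"
  using linear_iota by (auto simp: linear_conv_bounded_linear)

lemma open_H2: "open H2"
  unfolding H2_def by (intro open_Collect_less continuous_intros)

lemma H2_lebesgue: "H2 \<in> sets lebesgue"
  using open_H2 by auto

text \<open>With j the automorphy factor, the Jacobian is (det / |j|^2)^2 and Im is multiplied by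
  det / |j|^2, so dx dy / y^2 is invariant for every positive determinant. The equivalence with
  \<open>b\<close> carries integrability and value at once.\<close>

lemma hdens_change_of_variables:
  assumes det: "mdet \<alpha> > 0"
  shows "hdens (\<lambda>z. K (mob \<alpha> z)) absolutely_integrable_on H2 \<and> integral H2 (hdens (\<lambda>z. K (mob \<alpha> z))) = b
     \<longleftrightarrow> hdens K absolutely_integrable_on H2 \<and> integral H2 (hdens K) = b"
proof -
  define g where "g = (\<lambda>v. iota_inv (mob \<alpha> (iota v)))"
  define D where "D = (\<lambda>v. of_int (mdet \<alpha>) / (jfac \<alpha> (iota v))\<^sup>2)"
  define g' where "g' = (\<lambda>v h. iota_inv (D v * iota h))"
  have der: "(g has_derivative g' v) (at v within H2)" if v: "v \<in> H2" for v
  proof -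
    have "jfac \<alpha> (iota v) \<noteq> 0" using v det by (intro mdet_nonzero_jfac) (auto simp: H2_def)
    then have "(mob \<alpha> has_derivative (*) (D v)) (at (iota v))"
      using has_field_derivative_mob unfolding has_field_derivative_def D_def by blast
    from has_derivative_compose[OF bounded_linear.has_derivative[OF bounded_linear_iota(1) has_derivative_ident] this]
    have "((\<lambda>v. mob \<alpha> (iota v)) has_derivative (\<lambda>h. D v * iota h)) (at v within H2)" .
    from bounded_linear.has_derivative[OF bounded_linear_iota(2) this]
    show ?thesis by (simp add: g_def[abs_def] g'_def)
  qed
  have gH: "g v \<in> H2" if "v \<in> H2" for v
    using that Im_mob_pos[OF det, of "iota v"] by (simp add: g_def H2_def)
  have inv: "iota_inv (mob (madj \<alpha>) (iota (g v))) = v" if "v \<in> H2" for v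
    using that mob_madj(2)[OF det, of "iota v"] by (simp add: g_def H2_def)
  have inj: "inj_on g H2" using inv by (metis inj_onI)
  have img: "g ` H2 = H2"
  proof
    show "H2 \<subseteq> g ` H2"
    proof
      fix v assume v: "v \<in> H2"
      define u where "u = iota_inv (mob (madj \<alpha>) (iota v))"
      have "u \<in> H2" using v det Im_mob_pos[of "madj \<alpha>" "iota v"] by (simp add: u_def H2_def)
      moreover have "g u = v" using v mob_madj(1)[OF det, of "iota v"] by (simp add: g_def u_def H2_def)
      ultimately show "v \<in> g ` H2" by blast
    qed
  qed (use gH in auto)
  have det_g: "\<bar>det (matrix (g' v))\<bar> = (norm (D v))\<^sup>2" for v
    unfolding cmod_power2 unfolding power2_eq_square by (simp add: det_2 matrix_def g'_def axis_def iota_def)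
  have eq: "\<bar>det (matrix (g' v))\<bar> * hdens K (g v) = hdens (\<lambda>z. K (mob \<alpha> z)) v" if v: "v \<in> H2" for v
  proof -
    define J where "J = norm (jfac \<alpha> (iota v))"
    have J: "J > 0" using v mdet_nonzero_jfac[OF det, of "iota v"] by (simp add: J_def H2_def)
    have y: "v $ 2 > 0" using v by (simp add: H2_def)
    have "\<bar>det (matrix (g' v))\<bar> = (of_int (mdet \<alpha>) / J\<^sup>2)\<^sup>2"
      using det by (simp add: det_g D_def norm_divide norm_power J_def)
    moreover have "g v $ 2 = of_int (mdet \<alpha>) * v $ 2 / J\<^sup>2"
      by (simp add: g_def Im_mob J_def)
    ultimately have "\<bar>det (matrix (g' v))\<bar> / (g v $ 2)\<^sup>2 = 1 / (v $ 2)\<^sup>2"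
      using J y det by (simp add: power_divide power_mult_distrib)
    moreover have "iota (g v) = mob \<alpha> (iota v)" by (simp add: g_def)
    ultimately show ?thesis by (simp add: hdens_def) (metis mult.commute times_divide_eq_right mult.right_neutral)
  qed
  \<comment> \<open>Scalar integrands are viewed as vectors of length one and translated back
    below.\<close>
  have "(\<lambda>v. \<bar>det (matrix (g' v))\<bar> *\<^sub>R (vec (hdens K (g v)) :: real^1)) absolutely_integrable_on H2 \<and>
     integral H2 (\<lambda>v. \<bar>det (matrix (g' v))\<bar> *\<^sub>R vec (hdens K (g v))) = (vec b :: real^1)
     \<longleftrightarrow> (\<lambda>v. vec (hdens K v) :: real^1) absolutely_integrable_on (g ` H2) \<and> integral (g ` H2) (\<lambda>v. vec (hdens K v)) = (vec b :: real^1)"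
    by (rule has_absolute_integral_change_of_variables[OF H2_lebesgue der inj])
  then have "(\<lambda>v. \<bar>det (matrix (g' v))\<bar> * hdens K (g v)) absolutely_integrable_on H2 \<and>
     integral H2 (\<lambda>v. \<bar>det (matrix (g' v))\<bar> * hdens K (g v)) = b
     \<longleftrightarrow> hdens K absolutely_integrable_on H2 \<and> integral H2 (hdens K) = b"
    by (simp add: absolutely_integrable_on_1_iff integral_on_1_eq img)
  moreover have "(\<lambda>v. \<bar>det (matrix (g' v))\<bar> * hdens K (g v)) absolutely_integrable_on H2 \<longleftrightarrow> hdens (\<lambda>z. K (mob \<alpha> z)) absolutely_integrable_on H2"
    by (rule set_integrable_cong) (use eq in auto)
  moreover have "integral H2 (\<lambda>v. \<bar>det (matrix (g' v))\<bar> * hdens K (g v)) = integral H2 (hdens (\<lambda>z. K (mob \<alpha> z)))"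
    by (rule Henstock_Kurzweil_Integration.integral_cong) (use eq in auto)
  ultimately show ?thesis by simp
qed

text \<open>Finiteness of the hyperbolic area: boxes of width 1 and height 1/2, stacked from height
  1/2 upwards, cover the domain, and on the j-th one 1 / y^2 <= 4 / (j + 1)^2.\<close>

lemma hdens_std_domain_integrable: "hdens (indicator std_domain) absolutely_integrable_on H2"
proof -
  define F where "F = (\<lambda>v. indicator H2 v * hdens (indicator std_domain) v)"
  define lo hi :: "nat \<Rightarrow> real^2" where "lo = (\<lambda>j. \<chi> i. if i = 1 then - 1/2 else (j + 1) / 2)"
    and "hi = (\<lambda>j. \<chi> i. if i = 1 then 1/2 else (j + 2) / 2)"
  define c where "c = (\<lambda>j::nat. 4 / (real j + 1)\<^sup>2)"
  have iota_m: "iota \<in> borel_measurable borel"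
    using bounded_linear_iota(1) by (intro borel_measurable_continuous_onI linear_continuous_on)
  have Fm [measurable]: "F \<in> borel_measurable lborel"
  proof -
    have "(\<lambda>v. indicator std_domain (iota v) :: real) \<in> borel_measurable borel"
      by (rule measurable_compose[OF iota_m]) simp
    moreover have "(\<lambda>v::real^2. v $ 2) \<in> borel_measurable borel"
      by (intro borel_measurable_continuous_onI continuous_intros)
    moreover have "H2 \<in> sets borel" using open_H2 by auto
    ultimately show ?thesis unfolding F_def hdens_def by simp
  qed
  have F0: "F v \<ge> 0" for v by (simp add: F_def hdens_def)
  have box: "emeasure lborel (cbox (lo j) (hi j)) = ennreal (1/2)" for j
  proof -
    have ne: "cbox (lo j) (hi j) \<noteq> {}" by (auto simp: interval_ne_empty_cart lo_def hi_def)
    have m: "measure lborel (cbox (lo j) (hi j)) = 1/2"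
      by (subst content_cbox_cart[OF ne]) (simp add: UNIV_2 lo_def hi_def field_simps)
    have "emeasure lborel (cbox (lo j) (hi j)) = ennreal (measure lborel (cbox (lo j) (hi j)))"
      using emeasure_lborel_cbox_finite[of "lo j" "hi j"] by (intro emeasure_eq_ennreal_measure) auto
    then show ?thesis by (simp only: m)
  qed
  have le: "ennreal (F v) \<le> (\<Sum>j. ennreal (c j) * indicator (cbox (lo j) (hi j)) v)" for v
  proof (cases "F v = 0")
    case False
    then have S: "iota v \<in> std_domain" by (auto simp: F_def hdens_def indicator_def split: if_splits)
    have y: "v $ 2 \<ge> 1/2" using std_domain_Im[OF S] by simp
    define j where "j = nat \<lfloor>2 * v $ 2 - 1\<rfloor>"
    have j: "real j \<le> 2 * v $ 2 - 1" "2 * v $ 2 - 1 \<le> real j + 1"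
      using y by (auto simp: j_def)
    have "F v \<le> 1 / (v $ 2)\<^sup>2" by (auto simp: F_def hdens_def indicator_def)
    also have "\<dots> \<le> 1 / ((real j + 1) / 2)\<^sup>2"
      using j y by (intro divide_left_mono power_mono mult_pos_pos zero_less_power) auto
    also have "\<dots> = c j" by (simp add: c_def power_divide)
    finally have "ennreal (F v) \<le> ennreal (c j)" by (rule ennreal_leI)
    also have "v \<in> cbox (lo j) (hi j)"
      using S j by (auto simp: mem_box_cart forall_2 lo_def hi_def std_domain_def abs_le_iff)
    then have "ennreal (c j) = (\<Sum>i\<in>{j}. ennreal (c i) * indicator (cbox (lo i) (hi i)) v)" by simp
    also have "\<dots> \<le> (\<Sum>j. ennreal (c j) * indicator (cbox (lo j) (hi j)) v)"
      by (intro sum_le_suminf summableI) auto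
    finally show ?thesis .
  qed simp
  have "(\<integral>\<^sup>+v. ennreal (F v) \<partial>lborel) \<le> (\<integral>\<^sup>+v. (\<Sum>j. ennreal (c j) * indicator (cbox (lo j) (hi j)) v) \<partial>lborel)"
    by (intro nn_integral_mono le)
  also have "\<dots> = (\<Sum>j. \<integral>\<^sup>+v. ennreal (c j) * indicator (cbox (lo j) (hi j)) v \<partial>lborel)"
    by (intro nn_integral_suminf) auto
  also have "\<dots> = (\<Sum>j. ennreal (c j * (1/2)))"
  proof (rule suminf_cong)
    fix j
    show "(\<integral>\<^sup>+v. ennreal (c j) * indicator (cbox (lo j) (hi j)) v \<partial>lborel) = ennreal (c j * (1/2))"
    proof -
      have "(\<integral>\<^sup>+v. ennreal (c j) * indicator (cbox (lo j) (hi j)) v \<partial>lborel) = ennreal (c j) * ennreal (1/2)"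
        by (subst nn_integral_cmult_indicator) (simp_all only: box, simp)
      also have "\<dots> = ennreal (c j * (1/2))" by (rule ennreal_mult[symmetric]) (auto simp: c_def)
      finally show ?thesis .
    qed
  qed
  also have "\<dots> < \<infinity>"
  proof -
    have "summable (\<lambda>n. 1 / (real (Suc n))\<^sup>2)" using inverse_squares_sums by (auto simp: sums_iff)
    then have "summable (\<lambda>j. 2 * (1 / (real (Suc j))\<^sup>2))" by (rule summable_mult)
    also have "(\<lambda>j. 2 * (1 / (real (Suc j))\<^sup>2)) = (\<lambda>j. c j * (1/2))" by (auto simp: c_def add.commute)
    finally have "summable (\<lambda>j. c j * (1/2))" .
    then have "(\<Sum>j. ennreal (c j * (1/2))) \<noteq> top"
      by (intro ennreal_suminf_neq_top) (auto simp: c_def)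
    then show ?thesis by (simp add: less_top)
  qed
  finally have "integrable lborel F" using F0 by (intro integrableI_nonneg) auto
  then have "integrable lebesgue F" by (simp add: integrable_completion)
  then show ?thesis unfolding set_integrable_def F_def by simp
qed

section \<open>Integral matrices of determinant n and their Hermite normal forms\<close>

lemma finite_mats_bounded:
  "finite {\<alpha>. \<exists>p q r s. \<alpha> = (p, q, r, s) \<and> \<bar>p\<bar> \<le> B \<and> \<bar>q\<bar> \<le> B \<and> \<bar>r\<bar> \<le> B \<and> \<bar>s\<bar> \<le> (B::int)}"
  by (rule finite_subset[of _ "{-B..B} \<times> {-B..B} \<times> {-B..B} \<times> {-B..B}"]) auto

lemma square_le_imp_abs_le_int:
  fixes r :: int assumes "(real_of_int r)\<^sup>2 \<le> of_int m" shows "\<bar>r\<bar> \<le> m"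
proof (cases "r = 0")
  case True
  then show ?thesis using assms by simp
next
  case False
  then have "\<bar>r\<bar> * 1 \<le> \<bar>r\<bar> * \<bar>r\<bar>" by (intro mult_left_mono) auto
  moreover have "\<bar>r\<bar> * \<bar>r\<bar> \<le> m" using assms by (simp add: power2_eq_square flip: of_int_mult abs_mult)
  ultimately show ?thesis by linarith
qed

text \<open>
  The matrices that return some point of the fundamental domain to it. Unlike the set of all matrices of
  determinant \<open>n\<close> this set is finite.
\<close>
definition ret_mats :: "int \<Rightarrow> mat2 set" where
  "ret_mats n = {\<alpha>. mdet \<alpha> = n \<and> (\<exists>z\<in>std_domain. mob \<alpha> z \<in> std_domain)}"

text \<open>The heights y of z and v of its image are at least 1/2, and |r z + s|^2 = n y / v. If r
  = 0, then p and s divide n and the real parts bound q. Otherwise (r y)^2 <= n y / v bounds r, y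
  and v, after which s, p and q follow. The bound 100 n^2 is generous.\<close>

lemma finite_ret_mats:
  assumes n: "n > 0"
  shows "finite (ret_mats n)"
proof -
  define B where "B = 100 * n * n"
  have nn: "n \<le> n * n" using n by simp
  have "ret_mats n \<subseteq> {\<alpha>. \<exists>p q r s. \<alpha> = (p, q, r, s) \<and> \<bar>p\<bar> \<le> B \<and> \<bar>q\<bar> \<le> B \<and> \<bar>r\<bar> \<le> B \<and> \<bar>s\<bar> \<le> B}"
  proof
    fix \<alpha> assume "\<alpha> \<in> ret_mats n"
    then obtain z where z: "mdet \<alpha> = n" "z \<in> std_domain" "mob \<alpha> z \<in> std_domain" by (auto simp: ret_mats_def)
    obtain p q r s where al: "\<alpha> = (p, q, r, s)" by (cases \<alpha> rule: mdet.cases)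
    define w where "w = mob \<alpha> z"
    define y v where "y = Im z" and "v = Im w"
    have yv: "y \<ge> 1/2" "v \<ge> 1/2" using std_domain_Im z by (auto simp: y_def v_def w_def)
    have rez: "\<bar>Re z\<bar> \<le> 1/2" "\<bar>Re w\<bar> \<le> 1/2" using z by (auto simp: std_domain_def w_def)
    have jz: "jfac \<alpha> z \<noteq> 0" using z n yv by (intro mdet_nonzero_jfac) (auto simp: y_def)
    have det: "p * s - q * r = n" using z al by simp
    have "v = n * y / (norm (jfac \<alpha> z))\<^sup>2" using z by (simp add: v_def w_def Im_mob y_def)
    then have J: "(norm (jfac \<alpha> z))\<^sup>2 = n * y / v" using jz yv by (simp add: field_simps)
    have J2: "(norm (jfac \<alpha> z))\<^sup>2 = (r * Re z + s)\<^sup>2 + (r * y)\<^sup>2"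
      by (simp add: al cmod_power2 y_def)
    have eqw: "w * (of_int r * z + of_int s) = of_int p * z + of_int q"
      using jz by (simp add: w_def al field_simps)
    show "\<alpha> \<in> {\<alpha>. \<exists>p q r s. \<alpha> = (p, q, r, s) \<and> \<bar>p\<bar> \<le> B \<and> \<bar>q\<bar> \<le> B \<and> \<bar>r\<bar> \<le> B \<and> \<bar>s\<bar> \<le> B}"
    proof (cases "r = 0")
      case True
      then have ps: "p * s = n" using det by simp
      have sp: "\<bar>p\<bar> \<le> n" "\<bar>s\<bar> \<le> n"
        using ps n by (auto intro!: zdvd_imp_le simp flip: ps)
      have "Re (w * of_int s) = Re (of_int p * z + of_int q)" using eqw True by simp
      then have "real_of_int q = s * Re w - p * Re z" by (simp add: mult.commute)
      also have "\<bar>\<dots>\<bar> \<le> \<bar>s * Re w\<bar> + \<bar>p * Re z\<bar>" by (rule abs_triangle_ineq4)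
      also have "\<dots> \<le> real_of_int n * (1/2) + real_of_int n * (1/2)"
        unfolding abs_mult using sp rez by (intro add_mono mult_mono) auto
      finally have "\<bar>q\<bar> \<le> n" by linarith
      moreover have "n \<le> B" using nn n by (simp add: B_def)
      ultimately have "\<bar>p\<bar> \<le> B" "\<bar>q\<bar> \<le> B" "\<bar>r\<bar> \<le> B" "\<bar>s\<bar> \<le> B" using sp True n by linarith+
      then show ?thesis using al by blast
    next
      case False
      have r1: "(real_of_int r)\<^sup>2 \<ge> 1" using False by (simp flip: of_int_power add: int_one_le_iff_zero_less)
      have "(r * y)\<^sup>2 \<le> n * y / v" using J J2 zero_le_power2[of "r * Re z + s"] by linarith
      then have "(real_of_int r)\<^sup>2 * (y * v) \<le> n" using yv by (simp add: power_mult_distrib field_simps power2_eq_square)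
      moreover have yv4: "y * v \<ge> 1/4" using mult_mono[OF yv] yv by simp
      ultimately have "(real_of_int r)\<^sup>2 * (1/4) \<le> n"
        using mult_left_mono[OF yv4, of "(real_of_int r)\<^sup>2"] by simp
      then have rb: "\<bar>r\<bar> \<le> 4 * n" by (intro square_le_imp_abs_le_int) simp
      have "1 * (y * v) \<le> (real_of_int r)\<^sup>2 * (y * v)" using r1 yv by (intro mult_right_mono) auto
      then have yvn: "y * v \<le> n" using \<open>(real_of_int r)\<^sup>2 * (y * v) \<le> n\<close> by linarith
      have "y * (1/2) \<le> y * v" "(1/2) * v \<le> y * v" using yv by (auto intro!: mult_left_mono mult_right_mono)
      then have y2: "y \<le> 2 * real_of_int n" "v \<le> 2 * real_of_int n" using yvn by linarith+
      have yvq: "n * y / v \<le> (2 * real_of_int n)\<^sup>2"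
      proof -
        have "n * y / v \<le> n * (2 * real_of_int n) / (1/2)" using y2 yv n by (intro frac_le mult_mono) auto
        then show ?thesis by (simp add: power2_eq_square)
      qed
      have sx: "\<bar>r * Re z + s\<bar> \<le> 2 * real_of_int n"
      proof (rule power2_le_imp_le)
        show "\<bar>r * Re z + s\<bar>\<^sup>2 \<le> (2 * real_of_int n)\<^sup>2" unfolding power2_abs using yvq J J2 zero_le_power2[of "r * y"] by linarith
      qed (use n in simp)
      have "\<bar>r * Re z\<bar> \<le> (4 * real_of_int n) * (1/2)" unfolding abs_mult using rb rez by (intro mult_mono) auto
      then have "\<bar>real_of_int s\<bar> \<le> 4 * real_of_int n" using sx by linarith
      then have sb: "\<bar>s\<bar> \<le> 4 * n" by linarith
      \<comment> \<open>The counterpart of \<open>sx\<close> with z and w exchanged, by means of (p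
        - r w) (r z + s) = n.\<close>
      have px: "\<bar>p - r * Re w\<bar> \<le> 2 * real_of_int n"
      proof -
        define u where "u = - of_int r * w + of_int p"
        have "u * (of_int r * z + of_int s) = of_int p * (of_int r * z + of_int s) - of_int r * (w * (of_int r * z + of_int s))"
          by (simp add: u_def algebra_simps)
        also have "\<dots> = of_int (p * s - q * r)" unfolding eqw by (simp add: algebra_simps)
        finally have "u * jfac \<alpha> z = of_int n" using det by (simp add: al)
        from arg_cong[OF this, of norm] have "norm u * norm (jfac \<alpha> z) = n"
          using n by (simp add: norm_mult)
        from arg_cong[OF this, of "\<lambda>x. x\<^sup>2"] have "(norm u)\<^sup>2 * (n * y / v) = (real_of_int n)\<^sup>2"
          unfolding power_mult_distrib J .
        moreover have "n * y / v \<noteq> 0" using n yv by simp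
        ultimately have "(norm u)\<^sup>2 = (real_of_int n)\<^sup>2 / (n * y / v)" by (subst eq_divide_eq) simp
        also have "\<dots> = n * v / y" using n by (simp add: power2_eq_square)
        also have "\<dots> \<le> n * (2 * real_of_int n) / (1/2)" using y2 yv n by (intro frac_le mult_mono) auto
        also have "\<dots> = (2 * real_of_int n)\<^sup>2" by (simp add: power2_eq_square)
        finally have "norm u \<le> 2 * real_of_int n" by (rule power2_le_imp_le) (use n in simp)
        then show ?thesis using abs_Re_le_cmod[of u] by (simp add: u_def)
      qed
      have "\<bar>r * Re w\<bar> \<le> (4 * real_of_int n) * (1/2)" unfolding abs_mult using rb rez by (intro mult_mono) auto
      then have "\<bar>real_of_int p\<bar> \<le> 4 * real_of_int n" using px by linarith
      then have pb: "\<bar>p\<bar> \<le> 4 * n" by linarith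
      \<comment> \<open>The remaining entry comes from the determinant: q r = p s - n with |r| >=
        1.\<close>
      have "\<bar>q\<bar> * 1 \<le> \<bar>q\<bar> * \<bar>r\<bar>" using False by (intro mult_left_mono) auto
      also have "\<dots> = \<bar>p * s - n\<bar>" using det by (simp flip: abs_mult)
      also have "\<dots> \<le> \<bar>p\<bar> * \<bar>s\<bar> + n" using n by (simp flip: abs_mult)
      also have "\<dots> \<le> (4 * n) * (4 * n) + n" using pb sb by (intro add_mono mult_mono) auto
      finally have "\<bar>q\<bar> \<le> 16 * (n * n) + n" by simp
      moreover have "4 * n \<le> B" "16 * (n * n) + n \<le> B" using nn n by (auto simp: B_def)
      ultimately have "\<bar>p\<bar> \<le> B" "\<bar>q\<bar> \<le> B" "\<bar>r\<bar> \<le> B" "\<bar>s\<bar> \<le> B" using pb sb rb by linarith+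
      then show ?thesis using al by blast
    qed
  qed
  then show ?thesis by (rule finite_subset) (rule finite_mats_bounded)
qed

lemma madj_ret_mats:
  assumes "n > 0" "\<alpha> \<in> ret_mats n"
  shows "madj \<alpha> \<in> ret_mats n"
proof -
  obtain z where z: "mdet \<alpha> = n" "z \<in> std_domain" "mob \<alpha> z \<in> std_domain" using assms by (auto simp: ret_mats_def)
  have "mob (madj \<alpha>) (mob \<alpha> z) = z" using z assms by (intro mob_madj) (auto simp: std_domain_def)
  then show ?thesis using z by (auto simp: ret_mats_def intro!: bexI[of _ "mob \<alpha> z"])
qed

text \<open>The index pairs (d, b) of the double sum in \<open>hecke_operator\<close>.\<close>

definition hnf_index :: "nat \<Rightarrow> (nat \<times> nat) set" where
  "hnf_index n = (SIGMA d:{d. d dvd n}. {..<d})"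

text \<open>Hermite normal form.\<close>
fun hnf :: "nat \<Rightarrow> nat \<times> nat \<Rightarrow> mat2" where
  "hnf n (d, b) = (int (n div d), int b, 0, int d)"

lemma mdet_hnf: "x \<in> hnf_index n \<Longrightarrow> mdet (hnf n x) = int n"
  by (cases x) (auto simp: hnf_index_def simp flip: of_nat_mult)

text \<open>Row reduction: a Bezout relation clears the first column down to its gcd g, the lower
  right corner becomes d = n / g, and a translation reduces the upper right entry modulo d.\<close>

lemma hnf_surj:
  assumes n: "n > 0" and det: "mdet \<beta> = int n"
  shows "\<exists>\<gamma> x. mdet \<gamma> = 1 \<and> x \<in> hnf_index n \<and> \<beta> = mmul \<gamma> (hnf n x)"
proof -
  obtain p q r s where be: "\<beta> = (p, q, r, s)" by (cases \<beta> rule: mdet.cases)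
  have D: "p * s - q * r = int n" using det be by simp
  define g where "g = gcd p r"
  have "p \<noteq> 0 \<or> r \<noteq> 0" using D n by auto
  then have g: "g > 0" by (auto simp: g_def)
  obtain p' r' where pr: "p = g * p'" "r = g * r'" unfolding g_def by (meson dvdE gcd_dvd1 gcd_dvd2)
  obtain u v where "u * p + v * r = g" using bezout_int[of p r] by (auto simp: g_def)
  then have "g * (u * p' + v * r') = g * 1" by (simp add: pr algebra_simps)
  then have uv: "u * p' + v * r' = 1" using g by simp
  define d where "d = p' * s - r' * q"
  have gd: "g * d = int n" using D by (simp add: d_def pr algebra_simps)
  then have d: "d > 0" using g n by (metis of_nat_0_less_iff zero_less_mult_pos)
  define b0 where "b0 = u * q + v * s"
  define t b where "t = b0 div d" and "b = b0 mod d"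
  have b: "0 \<le> b" "b < d" "b0 = b + t * d" using d by (auto simp: b_def t_def)
  define \<gamma> where "\<gamma> = (p', p' * t - v, r', r' * t + u)"
  have "mdet \<gamma> = 1" using uv by (simp add: \<gamma>_def algebra_simps)
  moreover have "(nat d, nat b) \<in> hnf_index n"
  proof -
    have "nat g * nat d = nat (g * d)" using g by (simp add: nat_mult_distrib)
    then have "nat g * nat d = n" by (simp add: gd)
    then have "nat d dvd n" by (metis dvd_triv_right)
    then show ?thesis using b d by (simp add: hnf_index_def)
  qed
  moreover have "\<beta> = mmul \<gamma> (hnf n (nat d, nat b))"
  proof -
    have "int (n div nat d) = int n div d" using d by (simp add: zdiv_int)
    also have "\<dots> = g" using gd d by (metis nonzero_mult_div_cancel_right less_irrefl)
    finally have nd: "int (n div nat d) = g" .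
    have q: "q = p' * b + (p' * t - v) * d"
    proof -
      have "p' * b + (p' * t - v) * d = p' * b0 - v * d" using b(3) by (simp add: algebra_simps)
      also have "\<dots> = q * (u * p' + v * r')" by (simp add: b0_def d_def algebra_simps)
      finally show ?thesis using uv by simp
    qed
    have s: "s = r' * b + (r' * t + u) * d"
    proof -
      have "r' * b + (r' * t + u) * d = r' * b0 + u * d" using b(3) by (simp add: algebra_simps)
      also have "\<dots> = s * (u * p' + v * r')" by (simp add: b0_def d_def algebra_simps)
      finally show ?thesis using uv by simp
    qed
    show ?thesis using nd q s b d by (simp add: be \<gamma>_def pr)
  qed
  ultimately show ?thesis by blast
qed

text \<open>The first column of a unimodular matrix is coprime, so the gcd of the first column of
  the product is n / d and determines d. What remains is a multiple of d in b - b', which must be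
  0.\<close>

lemma hnf_inj:
  assumes n: "n > 0" and "mdet \<gamma> = 1" "mdet \<gamma>' = 1" "x \<in> hnf_index n" "x' \<in> hnf_index n"
    and eq: "mmul \<gamma> (hnf n x) = mmul \<gamma>' (hnf n x')"
  shows "\<gamma> = \<gamma>' \<and> x = x'"
proof -
  obtain A B C D where g: "\<gamma> = (A, B, C, D)" by (cases \<gamma> rule: mdet.cases)
  obtain A' B' C' D' where g': "\<gamma>' = (A', B', C', D')" by (cases \<gamma>' rule: mdet.cases)
  obtain d b where x: "x = (d, b)" by (cases x)
  obtain d' b' where x': "x' = (d', b')" by (cases x')
  define e e' where "e = int (n div d)" and "e' = int (n div d')"
  have db: "d dvd n" "b < d" "d' dvd n" "b' < d'" using assms x x' by (auto simp: hnf_index_def)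
  have ed: "e * int d = int n" "e' * int d' = int n" using db by (auto simp: e_def e'_def simp flip: of_nat_mult)
  have dt: "A * D - B * C = 1" "A' * D' - B' * C' = 1" using assms g g' by auto
  have cop: "gcd A C = 1" "gcd A' C' = 1"
  proof -
    have "gcd A C dvd A * D - B * C" by (intro dvd_diff dvd_mult dvd_mult2) auto
    then show "gcd A C = 1" using dt by simp
    have "gcd A' C' dvd A' * D' - B' * C'" by (intro dvd_diff dvd_mult dvd_mult2) auto
    then show "gcd A' C' = 1" using dt by simp
  qed
  have E: "A * e = A' * e'" "C * e = C' * e'" "A * int b + B * int d = A' * int b' + B' * int d'"
    "C * int b + D * int d = C' * int b' + D' * int d'"
    using eq by (auto simp: g g' x x' e_def e'_def)
  have "gcd (A * e) (C * e) = e"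
    using gcd_mult_distrib_int[of e A C] cop by (simp add: mult.commute e_def)
  moreover have "gcd (A' * e') (C' * e') = e'"
    using gcd_mult_distrib_int[of e' A' C'] cop by (simp add: mult.commute e'_def)
  ultimately have ee: "e = e'" using E by simp
  have e0: "e \<noteq> 0" using ed n by auto
  have dd: "d = d'" using ed ee e0 by (metis mult_left_cancel of_nat_eq_iff)
  have AA: "A = A'" "C = C'" using E ee e0 by auto
  have dvd1: "int d dvd A * (int b - int b')" "int d dvd C * (int b - int b')"
  proof -
    have "A * (int b - int b') = (B' - B) * int d" "C * (int b - int b') = (D' - D) * int d"
      using E dd AA by (simp_all add: algebra_simps)
    then show "int d dvd A * (int b - int b')" "int d dvd C * (int b - int b')" by auto
  qed
  have "int d dvd D * (A * (int b - int b')) - B * (C * (int b - int b'))"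
    by (rule dvd_diff[OF dvd_mult[OF dvd1(1)] dvd_mult[OF dvd1(2)]])
  also have "D * (A * (int b - int b')) - B * (C * (int b - int b')) = (A * D - B * C) * (int b - int b')"
    by (simp add: algebra_simps)
  also have "\<dots> = int b - int b'" using dt by simp
  finally have dv: "int d dvd int b - int b'" .
  have bb: "b = b'"
  proof (rule ccontr)
    assume "b \<noteq> b'"
    then have "int d \<le> \<bar>int b - int b'\<bar>" using dvd_imp_le_int[OF _ dv] by simp
    then show False using db dd by auto
  qed
  have d0: "int d \<noteq> 0" using db by auto
  have "B = B'" "D = D'" using E(3,4) AA bb dd d0 by auto
  then show ?thesis using AA bb dd by (simp add: g g' x x')
qed

section \<open>Hecke eigenvalues are real\<close>

locale hecke_eigenform = level_one_cusp_form +
  assumes hecke: "n \<ge> 1 \<Longrightarrow> \<exists>c. \<forall>z. Im z > 0 \<longrightarrow> hecke_operator k n f z = c * f z"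
begin

text \<open>Matrices are collected rather than points, so stabilisers, including the sign, are
  counted; the weights below are normalised accordingly.\<close>

definition orbit_mats :: "complex \<Rightarrow> mat2 set" where
  "orbit_mats w = {\<gamma>. mdet \<gamma> = 1 \<and> mob \<gamma> w \<in> std_domain}"

text \<open>
  Summed over an orbit of the modular group these weights give \<open>1\<close>. Points on the boundary of the
  standard domain are shared between the domains they touch, so that no strict fundamental domain is needed.
\<close>
definition hw :: "complex \<Rightarrow> real" where
  "hw z = indicator std_domain z / (\<Sum>\<gamma>\<in>ret_mats 1. indicator std_domain (mob \<gamma> z))"

text \<open>The integrand \<open>(f|\<alpha>)(z) cnj (f z) y\<^sup>k\<close> of the Petersson product, without normalisation in \<open>det \<alpha>\<close>.\<close>
definition G :: "mat2 \<Rightarrow> complex \<Rightarrow> complex" where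
  "G \<alpha> z = f (mob \<alpha> z) * jfac \<alpha> z powi (- k) * cnj (f z) * of_real (Im z powi k)"

lemma orbit_mats_std_domain: "z \<in> std_domain \<Longrightarrow> orbit_mats z = {\<gamma>\<in>ret_mats 1. mob \<gamma> z \<in> std_domain}"
  by (auto simp: orbit_mats_def ret_mats_def)

lemma finite_orbit_mats_std_domain: "z \<in> std_domain \<Longrightarrow> finite (orbit_mats z)"
  using finite_ret_mats[of 1] by (simp add: orbit_mats_std_domain)

lemma hw_std_domain:
  assumes "z \<in> std_domain"
  shows "hw z = 1 / card (orbit_mats z)"
proof -
  have "(\<Sum>\<gamma>\<in>ret_mats 1. indicator std_domain (mob \<gamma> z) :: real) = card (orbit_mats z)"
    unfolding orbit_mats_std_domain[OF assms] using finite_ret_mats[of 1]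
    by (simp add: indicator_def sum.If_cases Int_def)
  then show ?thesis using assms by (simp add: hw_def)
qed

text \<open>Right multiplication by \<open>\<gamma>0\<close> identifies the matrices for the two
  points, with the adjugate as inverse; the cardinality thus depends on the orbit alone.\<close>

lemma orbit_mats_card:
  assumes w: "Im w > 0" and g: "\<gamma>0 \<in> orbit_mats w"
  shows "finite (orbit_mats w)" "card (orbit_mats (mob \<gamma>0 w)) = card (orbit_mats w)"
proof -
  have g0: "mdet \<gamma>0 = 1" "mob \<gamma>0 w \<in> std_domain" using g by (auto simp: orbit_mats_def)
  have nz: "jfac \<gamma>0 w \<noteq> 0" using g0 w by (intro mdet_nonzero_jfac) auto
  have bij: "bij_betw (\<lambda>\<gamma>. mmul \<gamma> \<gamma>0) (orbit_mats (mob \<gamma>0 w)) (orbit_mats w)"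
  proof (rule bij_betw_byWitness[where f' = "\<lambda>\<gamma>. mmul \<gamma> (madj \<gamma>0)"])
    have I: "mmul (mmul \<gamma> \<gamma>0) (madj \<gamma>0) = \<gamma>" "mmul (mmul \<gamma> (madj \<gamma>0)) \<gamma>0 = \<gamma>" for \<gamma>
    proof -
      have "mmul \<gamma>0 (madj \<gamma>0) = (1, 0, 0, 1)" "mmul (madj \<gamma>0) \<gamma>0 = (1, 0, 0, 1)"
        using g0(1) by (cases \<gamma>0 rule: mdet.cases; simp add: algebra_simps)+
      then show "mmul (mmul \<gamma> \<gamma>0) (madj \<gamma>0) = \<gamma>" "mmul (mmul \<gamma> (madj \<gamma>0)) \<gamma>0 = \<gamma>"
        unfolding mmul_assoc by (cases \<gamma> rule: mdet.cases; simp)+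
    qed
    show "\<forall>\<gamma>\<in>orbit_mats (mob \<gamma>0 w). mmul (mmul \<gamma> \<gamma>0) (madj \<gamma>0) = \<gamma>"
      "\<forall>\<gamma>\<in>orbit_mats w. mmul (mmul \<gamma> (madj \<gamma>0)) \<gamma>0 = \<gamma>" using I by auto
    show "(\<lambda>\<gamma>. mmul \<gamma> \<gamma>0) ` orbit_mats (mob \<gamma>0 w) \<subseteq> orbit_mats w"
      using g0 nz by (auto simp: orbit_mats_def mdet_mmul mob_mmul)
    show "(\<lambda>\<gamma>. mmul \<gamma> (madj \<gamma>0)) ` orbit_mats w \<subseteq> orbit_mats (mob \<gamma>0 w)"
    proof (clarsimp simp: orbit_mats_def mdet_mmul g0)
      fix p q r s assume a: "p * s - q * r = 1" "(of_int p * w + of_int q) / (of_int r * w + of_int s) \<in> std_domain"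
      have im: "Im (mob \<gamma>0 w) > 0" using g0 by (simp add: std_domain_def)
      have nz': "jfac (madj \<gamma>0) (mob \<gamma>0 w) \<noteq> 0" using g0 im by (intro mdet_nonzero_jfac) auto
      have "mob (mmul (p, q, r, s) (madj \<gamma>0)) (mob \<gamma>0 w) = mob (p, q, r, s) w"
        using mob_mmul[OF nz', of "(p, q, r, s)"] mob_madj(2)[of \<gamma>0 w] g0 w by simp
      then show "mob (mmul (p, q, r, s) (madj \<gamma>0)) (mob \<gamma>0 w) \<in> std_domain" using a by simp
    qed
  qed
  show "finite (orbit_mats w)" using bij_betw_finite[OF bij] finite_orbit_mats_std_domain[OF g0(2)] by simp
  show "card (orbit_mats (mob \<gamma>0 w)) = card (orbit_mats w)" using bij_betw_same_card[OF bij] .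
qed

lemma sum_hw_orbit:
  assumes w: "Im w > 0"
  shows "(\<Sum>\<gamma>\<in>orbit_mats w. hw (mob \<gamma> w)) = 1"
proof -
  obtain \<gamma>0 where g0: "\<gamma>0 \<in> orbit_mats w" using exists_std_domain[OF w] by (auto simp: orbit_mats_def)
  have fin: "finite (orbit_mats w)" using orbit_mats_card[OF w g0] by simp
  have "(\<Sum>\<gamma>\<in>orbit_mats w. hw (mob \<gamma> w)) = (\<Sum>\<gamma>\<in>orbit_mats w. 1 / card (orbit_mats w))"
  proof (rule sum.cong)
    fix \<gamma> assume g: "\<gamma> \<in> orbit_mats w"
    then have "mob \<gamma> w \<in> std_domain" by (simp add: orbit_mats_def)
    then show "hw (mob \<gamma> w) = 1 / card (orbit_mats w)" using orbit_mats_card(2)[OF w g] by (simp add: hw_std_domain)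
  qed simp
  also have "\<dots> = 1" using fin g0 by auto
  finally show ?thesis .
qed

lemma hw_bounds:
  "0 \<le> hw z" "hw z \<le> 1" "z \<notin> std_domain \<Longrightarrow> hw z = 0"
proof -
  have "(1, 0, 0, 1) \<in> orbit_mats z" if "z \<in> std_domain" using that by (simp add: orbit_mats_def)
  then have "z \<in> std_domain \<Longrightarrow> card (orbit_mats z) > 0"
    using finite_orbit_mats_std_domain by (metis card_gt_0_iff empty_iff)
  then show "0 \<le> hw z" "hw z \<le> 1"
    by (cases "z \<in> std_domain"; simp add: hw_std_domain; simp add: hw_def)+
qed (simp add: hw_def)

text \<open>A lower bound uniform in z, from which positivity of the Petersson norm will
  follow.\<close>

lemma hw_lower: "z \<in> std_domain \<Longrightarrow> hw z \<ge> 1 / card (ret_mats 1)"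
proof -
  assume z: "z \<in> std_domain"
  have "card (orbit_mats z) \<le> card (ret_mats 1)"
    unfolding orbit_mats_std_domain[OF z] using finite_ret_mats[of 1] by (intro card_mono) auto
  moreover have "(1, 0, 0, 1) \<in> orbit_mats z" using z by (simp add: orbit_mats_def)
  then have "card (orbit_mats z) > 0" using finite_orbit_mats_std_domain[OF z] by (metis card_gt_0_iff empty_iff)
  ultimately show ?thesis unfolding hw_std_domain[OF z] by (intro divide_left_mono mult_pos_pos) auto
qed

lemma measurable_hw [measurable]: "hw \<in> borel_measurable borel"
  unfolding hw_def by measurable

text \<open>The cocycle of \<gamma> cancels against the modularity of f, so \<open>G\<close> depends
  only on the left coset of the modular group.\<close>

lemma G_mmul:
  assumes "mdet \<gamma> = 1" "mdet \<alpha> > 0" "Im z > 0"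
  shows "G (mmul \<gamma> \<alpha>) z = G \<alpha> z"
proof -
  define w where "w = mob \<alpha> z"
  have nz: "jfac \<alpha> z \<noteq> 0" using assms by (intro mdet_nonzero_jfac)
  have w: "Im w > 0" using Im_mob_pos assms by (simp add: w_def)
  have jw: "jfac \<gamma> w \<noteq> 0" using assms w by (intro mdet_nonzero_jfac) auto
  have "f (mob (mmul \<gamma> \<alpha>) z) = jfac \<gamma> w powi k * f w"
    using modular[OF assms(1) w] by (simp add: mob_mmul[OF nz] w_def)
  moreover have "jfac (mmul \<gamma> \<alpha>) z powi (- k) = jfac \<gamma> w powi (- k) * jfac \<alpha> z powi (- k)"
    by (simp add: jfac_mmul[OF nz] w_def power_int_mult_distrib)
  moreover have "jfac \<gamma> w powi k * jfac \<gamma> w powi (- k) = 1" using jw by (simp add: power_int_minus)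
  moreover have "G (mmul \<gamma> \<alpha>) z = (jfac \<gamma> w powi k * jfac \<gamma> w powi (- k)) * G \<alpha> z"
    using calculation(1,2) unfolding G_def w_def[symmetric] by (simp only: mult_ac)
  ultimately show ?thesis by simp
qed

text \<open>For w the image of z under the adjugate, the two automorphy factors multiply to n = det
  \<alpha>, and Im w = n Im z / |j|^2. All powers of n cancel, and the two values of f change
  places.\<close>

lemma G_madj:
  assumes det: "mdet \<alpha> > 0" and z: "Im z > 0"
  shows "G \<alpha> (mob (madj \<alpha>) z) = cnj (G (madj \<alpha>) z)"
proof -
  define n where "n = mdet \<alpha>"
  define w where "w = mob (madj \<alpha>) z"
  define j where "j = jfac (madj \<alpha>) z"
  have n0: "n > 0" using det by (simp add: n_def)
  have j0: "j \<noteq> 0" unfolding j_def using assms by (intro mdet_nonzero_jfac) auto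
  have jj: "jfac \<alpha> w * j = of_int n" using mob_madj(3)[OF assms] by (simp add: w_def j_def n_def)
  have imw: "Im w = of_int n * Im z / (norm j)\<^sup>2" by (simp add: w_def Im_mob j_def n_def)
  have "jfac \<alpha> w = of_int n / j" using jj j0 by (simp add: field_simps)
  then have "jfac \<alpha> w powi (- k) * of_real (Im w powi k) = (of_int n / j) powi (- k) * (of_int n * of_real (Im z) / (of_real (norm j))\<^sup>2) powi k"
    by (simp add: imw of_real_power_int)
  also have "(of_real (norm j))\<^sup>2 = j * cnj j" by (simp flip: complex_norm_square of_real_power)
  also have "(of_int n / j) powi (- k) * (of_int n * of_real (Im z) / (j * cnj j)) powi k = ((of_int n / j) powi (- k) * (of_int n / j) powi k) * (of_real (Im z) / cnj j) powi k"
    by (simp add: power_int_mult_distrib[symmetric] mult.assoc)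
  also have "\<dots> = cnj (j powi (- k) * of_real (Im z powi k))"
    using n0 j0 by (simp add: power_int_minus power_int_mult_distrib power_int_inverse of_real_power_int divide_inverse; simp add: field_simps)
  finally have e: "jfac \<alpha> w powi (- k) * of_real (Im w powi k) = cnj (j powi (- k) * of_real (Im z powi k))" .
  have "G \<alpha> w = f z * cnj (f w) * (jfac \<alpha> w powi (- k) * of_real (Im w powi k))"
    using mob_madj(1)[OF assms] by (simp add: G_def w_def)
  also have "\<dots> = cnj (G (madj \<alpha>) z)" unfolding e by (simp add: G_def w_def j_def)
  finally show ?thesis by (simp add: w_def)
qed

lemma G_bound:
  assumes det: "mdet \<alpha> > 0"
  obtains C where "C > 0" "\<And>z. Im z > 0 \<Longrightarrow> norm (G \<alpha> z) \<le> C"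
proof -
  obtain C where C: "C > 0" "\<And>z. Im z > 0 \<Longrightarrow> norm (f z) * Im z powr (k / 2) \<le> C" using f_bound by blast
  define n where "n = real_of_int (mdet \<alpha>)"
  have n: "n > 0" using det by (simp add: n_def)
  have "norm (G \<alpha> z) \<le> C * C * n powr (- k / 2)" if z: "Im z > 0" for z
  proof -
    define w where "w = mob \<alpha> z"
    define J where "J = norm (jfac \<alpha> z)"
    have J: "J > 0" using mdet_nonzero_jfac[OF det z] by (simp add: J_def)
    have w: "Im w > 0" using Im_mob_pos[OF det z] by (simp add: w_def)
    have "Im w = n * Im z / J\<^sup>2" by (simp add: w_def Im_mob J_def n_def)
    then have iw: "Im w powr (k / 2) = n powr (k / 2) * Im z powr (k / 2) * J powr (- k)"
    proof -
      have "J\<^sup>2 = J powr 2" using J by simp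
      then have "(J\<^sup>2) powr (k / 2) = J powr k" by (simp only: powr_powr) simp
      moreover have "Im w powr (k / 2) = (n * Im z) powr (k / 2) / (J\<^sup>2) powr (k / 2)"
        unfolding \<open>Im w = n * Im z / J\<^sup>2\<close> by (rule powr_divide)
      ultimately show ?thesis by (simp only: powr_mult powr_minus divide_inverse of_int_minus)
    qed
    have Jk: "J powi (- k) = J powr (- k)" using J powr_real_of_int'[of J "- k"] by simp
    have yk: "Im z powi k = Im z powr (k / 2) * Im z powr (k / 2)"
      using z powr_real_of_int'[of "Im z" k] by (simp flip: powr_add)
    have "norm (G \<alpha> z) = norm (f w) * J powi (- k) * norm (f z) * \<bar>Im z powi k\<bar>"
      using z by (simp add: G_def norm_mult norm_power_int w_def J_def zero_less_power_int abs_of_pos)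
    also have "\<dots> = norm (f w) * J powr (- k) * norm (f z) * (Im z powr (k / 2) * Im z powr (k / 2))"
      unfolding Jk yk by simp
    also have "\<dots> = (norm (f w) * (n powr (k / 2) * Im z powr (k / 2) * J powr (- k))) * (norm (f z) * Im z powr (k / 2)) * n powr (- k / 2)"
      using n by (simp add: powr_minus field_simps)
    also have "\<dots> \<le> C * C * n powr (- k / 2)"
      unfolding iw[symmetric] using C(2)[OF w] C(2)[OF z] C(1) by (intro mult_right_mono mult_mono) auto
    finally show ?thesis .
  qed
  then show thesis using that[of "C * C * n powr (- k / 2)"] C n by simp
qed

lemma G_continuous:
  assumes det: "mdet \<alpha> > 0"
  shows "continuous_on H2 (\<lambda>v. G \<alpha> (iota v))"
proof -
  have ci: "continuous_on A iota" for A using bounded_linear_iota(1) by (rule linear_continuous_on)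
  have cf: "continuous_on A (\<lambda>x. f (g x))" if "continuous_on A g" "\<And>x. x \<in> A \<Longrightarrow> Im (g x) > 0" for A :: "(real^2) set" and g
    by (rule continuous_on_compose2[OF holomorphic_on_imp_continuous_on[OF hol] that(1)]) (use that(2) in \<open>auto simp: upper_half_plane_def\<close>)
  have im: "Im (iota v) > 0" if "v \<in> H2" for v using that by (simp add: H2_def)
  have "continuous_on {z. Im z > 0} (mob \<alpha>)"
    by (rule DERIV_continuous_on[OF has_field_derivative_at_within[OF has_field_derivative_mob]]) (use mdet_nonzero_jfac[OF det] in auto)
  then have cm: "continuous_on H2 (\<lambda>v. mob \<alpha> (iota v))"
    by (rule continuous_on_compose2[OF _ ci]) (use im in auto)
  have cj: "continuous_on H2 (\<lambda>v. jfac \<alpha> (iota v))"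
    by (cases \<alpha> rule: mdet.cases) (auto intro!: continuous_intros ci)
  show ?thesis
    unfolding G_def using im Im_mob_pos[OF det] mdet_nonzero_jfac[OF det]
    by (intro continuous_intros cf cm cj ci) (force simp: H2_def)+
qed

lemma hdens_integrableI:
  assumes m: "(\<lambda>v. F (iota v)) \<in> borel_measurable (lebesgue_on H2)"
    and le: "\<And>z. Im z > 0 \<Longrightarrow> \<bar>F z\<bar> \<le> C * indicator std_domain z"
  shows "hdens F absolutely_integrable_on H2"
proof (rule measurable_bounded_by_integrable_imp_absolutely_integrable[OF _ H2_lebesgue])
  have "(\<lambda>v::real^2. v $ 2) \<in> borel_measurable (lebesgue_on H2)"
    by (intro continuous_imp_measurable_on_sets_lebesgue H2_lebesgue continuous_intros)
  then show "hdens F \<in> borel_measurable (lebesgue_on H2)"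
    unfolding hdens_def using m by simp
  show "(\<lambda>v. C * hdens (indicator std_domain) v) integrable_on H2"
    using integrable_cmul[OF set_lebesgue_integral_eq_integral(1)[OF hdens_std_domain_integrable], of C] by simp
  fix v assume "v \<in> H2"
  then show "norm (hdens F v) \<le> C * hdens (indicator std_domain) v"
    using le[of "iota v"] by (simp add: hdens_def H2_def divide_right_mono)
qed

text \<open>
  The sum of the integrals of \<open>K \<alpha>\<close> over the matrices of determinant \<open>n\<close> unfolds to the imaginary part of
  \<open>\<langle>T\<^sub>n f, f\<rangle>\<close>; the second weight makes the integrand change sign under the substitution that
  exchanges \<open>\<alpha>\<close> with its adjugate.
\<close>
definition K :: "mat2 \<Rightarrow> complex \<Rightarrow> real" where
  "K \<alpha> z = Im (G \<alpha> z) * hw z * hw (mob \<alpha> z)"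

lemma borel_iota_measurable:
  assumes "g \<in> borel_measurable borel"
  shows "(\<lambda>v. g (iota v)) \<in> borel_measurable (lebesgue_on H2)"
proof -
  have "iota \<in> borel_measurable (lebesgue_on H2)"
    using bounded_linear_iota(1) by (intro continuous_imp_measurable_on_sets_lebesgue H2_lebesgue linear_continuous_on)
  then show ?thesis using assms by (rule measurable_compose)
qed

lemma K_integrable:
  assumes det: "mdet \<alpha> > 0"
  shows "hdens (K \<alpha>) absolutely_integrable_on H2"
proof -
  obtain C where C: "C > 0" "\<And>z. Im z > 0 \<Longrightarrow> norm (G \<alpha> z) \<le> C" using G_bound[OF det] by blast
  show ?thesis
  proof (rule hdens_integrableI[where C = C])
    have "(\<lambda>v. Im (G \<alpha> (iota v))) \<in> borel_measurable (lebesgue_on H2)"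
      by (intro continuous_imp_measurable_on_sets_lebesgue H2_lebesgue continuous_intros G_continuous det)
    moreover have "(\<lambda>v. hw (iota v)) \<in> borel_measurable (lebesgue_on H2)"
      "(\<lambda>v. hw (mob \<alpha> (iota v))) \<in> borel_measurable (lebesgue_on H2)"
      by (intro borel_iota_measurable measurable_hw measurable_compose[OF measurable_mob measurable_hw])+
    ultimately show "(\<lambda>v. K \<alpha> (iota v)) \<in> borel_measurable (lebesgue_on H2)"
      unfolding K_def by simp
    fix z assume z: "Im z > 0"
    show "\<bar>K \<alpha> z\<bar> \<le> C * indicator std_domain z"
    proof (cases "z \<in> std_domain")
      case True
      have "\<bar>K \<alpha> z\<bar> = \<bar>Im (G \<alpha> z)\<bar> * hw z * hw (mob \<alpha> z)"
        using hw_bounds by (simp add: K_def abs_mult)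
      also have "\<dots> \<le> C * 1 * 1"
        using hw_bounds C(2)[OF z] C(1) abs_Im_le_cmod[of "G \<alpha> z"] by (intro mult_mono) auto
      finally show ?thesis using True by simp
    qed (simp add: K_def hw_bounds)
  qed
qed

text \<open>Substitution by the adjugate preserves the measure, exchanges the two weights and
  conjugates \<open>G\<close>, so the imaginary part changes sign.\<close>

lemma integral_K_madj:
  assumes det: "mdet \<alpha> > 0"
  shows "integral H2 (hdens (K (madj \<alpha>))) = - integral H2 (hdens (K \<alpha>))"
proof -
  have "integral H2 (hdens (\<lambda>z. K \<alpha> (mob (madj \<alpha>) z))) = integral H2 (hdens (K \<alpha>))"
    using hdens_change_of_variables[of "madj \<alpha>" "K \<alpha>" "integral H2 (hdens (K \<alpha>))"] K_integrable[OF det] det by simp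
  moreover have "integral H2 (hdens (\<lambda>z. K \<alpha> (mob (madj \<alpha>) z))) = integral H2 (\<lambda>v. - hdens (K (madj \<alpha>)) v)"
  proof (rule Henstock_Kurzweil_Integration.integral_cong)
    fix v assume "v \<in> H2"
    then have z: "Im (iota v) > 0" by (simp add: H2_def)
    have "K \<alpha> (mob (madj \<alpha>) (iota v)) = - K (madj \<alpha>) (iota v)"
      using G_madj[OF det z] mob_madj(1)[OF det z] by (simp add: K_def)
    then show "hdens (\<lambda>z. K \<alpha> (mob (madj \<alpha>) z)) v = - hdens (K (madj \<alpha>)) v" by (simp add: hdens_def)
  qed
  ultimately show ?thesis by simp
qed

text \<open>Adjugation permutes \<open>ret_mats n\<close>, so the sum is its own negative. This is
  the self-adjointness of T_n in the form that is applied.\<close>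

lemma sum_integral_K_eq_0:
  assumes n: "n > 0"
  shows "(\<Sum>\<alpha>\<in>ret_mats n. integral H2 (hdens (K \<alpha>))) = 0"
proof -
  have bij: "bij_betw madj (ret_mats n) (ret_mats n)"
    by (rule bij_betw_byWitness[where f' = madj]) (use madj_ret_mats[OF n] in auto)
  have "(\<Sum>\<alpha>\<in>ret_mats n. integral H2 (hdens (K \<alpha>))) = (\<Sum>\<alpha>\<in>ret_mats n. integral H2 (hdens (K (madj \<alpha>))))"
    using sum.reindex_bij_betw[OF bij, of "\<lambda>\<alpha>. integral H2 (hdens (K \<alpha>))"] by simp
  also have "\<dots> = (\<Sum>\<alpha>\<in>ret_mats n. - integral H2 (hdens (K \<alpha>)))"
    using n by (intro sum.cong integral_K_madj) (auto simp: ret_mats_def)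
  finally show ?thesis by (simp add: sum_negf)
qed

text \<open>The bottom row (0, d) of the normal form has constant automorphy factor d, which
  accounts for d^(-k) in the Hecke operator.\<close>

lemma hecke_operator_hnf:
  assumes n: "n \<ge> 1" and z: "Im z > 0"
  shows "hecke_operator k n f z * cnj (f z) * of_real (Im z powi k) = of_nat n powi (k - 1) * (\<Sum>x\<in>hnf_index n. G (hnf n x) z)"
proof -
  have fin: "finite {d. d dvd n}" using n by (intro finite_divisors_nat) auto
  have "(\<Sum>x\<in>hnf_index n. G (hnf n x) z) = (\<Sum>d | d dvd n. \<Sum>b<d. G (hnf n (d, b)) z)"
    unfolding hnf_index_def using fin by (subst sum.Sigma) (auto intro!: sum.cong)
  also have "\<dots> = (\<Sum>d | d dvd n. of_nat d powi (- k) * (\<Sum>b<d. f ((of_nat (n div d) * z + of_nat b) / of_nat d))) * (cnj (f z) * of_real (Im z powi k))"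
    unfolding sum_distrib_left sum_distrib_right by (simp add: G_def mult_ac)
  finally show ?thesis by (simp add: hecke_operator_def mult_ac)
qed

text \<open>Unfolding: for each normal form the total weight 1 of an orbit is inserted, and (x,
  \<gamma>) |-> \<gamma> \<open>hnf n x\<close> meets every matrix of determinant n that takes z
  into the domain exactly once.\<close>

lemma sum_hnf_G:
  assumes n: "n \<ge> 1" and z: "z \<in> std_domain"
  shows "(\<Sum>x\<in>hnf_index n. G (hnf n x) z) = (\<Sum>\<beta>\<in>ret_mats (int n). G \<beta> z * of_real (hw (mob \<beta> z)))"
proof -
  have imz: "Im z > 0" using z by (simp add: std_domain_def)
  have n0: "n > 0" using n by simp
  have fin: "finite (hnf_index n)" unfolding hnf_index_def using n0 by (auto intro!: finite_SigmaI finite_divisors_nat)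
  have im: "Im (mob (hnf n x) z) > 0" and nz: "jfac (hnf n x) z \<noteq> 0" if "x \<in> hnf_index n" for x
    using Im_mob_pos mdet_nonzero_jfac mdet_hnf[OF that] n0 imz by (metis of_nat_0_less_iff)+
  have finO: "finite (orbit_mats w)" if w: "Im w > 0" for w
  proof -
    obtain \<gamma>0 where "\<gamma>0 \<in> orbit_mats w" using exists_std_domain[OF w] by (auto simp: orbit_mats_def)
    then show ?thesis using orbit_mats_card(1)[OF w] by blast
  qed
  define B where "B = {\<beta>. mdet \<beta> = int n \<and> mob \<beta> z \<in> std_domain}"
  define J where "J = (SIGMA x:hnf_index n. orbit_mats (mob (hnf n x) z))"
  have bij: "bij_betw (\<lambda>(x, \<gamma>). mmul \<gamma> (hnf n x)) J B"
  proof (rule bij_betw_imageI)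
    show "inj_on (\<lambda>(x, \<gamma>). mmul \<gamma> (hnf n x)) J"
    proof (rule inj_onI)
      fix u v assume uv: "u \<in> J" "v \<in> J" "(\<lambda>(x, \<gamma>). mmul \<gamma> (hnf n x)) u = (\<lambda>(x, \<gamma>). mmul \<gamma> (hnf n x)) v"
      obtain x \<gamma> x' \<gamma>' where e: "u = (x, \<gamma>)" "v = (x', \<gamma>')" by (metis surj_pair)
      have "\<gamma> = \<gamma>' \<and> x = x'"
        by (rule hnf_inj[OF n0]) (use uv in \<open>auto simp: e J_def orbit_mats_def simp del: hnf.simps\<close>)
      then show "u = v" by (simp add: e)
    qed
    show "(\<lambda>(x, \<gamma>). mmul \<gamma> (hnf n x)) ` J = B"
    proof (intro equalityI subsetI)
      fix \<beta> assume "\<beta> \<in> (\<lambda>(x, \<gamma>). mmul \<gamma> (hnf n x)) ` J"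
      then obtain x \<gamma> where x: "x \<in> hnf_index n" "\<gamma> \<in> orbit_mats (mob (hnf n x) z)" "\<beta> = mmul \<gamma> (hnf n x)"
        by (auto simp: J_def)
      then show "\<beta> \<in> B" using mdet_hnf[OF x(1)] nz[OF x(1)] by (simp add: B_def orbit_mats_def mdet_mmul mob_mmul)
    next
      fix \<beta> assume b: "\<beta> \<in> B"
      then obtain \<gamma> x where x: "mdet \<gamma> = 1" "x \<in> hnf_index n" "\<beta> = mmul \<gamma> (hnf n x)"
        using hnf_surj[OF n0, of \<beta>] by (auto simp: B_def)
      then have "\<gamma> \<in> orbit_mats (mob (hnf n x) z)" using b nz[OF x(2)] by (simp add: B_def orbit_mats_def mob_mmul)
      then show "\<beta> \<in> (\<lambda>(x, \<gamma>). mmul \<gamma> (hnf n x)) ` J" using x by (force simp: J_def)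
    qed
  qed
  have "(\<Sum>x\<in>hnf_index n. G (hnf n x) z) = (\<Sum>x\<in>hnf_index n. \<Sum>\<gamma>\<in>orbit_mats (mob (hnf n x) z). G (mmul \<gamma> (hnf n x)) z * of_real (hw (mob (mmul \<gamma> (hnf n x)) z)))"
  proof (rule sum.cong)
    fix x assume x: "x \<in> hnf_index n"
    have "(\<Sum>\<gamma>\<in>orbit_mats (mob (hnf n x) z). G (mmul \<gamma> (hnf n x)) z * of_real (hw (mob (mmul \<gamma> (hnf n x)) z)))
      = (\<Sum>\<gamma>\<in>orbit_mats (mob (hnf n x) z). G (hnf n x) z * of_real (hw (mob \<gamma> (mob (hnf n x) z))))"
      using mdet_hnf[OF x] n0 imz nz[OF x] by (intro sum.cong refl) (simp add: orbit_mats_def G_mmul mob_mmul)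
    also have "\<dots> = G (hnf n x) z * of_real (\<Sum>\<gamma>\<in>orbit_mats (mob (hnf n x) z). hw (mob \<gamma> (mob (hnf n x) z)))"
      by (simp add: sum_distrib_left)
    also have "\<dots> = G (hnf n x) z" using sum_hw_orbit[OF im[OF x]] by simp
    finally show "G (hnf n x) z = (\<Sum>\<gamma>\<in>orbit_mats (mob (hnf n x) z). G (mmul \<gamma> (hnf n x)) z * of_real (hw (mob (mmul \<gamma> (hnf n x)) z)))" by simp
  qed simp
  also have "\<dots> = (\<Sum>(x, \<gamma>)\<in>J. G (mmul \<gamma> (hnf n x)) z * of_real (hw (mob (mmul \<gamma> (hnf n x)) z)))"
    unfolding J_def using fin finO im by (intro sum.Sigma) auto
  also have "\<dots> = (\<Sum>\<beta>\<in>B. G \<beta> z * of_real (hw (mob \<beta> z)))"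
    using sum.reindex_bij_betw[OF bij, of "\<lambda>\<beta>. G \<beta> z * of_real (hw (mob \<beta> z))"] by (simp add: case_prod_unfold)
  \<comment> \<open>The index set no longer depends on z; matrices that do not bring this particular
    z back have weight 0.\<close>
  also have "\<dots> = (\<Sum>\<beta>\<in>ret_mats (int n). G \<beta> z * of_real (hw (mob \<beta> z)))"
    using finite_ret_mats[of "int n"] n0 z by (intro sum.mono_neutral_left) (auto simp: B_def ret_mats_def hw_bounds)
  finally show ?thesis .
qed

text \<open>By analytic continuation. The open region in question lies inside the standard domain,
  where \<open>hw\<close> is positive.\<close>

lemma exists_f_nonzero: "\<exists>z. Im z > 1 \<and> \<bar>Re z\<bar> < 1/2 \<and> f z \<noteq> 0"
proof (rule ccontr)
  assume neg: "\<not> ?thesis"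
  define U where "U = {z. Im z > 1 \<and> \<bar>Re z\<bar> < 1/2}"
  have openU: "open U" unfolding U_def
    by (intro open_Collect_conj open_Collect_less continuous_intros)
  have "f z = 0" if z: "Im z > 0" for z
  proof (rule analytic_continuation[OF hol])
    show "open upper_half_plane" unfolding upper_half_plane_def by (rule open_halfspace_Im_gt)
    show "connected upper_half_plane" unfolding upper_half_plane_def by (intro convex_connected convex_halfspace_Im_gt)
    show "U \<subseteq> upper_half_plane" by (auto simp: U_def upper_half_plane_def)
    show "2 * \<i> \<in> upper_half_plane" by (simp add: upper_half_plane_def)
    have "2 * \<i> \<in> U" by (simp add: U_def)
    then show "2 * \<i> islimpt U" using openU by (simp add: interior_limit_point interior_open)
    show "f w = 0" if "w \<in> U" for w using that neg by (auto simp: U_def)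
    show "z \<in> upper_half_plane" using z by (simp add: upper_half_plane_def)
  qed
  then have "has_q_expansion f (\<lambda>_. 0)" by (simp add: has_q_expansion_def upper_half_plane_def)
  then have "a = (\<lambda>_. 0)" using has_q_expansion_unique q_exp by blast
  then show False using a1 by simp
qed

definition petersson_density :: "complex \<Rightarrow> real" where
  "petersson_density z = (norm (f z))\<^sup>2 * Im z powi k * hw z"

lemma petersson_density_G: "of_real (petersson_density z) = G (1, 0, 0, 1) z * of_real (hw z)"
  by (simp add: petersson_density_def G_def complex_norm_square[symmetric] del: of_real_power)

lemma petersson_integrable: "hdens petersson_density absolutely_integrable_on H2"
proof -
  have det: "mdet (1, 0, 0, 1) > 0" by simp
  obtain C where C: "C > 0" "\<And>z. Im z > 0 \<Longrightarrow> norm (G (1, 0, 0, 1) z) \<le> C" using G_bound[OF det] by blast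
  have eq: "petersson_density z = Re (G (1, 0, 0, 1) z) * hw z" for z
    using petersson_density_G[of z, THEN arg_cong[of _ _ Re]] by simp
  show ?thesis
  proof (rule hdens_integrableI[where C = C])
    have "(\<lambda>v. Re (G (1, 0, 0, 1) (iota v))) \<in> borel_measurable (lebesgue_on H2)"
      by (intro continuous_imp_measurable_on_sets_lebesgue H2_lebesgue continuous_intros G_continuous det)
    moreover have "(\<lambda>v. hw (iota v)) \<in> borel_measurable (lebesgue_on H2)"
      by (intro borel_iota_measurable measurable_hw)
    ultimately show "(\<lambda>v. petersson_density (iota v)) \<in> borel_measurable (lebesgue_on H2)"
      unfolding eq by simp
    fix z assume z: "Im z > 0"
    show "\<bar>petersson_density z\<bar> \<le> C * indicator std_domain z"
    proof (cases "z \<in> std_domain")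
      case True
      have "\<bar>petersson_density z\<bar> = \<bar>Re (G (1, 0, 0, 1) z)\<bar> * hw z"
        using hw_bounds by (simp add: eq abs_mult)
      also have "\<dots> \<le> C * 1"
        using hw_bounds C(2)[OF z] C(1) abs_Re_le_cmod[of "G (1, 0, 0, 1) z"] by (intro mult_mono) auto
      finally show ?thesis using True by simp
    qed (simp add: eq hw_bounds)
  qed
qed

lemma petersson_pos: "integral H2 (hdens petersson_density) > 0"
proof -
  obtain z0 where z0: "Im z0 > 1" "\<bar>Re z0\<bar> < 1/2" "f z0 \<noteq> 0" using exists_f_nonzero by blast
  define \<psi> where "\<psi> = (\<lambda>v. Re (G (1, 0, 0, 1) (iota v)) / (v $ 2)\<^sup>2)"
  define v0 where "v0 = iota_inv z0"
  have psi: "\<psi> v = (norm (f (iota v)))\<^sup>2 * (v $ 2) powi k / (v $ 2)\<^sup>2" for v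
    by (simp add: \<psi>_def G_def complex_norm_square[symmetric] mult.assoc del: of_real_power_int flip: of_real_mult of_real_power)
  have psi0: "\<psi> v0 > 0" using z0 by (simp add: psi v0_def zero_less_power_int)
  define U where "U = {v::real^2. v $ 2 > 1 \<and> \<bar>v $ 1\<bar> < 1/2}"
  have oU: "open U" unfolding U_def by (intro open_Collect_conj open_Collect_less continuous_intros)
  have UH: "U \<subseteq> H2" by (auto simp: U_def H2_def)
  have "continuous_on U \<psi>" unfolding \<psi>_def
    using continuous_on_subset[OF G_continuous[of "(1,0,0,1)"] UH] by (intro continuous_intros) (auto simp: U_def)
  then have "open {v \<in> U. \<psi> v > \<psi> v0 / 2}"
    using continuous_open_preimage[OF _ oU open_greaterThan[of "\<psi> v0 / 2"]] by (simp add: vimage_def Int_def)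
  moreover have "v0 \<in> {v \<in> U. \<psi> v > \<psi> v0 / 2}" using psi0 z0 by (simp add: U_def v0_def)
  ultimately obtain a b where ab: "cbox a b \<subseteq> {v \<in> U. \<psi> v > \<psi> v0 / 2}" "v0 \<in> box a b"
    and lt: "\<forall>i\<in>Basis. a \<bullet> i < b \<bullet> i"
    by (rule open_contains_cbox)
  have cpos: "measure lborel (cbox a b) > 0"
    using lt by (simp add: content_pos_lt_eq)
  \<comment> \<open>Half the value at \<open>v0\<close>, times the uniform lower bound for
    \<open>hw\<close>.\<close>
  define \<epsilon> where "\<epsilon> = \<psi> v0 / 2 * (1 / card (ret_mats 1))"
  have r1: "card (ret_mats 1) > 0"
  proof -
    have "2 * \<i> \<in> std_domain" by (simp add: std_domain_def)
    then have "(1, 0, 0, 1) \<in> ret_mats 1" by (auto simp: ret_mats_def intro!: bexI[of _ "2 * \<i>"])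
    then show ?thesis using finite_ret_mats[of 1] by (auto simp: card_gt_0_iff)
  qed
  have e: "\<epsilon> > 0" using psi0 r1 by (simp add: \<epsilon>_def)
  have low: "hdens petersson_density v \<ge> \<epsilon>" if v: "v \<in> cbox a b" for v
  proof -
    have vU: "v \<in> U" "\<psi> v > \<psi> v0 / 2" using ab v by auto
    have "norm (iota v) \<ge> 1" using vU abs_Im_le_cmod[of "iota v"] by (simp add: U_def)
    then have S: "iota v \<in> std_domain" using vU by (simp add: std_domain_def U_def)
    have "\<epsilon> \<le> \<psi> v * hw (iota v)" unfolding \<epsilon>_def
      using vU hw_lower[OF S] psi0 by (intro mult_mono) auto
    also have "\<dots> = hdens petersson_density v" by (simp add: psi hdens_def petersson_density_def)
    finally show ?thesis .
  qed
  have nn: "hdens petersson_density v \<ge> 0" if "v \<in> H2" for v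
    using that hw_bounds by (simp add: hdens_def petersson_density_def H2_def)
  have sub: "cbox a b \<subseteq> H2" using ab UH by auto
  have int: "hdens petersson_density integrable_on H2" "hdens petersson_density integrable_on cbox a b"
    using petersson_integrable set_integrable_subset[OF petersson_integrable _ sub] set_lebesgue_integral_eq_integral(1) by auto
  have "0 < \<epsilon> * measure lborel (cbox a b)" using e cpos by simp
  also have "\<dots> = integral (cbox a b) (\<lambda>_. \<epsilon>)" by simp
  also have "\<dots> \<le> integral (cbox a b) (hdens petersson_density)"
    by (intro integral_le int low) auto
  also have "\<dots> \<le> integral H2 (hdens petersson_density)"
    by (intro integral_subset_le sub int) (use nn in auto)
  finally show ?thesis .
qed

text \<open>Integration of the imaginary part of (T_n f) cnj(f) y^k against the weight gives Im c
  times a positive norm on one side and, after unfolding, the vanishing sum over adjugate pairs on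
  the other.\<close>

lemma hecke_eigenvalue_real:
  assumes n: "n \<ge> 1" and c: "\<And>z. Im z > 0 \<Longrightarrow> hecke_operator k n f z = c * f z"
  shows "Im c = 0"
proof -
  have rn: "of_nat n powi (k - 1) = complex_of_real (real n powi (k - 1))" by (simp add: of_real_power_int)
  have key: "Im c * petersson_density z = real n powi (k - 1) * (\<Sum>\<beta>\<in>ret_mats (int n). K \<beta> z)" if z: "Im z > 0" for z
  proof (cases "z \<in> std_domain")
    case True
    have "c * of_real (petersson_density z) = (c * f z) * cnj (f z) * of_real (Im z powi k) * of_real (hw z)"
      by (simp add: petersson_density_def complex_norm_square mult_ac del: of_real_power)
    also have "\<dots> = of_nat n powi (k - 1) * (\<Sum>x\<in>hnf_index n. G (hnf n x) z) * of_real (hw z)"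
      using hecke_operator_hnf[OF n z] c[OF z] by simp
    also have "\<dots> = of_real (real n powi (k - 1)) * (\<Sum>\<beta>\<in>ret_mats (int n). G \<beta> z * of_real (hw z * hw (mob \<beta> z)))"
      unfolding sum_hnf_G[OF n True] rn by (simp add: sum_distrib_left sum_distrib_right mult_ac)
    finally have e: "c * of_real (petersson_density z) = of_real (real n powi (k - 1)) * (\<Sum>\<beta>\<in>ret_mats (int n). G \<beta> z * of_real (hw z * hw (mob \<beta> z)))" .
    define r where "r = real n powi (k - 1)"
    have "Im (c * of_real (petersson_density z)) = Im (of_real (real n powi (k - 1)) * (\<Sum>\<beta>\<in>ret_mats (int n). G \<beta> z * of_real (hw z * hw (mob \<beta> z))))"
      unfolding e ..
    then show ?thesis unfolding r_def[symmetric] by (simp add: K_def mult.assoc del: of_real_mult)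
  qed (simp add: petersson_density_def K_def hw_bounds)
  have fin: "finite (ret_mats (int n))" using n by (intro finite_ret_mats) auto
  have "Im c * integral H2 (hdens petersson_density) = integral H2 (\<lambda>v. Im c * hdens petersson_density v)"
    by simp
  also have "\<dots> = integral H2 (\<lambda>v. real n powi (k - 1) * (\<Sum>\<beta>\<in>ret_mats (int n). hdens (K \<beta>) v))"
  proof (rule Henstock_Kurzweil_Integration.integral_cong)
    fix v assume "v \<in> H2"
    then have "Im (iota v) > 0" by (simp add: H2_def)
    from key[OF this] show "Im c * hdens petersson_density v = real n powi (k - 1) * (\<Sum>\<beta>\<in>ret_mats (int n). hdens (K \<beta>) v)"
      by (simp add: hdens_def flip: sum_divide_distrib)
  qed
  also have "\<dots> = real n powi (k - 1) * (\<Sum>\<beta>\<in>ret_mats (int n). integral H2 (hdens (K \<beta>)))"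
  proof -
    have "hdens (K \<beta>) integrable_on H2" if "\<beta> \<in> ret_mats (int n)" for \<beta>
      using that n K_integrable[of \<beta>] by (intro set_lebesgue_integral_eq_integral(1)) (auto simp: ret_mats_def)
    then show ?thesis using fin by (simp add: integral_sum)
  qed
  also have "\<dots> = 0" using sum_integral_K_eq_0[of "int n"] n by simp
  finally show ?thesis using petersson_pos by simp
qed

section \<open>Hecke eigenvalues as Fourier coefficients\<close>

lemma sum_roots_of_unity:
  assumes d: "d > 0"
  shows "(\<Sum>b<d. cis (2 * pi * real m * real b / real d)) = (if d dvd m then of_nat d else 0)"
proof -
  define x where "x = cis (2 * pi * real m / real d)"
  have xb: "cis (2 * pi * real m * real b / real d) = x ^ b" for b
    unfolding x_def Complex.DeMoivre by (rule arg_cong[of _ _ cis]) simp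
  show ?thesis
  proof (cases "d dvd m")
    case True
    then obtain l where l: "m = d * l" by blast
    have "x = cis (2 * pi * real l)" unfolding x_def l by (rule arg_cong[of _ _ cis]) (use d in simp)
    also have "\<dots> = 1" by (rule cis_multiple_2pi) auto
    finally show ?thesis using True by (simp add: xb)
  next
    case False
    have "x ^ d = cis (2 * pi * real m)"
      unfolding x_def Complex.DeMoivre by (rule arg_cong[of _ _ cis]) (use d in simp)
    also have "\<dots> = 1" by (rule cis_multiple_2pi) auto
    finally have xd: "x ^ d = 1" .
    have "x \<noteq> 1"
    proof
      assume "x = 1"
      then have "cos (2 * pi * real m / real d) = 1" by (simp add: x_def cis.code complex_eq_iff)
      then obtain i :: int where "2 * pi * real m / real d = real_of_int i * 2 * pi"
        using cos_one_2pi_int[of "2 * pi * real m / real d"] by blast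
      then have "2 * pi * real m = 2 * pi * (real_of_int i * real d)" using d by (simp only: field_simps)
      then have "real m = real_of_int i * real d" by (subst (asm) mult_cancel_left) simp
      then have "real_of_int (int m) = real_of_int (i * int d)" by simp
      then have "int m = i * int d" by (rule of_int_eq_iff[THEN iffD1])
      then have "int d dvd int m" by simp
      then show False using False by simp
    qed
    then show ?thesis using xd False by (simp add: xb sum_gp_strict)
  qed
qed

text \<open>The sum over b retains the indices m divisible by d, with a factor d; m = d l then
  contributes to the exponent l n / d. The two reindexings in \<open>main\<close> record
  this.\<close>

lemma hecke_q_expansion:
  assumes n: "n \<ge> 1"
  shows "has_q_expansion (hecke_operator k n f)
     (\<lambda>j. of_nat n powi (k - 1) * (\<Sum>d | d dvd n. of_nat d powi (- k) * (if (n div d) dvd j then of_nat d * a (d * (j div (n div d))) else 0)))"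
  unfolding has_q_expansion_def
proof
  fix z assume "z \<in> upper_half_plane"
  then have z: "Im z > 0" by (simp add: upper_half_plane_def)
  define q where "q = (\<lambda>j::nat. exp (2 * of_real pi * \<i> * of_nat j * z))"
  have main: "(\<lambda>j. (if e dvd j then of_nat d * a (d * (j div e)) else 0) * q j) sums (\<Sum>b<d. f ((of_nat e * z + of_nat b) / of_nat d))"
    if de: "d > 0" "e > 0" for d e :: nat
  proof -
    define w where "w = (\<lambda>b. (of_nat e * z + of_nat b) / of_nat d)"
    have imw: "Im (w b) > 0" for b using z de by (simp add: w_def Im_divide_of_nat)
    define E where "E = (\<lambda>m::nat. exp (2 * of_real pi * \<i> * of_nat m * (of_nat e * z / of_nat d)))"
    have ex: "exp (2 * of_real pi * \<i> * w b) ^ m = E m * cis (2 * pi * real m * real b / real d)" for b m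
    proof -
      have "of_nat m * (2 * of_real pi * \<i> * w b) = 2 * of_real pi * \<i> * of_nat m * (of_nat e * z / of_nat d) + \<i> * of_real (2 * pi * real m * real b / real d)"
        using de by (simp add: w_def field_simps)
      then show ?thesis by (simp only: E_def exp_of_nat_mult[symmetric] exp_add cis_conv_exp)
    qed
    have "(\<lambda>m. \<Sum>b<d. a m * exp (2 * of_real pi * \<i> * w b) ^ m) sums (\<Sum>b<d. f (w b))"
      by (intro sums_sum f_sums imw)
    also have "(\<lambda>m. \<Sum>b<d. a m * exp (2 * of_real pi * \<i> * w b) ^ m) = (\<lambda>m. if d dvd m then a m * E m * of_nat d else 0)"
    proof
      fix m
      have "(\<Sum>b<d. a m * exp (2 * of_real pi * \<i> * w b) ^ m) = a m * E m * (\<Sum>b<d. cis (2 * pi * real m * real b / real d))"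
        unfolding ex sum_distrib_left by (simp only: mult.assoc)
      then show "(\<Sum>b<d. a m * exp (2 * of_real pi * \<i> * w b) ^ m) = (if d dvd m then a m * E m * of_nat d else 0)"
        using sum_roots_of_unity[OF de(1), of m] by simp
    qed
    finally have "(\<lambda>m. if d dvd m then a m * E m * of_nat d else 0) sums (\<Sum>b<d. f (w b))" .
    then have "(\<lambda>l. if d dvd d * l then a (d * l) * E (d * l) * of_nat d else 0) sums (\<Sum>b<d. f (w b))"
      using de by (subst sums_mono_reindex[of "\<lambda>l. d * l"]) (auto simp: strict_mono_def)
    then have "(\<lambda>l. a (d * l) * E (d * l) * of_nat d) sums (\<Sum>b<d. f (w b))" by simp
    also have "(\<lambda>l. a (d * l) * E (d * l) * of_nat d) = (\<lambda>l. (if e dvd e * l then of_nat d * a (d * (e * l div e)) else 0) * q (e * l))"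
    proof
      fix l
      have "E (d * l) = q (e * l)" unfolding E_def q_def by (rule arg_cong[of _ _ exp]) (use de in simp)
      then show "a (d * l) * E (d * l) * of_nat d = (if e dvd e * l then of_nat d * a (d * (e * l div e)) else 0) * q (e * l)"
        using de by simp
    qed
    finally have "(\<lambda>l. (if e dvd e * l then of_nat d * a (d * (e * l div e)) else 0) * q (e * l)) sums (\<Sum>b<d. f (w b))" .
    then show ?thesis unfolding w_def
      using de by (subst (asm) sums_mono_reindex[of "\<lambda>l. e * l" "\<lambda>j. (if e dvd j then of_nat d * a (d * (j div e)) else 0) * q j"])
        (auto simp: strict_mono_def)
  qed
  have "(\<lambda>j. of_nat n powi (k - 1) * (\<Sum>d | d dvd n. of_nat d powi (- k) * ((if (n div d) dvd j then of_nat d * a (d * (j div (n div d))) else 0) * q j)))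
     sums (of_nat n powi (k - 1) * (\<Sum>d | d dvd n. of_nat d powi (- k) * (\<Sum>b<d. f ((of_nat (n div d) * z + of_nat b) / of_nat d))))"
  proof (intro sums_mult sums_sum main)
    fix d assume "d \<in> {d. d dvd n}"
    then have d: "d dvd n" by simp
    then show "d > 0" "n div d > 0" using n by (auto simp: dvd_pos_nat div_greater_zero_iff dvd_imp_le)
  qed
  moreover have "of_nat n powi (k - 1) * (\<Sum>d | d dvd n. of_nat d powi (- k) * ((if (n div d) dvd j then of_nat d * a (d * (j div (n div d))) else 0) * q j))
    = of_nat n powi (k - 1) * (\<Sum>d | d dvd n. of_nat d powi (- k) * (if (n div d) dvd j then of_nat d * a (d * (j div (n div d))) else 0)) * q j" for j
    by (simp only: sum_distrib_right mult.assoc)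
  ultimately show "(\<lambda>j. of_nat n powi (k - 1) * (\<Sum>d | d dvd n. of_nat d powi (- k) * (if (n div d) dvd j then of_nat d * a (d * (j div (n div d))) else 0)) * exp (2 * of_real pi * \<i> * of_nat j * z)) sums hecke_operator k n f z"
    unfolding hecke_operator_def by (simp only: q_def)
qed

text \<open>Comparison of the coefficients of index 1: n / d divides 1 only for d = n, and the
  powers of n cancel.\<close>

lemma hecke_eigenvalue_eq:
  assumes n: "n \<ge> 1" and c: "\<And>z. Im z > 0 \<Longrightarrow> hecke_operator k n f z = c * f z"
  shows "c = a n"
proof -
  let ?b = "\<lambda>j. of_nat n powi (k - 1) * (\<Sum>d | d dvd n. of_nat d powi (- k) * (if (n div d) dvd j then of_nat d * a (d * (j div (n div d))) else 0))"
  have "has_q_expansion (hecke_operator k n f) (\<lambda>j. c * a j)"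
    unfolding has_q_expansion_def
  proof
    fix z assume z: "z \<in> upper_half_plane"
    then have "(\<lambda>j. c * (a j * exp (2 * of_real pi * \<i> * of_nat j * z))) sums (c * f z)"
      using q_exp by (intro sums_mult) (simp add: has_q_expansion_def)
    then show "(\<lambda>j. c * a j * exp (2 * of_real pi * \<i> * of_nat j * z)) sums hecke_operator k n f z"
      using c z by (simp add: upper_half_plane_def mult.assoc)
  qed
  then have "(\<lambda>j. c * a j) = ?b" using has_q_expansion_unique hecke_q_expansion[OF n] by blast
  from fun_cong[OF this, of 1] have "c = of_nat n powi (k - 1) * (\<Sum>d | d dvd n. of_nat d powi (- k) * (if (n div d) dvd 1 then of_nat d * a (d * (1 div (n div d))) else 0))"
    using a1 by simp
  also have "(\<Sum>d | d dvd n. of_nat d powi (- k) * (if (n div d) dvd 1 then of_nat d * a (d * (1 div (n div d))) else 0))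
     = (\<Sum>d\<in>{n}. of_nat d powi (- k) * (of_nat d * a d))"
  proof (rule sum.mono_neutral_cong_right)
    show "finite {d. d dvd n}" using n by (intro finite_divisors_nat) auto
    show "\<forall>i\<in>{d. d dvd n} - {n}. of_nat i powi (- k) * (if n div i dvd 1 then of_nat i * a (i * (1 div (n div i))) else 0) = 0"
      using n by (auto simp: dvd_div_eq_iff)
  qed (use n in auto)
  also have "of_nat n powi (k - 1) * \<dots> = a n"
  proof -
    have "of_nat n powi (k - 1) * (of_nat n powi (- k) * of_nat n) = (1 :: complex)"
      using n by (simp add: power_int_diff power_int_minus)
    then show ?thesis using n by (simp add: mult.assoc[symmetric])
  qed
  finally show ?thesis .
qed

lemma a_real: "Im (a n) = 0"
proof (cases "n \<ge> 1")
  case True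
  obtain c where "\<And>z. Im z > 0 \<Longrightarrow> hecke_operator k n f z = c * f z" using hecke[OF True] by blast
  then show ?thesis using hecke_eigenvalue_real[OF True] hecke_eigenvalue_eq[OF True] by blast
next
  case False
  then show ?thesis using a0 by (simp add: not_le)
qed

end

section \<open>The derivatives of the L-function\<close>

lemma higher_deriv_exp_linear: "(deriv ^^ m) (\<lambda>s. exp (c * s)) = (\<lambda>s. c ^ m * exp (c * s :: complex))"
proof (induction m)
  case (Suc m)
  have "(deriv ^^ Suc m) (\<lambda>s. exp (c * s)) = deriv (\<lambda>s. c ^ m * exp (c * s))" using Suc by simp
  also have "\<dots> = (\<lambda>s. c ^ Suc m * exp (c * s))"
    by (rule ext, rule DERIV_imp_deriv) (auto intro!: derivative_eq_intros)
  finally show ?case .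
qed simp

text \<open>Cauchy's inequality on circles of radius 1. Its repeated use is why half-planes and
  strips shrink by one unit later on.\<close>

lemma higher_deriv_norm_le:
  fixes F :: "complex \<Rightarrow> complex"
  assumes F: "F holomorphic_on S" "cball s 1 \<subseteq> S" and B: "\<And>w. norm (s - w) = 1 \<Longrightarrow> norm (F w) \<le> B"
  shows "norm ((deriv ^^ m) F s) \<le> fact m * B"
proof -
  have "norm ((deriv ^^ m) F s) \<le> fact m * B / 1 ^ m"
  proof (rule Cauchy_inequality)
    show "F holomorphic_on ball s 1" using F holomorphic_on_subset ball_subset_cball by blast
    show "continuous_on (cball s 1) F" using F holomorphic_on_imp_continuous_on holomorphic_on_subset by blast
  qed (use B in auto)
  then show ?thesis by simp
qed

lemma higher_deriv_cnj:
  fixes F :: "complex \<Rightarrow> complex"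
  assumes "F holomorphic_on UNIV" "\<And>z. F (cnj z) = cnj (F z)"
  shows "(deriv ^^ m) F (cnj z) = cnj ((deriv ^^ m) F z)"
  using assms
proof (induction m arbitrary: F z)
  case (Suc m)
  have d: "deriv F (cnj w) = cnj (deriv F w)" for w
  proof -
    have "(F has_field_derivative deriv F w) (at w)" using Suc.prems(1) holomorphic_derivI by blast
    then have "((cnj \<circ> F \<circ> cnj) has_field_derivative cnj (deriv F w)) (at (cnj w))"
      using has_field_derivative_cnj_cnj[of F "deriv F w" "cnj w"] by simp
    moreover have "cnj \<circ> F \<circ> cnj = F" using Suc.prems(2) by (auto simp: fun_eq_iff)
    ultimately show ?thesis by (metis DERIV_imp_deriv)
  qed
  have "(deriv ^^ m) (deriv F) (cnj z) = cnj ((deriv ^^ m) (deriv F) z)"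
    using Suc.prems(1) d by (intro Suc.IH) (auto intro: holomorphic_deriv)
  then show ?case by (simp add: funpow_swap1)
qed simp

lemma not_nonpos_Int: "Re z > 0 \<or> Im z \<noteq> 0 \<Longrightarrow> (z :: complex) \<notin> \<int>\<^sub>\<le>\<^sub>0"
  by (auto elim!: nonpos_Ints_cases)

section \<open>Growth of the L-function in vertical strips\<close>

context level_one_cusp_form
begin

lemma norm_nat_powr: "norm (of_nat (Suc n) powr (- s) :: complex) = real (Suc n) powr (- Re s)"
  using norm_powr_real_powr[of "of_nat (Suc n)" "- s"] by simp

lemma Lfun_reflect:
  assumes "Re (1 - s) + \<kappa> > 0"
  shows "Lfun s = inverse (\<i> powi k) * of_real (2 * pi) powr (2 * s - 1) * rGamma (s + of_real \<kappa>) * Gamma (1 - s + of_real \<kappa>) * Lfun (1 - s)"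
proof -
  define z where "z = 1 - s + of_real \<kappa>"
  have "z \<notin> \<int>\<^sub>\<le>\<^sub>0" using assms by (intro not_nonpos_Int) (simp add: z_def)
  then have G: "Gamma z * rGamma z = 1" by (simp add: rGamma_inverse_Gamma Gamma_eq_zero_iff)
  have p: "of_real (2 * pi) powr (2 * s - 1) * of_real (2 * pi) powr z = (of_real (2 * pi) powr (s + of_real \<kappa>) :: complex)"
    by (simp add: powr_add[symmetric] z_def)
  have w: "inverse (\<i> powi k) * \<i> powi k = (1 :: complex)" by simp
  have "inverse (\<i> powi k) * of_real (2 * pi) powr (2 * s - 1) * rGamma (s + of_real \<kappa>) * Gamma z * Lfun (1 - s)
    = (inverse (\<i> powi k) * \<i> powi k) * (of_real (2 * pi) powr (2 * s - 1) * of_real (2 * pi) powr z) * (Gamma z * rGamma z) * rGamma (s + of_real \<kappa>) * \<Lambda> s"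
    by (simp add: Lfun_def[of "1 - s"] Lambda_reflect z_def[symmetric] mult_ac)
  also have "\<dots> = Lfun s" unfolding w p G by (simp add: Lfun_def)
  finally show ?thesis by (simp add: z_def)
qed

lemma summable_lam_Suc: "\<sigma> > 1 \<Longrightarrow> summable (\<lambda>n. norm (lam (Suc n)) * real (Suc n) powr (- \<sigma>))"
  using summable_lam[of \<sigma>] by (subst summable_Suc_iff[where f = "\<lambda>n. norm (lam n) * real n powr (- \<sigma>)"])

lemma Lfun_right_bound:
  obtains B where "B > 0" "\<And>s. Re s \<ge> 2 \<Longrightarrow> norm (Lfun s) \<le> B"
proof -
  define B where "B = (\<Sum>n. norm (lam (Suc n)) * real (Suc n) powr (- 2))"
  have B0: "B \<ge> 0" unfolding B_def by (intro suminf_nonneg summable_lam_Suc) auto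
  have "norm (Lfun s) \<le> B" if s: "Re s \<ge> 2" for s
  proof -
    have "Lfun s = (\<Sum>n. lam (Suc n) * of_nat (Suc n) powr (- s))"
      using Lambda_sums[of s] s by (intro sums_unique) auto
    also have "norm \<dots> \<le> B" unfolding B_def
    proof (rule norm_suminf_le)
      show "norm (lam (Suc n) * of_nat (Suc n) powr (- s)) \<le> norm (lam (Suc n)) * real (Suc n) powr (- 2)" for n
        unfolding norm_mult norm_nat_powr using s by (intro mult_left_mono powr_mono) auto
    qed (rule summable_lam_Suc, simp)
    finally show ?thesis .
  qed
  then show thesis using that[of "B + 1"] B0 by fastforce
qed

text \<open>The a priori bound demanded by Phragmen-Lindelof. Only \<open>rGamma\<close> grows;
  \<Lambda> is bounded in strips.\<close>

lemma Lfun_exp_bound: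
  obtains A where "A > 0" "\<And>s. l \<le> Re s \<Longrightarrow> Re s \<le> u \<Longrightarrow> Im s \<ge> 1 \<Longrightarrow> norm (Lfun s) \<le> A * exp (A * Im s)"
proof -
  obtain C where C: "C > 0" "\<And>z. l + \<kappa> \<le> Re z \<Longrightarrow> Re z \<le> u + \<kappa> \<Longrightarrow> \<bar>Im z\<bar> \<ge> 1 \<Longrightarrow> norm (rGamma z :: complex) \<le> C * exp (pi * \<bar>Im z\<bar>)"
    using rGamma_exp_bound by blast
  obtain M where M: "M > 0" "\<And>s. \<bar>Re s - 1/2\<bar> \<le> \<bar>l\<bar> + \<bar>u\<bar> + 1 \<Longrightarrow> norm (\<Lambda> s) \<le> M" using Lambda_bound by blast
  define P where "P = (2 * pi) powr (\<bar>u + \<kappa>\<bar>)"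
  define A where "A = P * C * M + pi"
  have P: "P > 0" by (simp add: P_def)
  have A: "A > 0" using P C M by (simp add: A_def add_pos_pos)
  have "norm (Lfun s) \<le> A * exp (A * Im s)" if s: "l \<le> Re s" "Re s \<le> u" "Im s \<ge> 1" for s
  proof -
    have "norm (of_real (2 * pi) powr (s + of_real \<kappa>) :: complex) = (2 * pi) powr (Re s + \<kappa>)"
      by (subst norm_powr_real_powr) auto
    also have "\<dots> \<le> P" unfolding P_def using s pi_gt3 by (intro powr_mono) auto
    finally have 1: "norm (of_real (2 * pi) powr (s + of_real \<kappa>) :: complex) \<le> P" .
    have 2: "norm (rGamma (s + of_real \<kappa>)) \<le> C * exp (pi * Im s)" using C(2)[of "s + of_real \<kappa>"] s by simp
    have 3: "norm (\<Lambda> s) \<le> M" by (rule M(2)) (use s in linarith)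
    have "norm (Lfun s) \<le> P * (C * exp (pi * Im s)) * M"
      unfolding Lfun_def norm_mult using 1 2 3 P C M by (intro mult_mono) auto
    also have "\<dots> = (P * C * M) * exp (pi * Im s)" by simp
    also have "\<dots> \<le> A * exp (A * Im s)"
    proof (intro mult_mono)
      have "pi \<le> A" using P C M by (simp add: A_def)
      then show "exp (pi * Im s) \<le> exp (A * Im s)" using s by simp
    qed (use A in \<open>auto simp: A_def\<close>)
    finally show ?thesis .
  qed
  then show thesis using that A by blast
qed

text \<open>At real part - M the number 1 - s + \<kappa> is the conjugate of s + \<kappa> plus the
  integer 2 M + 1. The Gamma quotient is therefore a Pochhammer product of that degree in absolute
  value.\<close>

lemma Lfun_edge_bound:
  fixes M :: nat
  assumes M: "M \<ge> 1"
  obtains B where "B > 0" "\<And>s. Re s = - real M \<Longrightarrow> Im s \<ge> 1 \<Longrightarrow> norm (Lfun s) \<le> B * norm s ^ (2 * M + 1)"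
proof -
  obtain B where B: "B > 0" "\<And>s. Re s \<ge> 2 \<Longrightarrow> norm (Lfun s) \<le> B" using Lfun_right_bound by blast
  define D where "D = 1 + \<bar>\<kappa>\<bar> + (2 * real M + 1)"
  have D0: "D \<ge> 0" by (simp add: D_def)
  have "norm (Lfun s) \<le> (D ^ (2 * M + 1) * B) * norm s ^ (2 * M + 1)" if s: "Re s = - real M" "Im s \<ge> 1" for s
  proof -
    define w where "w = s + of_real \<kappa>"
    have wni: "w \<notin> \<int>\<^sub>\<le>\<^sub>0" using s by (intro not_nonpos_Int) (simp add: w_def)
    have eq: "1 - s + of_real \<kappa> = cnj w + of_nat (2 * M + 1)" using s by (simp add: w_def complex_eq_iff)
    have n1: "norm s \<ge> 1" using s abs_Im_le_cmod[of s] by linarith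
    have "Re (1 - s) + \<kappa> > 0" using s M kappa_ge by simp
    from Lfun_reflect[OF this] have "norm (Lfun s) = (2 * pi) powr (- 2 * real M - 1) * (norm (rGamma w) * norm (Gamma (cnj w + of_nat (2 * M + 1)))) * norm (Lfun (1 - s))"
      using s by (simp add: norm_mult norm_inverse norm_power_int norm_powr_real_powr eq w_def[symmetric] del: of_nat_add of_nat_Suc)
    also have "\<dots> = (2 * pi) powr (- 2 * real M - 1) * norm (pochhammer (cnj w) (2 * M + 1)) * norm (Lfun (1 - s))"
      by (simp only: norm_rGamma_mult_Gamma_cnj[OF wni])
    also have "\<dots> \<le> 1 * (D * norm s) ^ (2 * M + 1) * B"
    proof (intro mult_mono)
      have "(2 * pi) powr (- 2 * real M - 1) \<le> (2 * pi) powr 0" using pi_gt3 by (intro powr_mono) auto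
      then show "(2 * pi) powr (- 2 * real M - 1) \<le> 1" using pi_gt_zero by simp
      have "norm (pochhammer (cnj w) (2 * M + 1)) = (\<Prod>i<2 * M + 1. norm (cnj w + of_nat i))"
        by (simp add: pochhammer_prod prod_norm lessThan_atLeast0)
      also have "\<dots> \<le> (\<Prod>i<2 * M + 1. D * norm s)"
      proof (intro prod_mono conjI)
        fix i assume "i \<in> {..<2 * M + 1}"
        then have i: "real i \<le> 2 * real M + 1" by auto
        have "norm (cnj w + of_nat i) \<le> norm (cnj w) + norm (of_nat i :: complex)" by (rule norm_triangle_ineq)
        also have "norm (cnj w) \<le> norm s + \<bar>\<kappa>\<bar>" using norm_triangle_ineq[of s "of_real \<kappa>"] unfolding complex_mod_cnj by (simp add: w_def)
        also have "norm s + \<bar>\<kappa>\<bar> + norm (of_nat i :: complex) \<le> norm s * 1 + \<bar>\<kappa>\<bar> * 1 + (2 * real M + 1) * 1" using i by simp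
        also have "\<dots> \<le> norm s * 1 + \<bar>\<kappa>\<bar> * norm s + (2 * real M + 1) * norm s"
          using n1 by (intro add_mono mult_left_mono) auto
        also have "\<dots> = D * norm s" by (simp add: D_def algebra_simps)
        finally show "norm (cnj w + of_nat i) \<le> D * norm s" by simp
      qed auto
      finally show "norm (pochhammer (cnj w) (2 * M + 1)) \<le> (D * norm s) ^ (2 * M + 1)" by simp
      show "norm (Lfun (1 - s)) \<le> B" using B(2)[of "1 - s"] s M by simp
    qed (use D0 B in auto)
    finally show ?thesis by (simp add: power_mult_distrib mult_ac)
  qed
  moreover have "D ^ (2 * M + 1) * B > 0" using B by (simp add: D_def add_pos_nonneg)
  ultimately show thesis using that by blast
qed

text \<open>Phragmen-Lindelof between the abscissas - M and 2; further right the Dirichlet series is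
  bounded.\<close>

lemma Lfun_growth:
  fixes M :: nat
  assumes M: "M \<ge> 1"
  obtains C where "C > 0" "\<And>s. Re s \<ge> - real M \<Longrightarrow> Im s \<ge> 1 \<Longrightarrow> norm (Lfun s) \<le> C * norm s ^ (2 * M + 1)"
proof -
  obtain B1 where B1: "B1 > 0" "\<And>s. Re s = - real M \<Longrightarrow> Im s \<ge> 1 \<Longrightarrow> norm (Lfun s) \<le> B1 * norm s ^ (2 * M + 1)"
    using Lfun_edge_bound[OF M] by blast
  obtain B2 where B2: "B2 > 0" "\<And>s. Re s \<ge> 2 \<Longrightarrow> norm (Lfun s) \<le> B2" using Lfun_right_bound by blast
  have right: "norm (Lfun s) \<le> B2 * norm s ^ (2 * M + 1)" if "Re s \<ge> 2" "Im s \<ge> 1" for s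
  proof -
    have "norm s \<ge> 1" using that abs_Im_le_cmod[of s] by linarith
    then have "B2 * 1 \<le> B2 * norm s ^ (2 * M + 1)" using B2 by (intro mult_left_mono one_le_power) auto
    then show ?thesis using B2(2)[OF that(1)] by simp
  qed
  obtain A where A: "A > 0" "\<And>s. - real M \<le> Re s \<Longrightarrow> Re s \<le> 2 \<Longrightarrow> Im s \<ge> 1 \<Longrightarrow> norm (Lfun s) \<le> A * exp (A * Im s)"
    using Lfun_exp_bound by blast
  have "\<exists>C. \<forall>s. - real M \<le> Re s \<longrightarrow> Re s \<le> 2 \<longrightarrow> Im s \<ge> 1 \<longrightarrow> norm (Lfun s) \<le> C * norm s ^ (2 * M + 1)"
  proof (rule phragmen_lindelof_half_strip[OF Lfun_holomorphic, where A = A and B = "max B1 B2"])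
    fix s assume s: "Re s = - real M \<or> Re s = 2" "Im s \<ge> 1"
    have "B1 * norm s ^ (2 * M + 1) \<le> max B1 B2 * norm s ^ (2 * M + 1)" "B2 * norm s ^ (2 * M + 1) \<le> max B1 B2 * norm s ^ (2 * M + 1)"
      by (intro mult_right_mono; simp)+
    then show "norm (Lfun s) \<le> max B1 B2 * norm s ^ (2 * M + 1)"
      using B1(2)[of s] right[of s] s by fastforce
  qed (use A in auto)
  then obtain C where C: "\<And>s. - real M \<le> Re s \<Longrightarrow> Re s \<le> 2 \<Longrightarrow> Im s \<ge> 1 \<Longrightarrow> norm (Lfun s) \<le> C * norm s ^ (2 * M + 1)"
    by blast
  have "norm (Lfun s) \<le> (\<bar>C\<bar> + B2) * norm s ^ (2 * M + 1)" if s: "Re s \<ge> - real M" "Im s \<ge> 1" for s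
  proof (cases "Re s \<le> 2")
    case True
    then have "norm (Lfun s) \<le> C * norm s ^ (2 * M + 1)" using C s by blast
    also have "\<dots> \<le> (\<bar>C\<bar> + B2) * norm s ^ (2 * M + 1)" using B2 by (intro mult_right_mono) auto
    finally show ?thesis .
  next
    case False
    then have "norm (Lfun s) \<le> B2 * norm s ^ (2 * M + 1)" using right s by simp
    also have "\<dots> \<le> (\<bar>C\<bar> + B2) * norm s ^ (2 * M + 1)" by (intro mult_right_mono) auto
    finally show ?thesis .
  qed
  moreover have "\<bar>C\<bar> + B2 > 0" using B2 by simp
  ultimately show thesis using that by blast
qed

lemma Lfun_deriv_growth:
  obtains C n where "\<And>s. \<bar>Re s - \<beta>\<bar> \<le> R \<Longrightarrow> Im s \<ge> 2 \<Longrightarrow> norm ((deriv ^^ m) Lfun s) \<le> C * Im s ^ n"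
proof -
  define M where "M = nat \<lceil>\<bar>\<beta>\<bar> + \<bar>R\<bar>\<rceil> + 1"
  have M: "M \<ge> 1" "real M \<ge> \<bar>\<beta>\<bar> + \<bar>R\<bar> + 1" by (auto simp: M_def)
  obtain C where C: "C > 0" "\<And>s. Re s \<ge> - real M \<Longrightarrow> Im s \<ge> 1 \<Longrightarrow> norm (Lfun s) \<le> C * norm s ^ (2 * M + 1)"
    using Lfun_growth[OF M(1)] by blast
  define D where "D = real M + 1"
  have "norm ((deriv ^^ m) Lfun s) \<le> (fact m * C * (2 * D) ^ (2 * M + 1)) * Im s ^ (2 * M + 1)" if s: "\<bar>Re s - \<beta>\<bar> \<le> R" "Im s \<ge> 2" for s
  proof -
    have "norm s \<le> \<bar>Re s\<bar> + \<bar>Im s\<bar>" by (rule cmod_le)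
    also have "\<dots> \<le> real M * 1 + Im s" using s M by (simp add: abs_le_iff) linarith
    also have "\<dots> \<le> real M * Im s + Im s" using s by (intro add_right_mono mult_left_mono) auto
    finally have ns: "norm s \<le> D * Im s" by (simp add: D_def algebra_simps)
    have D1: "D \<ge> 1" by (simp add: D_def)
    have "norm ((deriv ^^ m) Lfun s) \<le> fact m * (C * (2 * D * Im s) ^ (2 * M + 1))"
    proof (rule higher_deriv_norm_le[OF Lfun_holomorphic])
      fix w assume w: "norm (s - w) = 1"
      have "\<bar>Re s - Re w\<bar> \<le> 1" "\<bar>Im s - Im w\<bar> \<le> 1"
        using w abs_Re_le_cmod[of "s - w"] abs_Im_le_cmod[of "s - w"] by auto
      then have "norm (Lfun w) \<le> C * norm w ^ (2 * M + 1)" using s M by (intro C(2)) (auto simp: abs_le_iff)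
      also have "\<dots> \<le> C * (2 * D * Im s) ^ (2 * M + 1)"
      proof (intro mult_left_mono power_mono)
        have "norm w \<le> norm s + 1" using w norm_triangle_ineq4[of s "s - w"] by simp
        also have "\<dots> \<le> D * Im s + D * Im s" using ns mult_mono[of 1 D 1 "Im s"] D1 s by simp
        finally show "norm w \<le> 2 * D * Im s" by simp
      qed (use C in auto)
      finally show "norm (Lfun w) \<le> C * (2 * D * Im s) ^ (2 * M + 1)" .
    qed simp
    then show ?thesis by (simp add: power_mult_distrib mult_ac)
  qed
  then show thesis using that by blast
qed

section \<open>The derivatives far to the right\<close>

definition nmin :: nat where "nmin = (LEAST n. n > 1 \<and> lam n \<noteq> 0)"

lemma nmin: "nmin > 1" "lam nmin \<noteq> 0" "1 < n \<Longrightarrow> n < nmin \<Longrightarrow> lam n = 0"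
proof -
  have "nmin > 1 \<and> lam nmin \<noteq> 0" unfolding nmin_def by (rule LeastI_ex) (rule exists_lam_nonzero)
  then show "nmin > 1" "lam nmin \<noteq> 0" by auto
  show "1 < n \<Longrightarrow> n < nmin \<Longrightarrow> lam n = 0" using not_less_Least[of n "\<lambda>n. n > 1 \<and> lam n \<noteq> 0"] by (auto simp: nmin_def)
qed

text \<open>The term of index n_f is written with \<open>exp\<close> so that its derivatives are
  explicit.\<close>

definition Ltail :: "complex \<Rightarrow> complex" where
  "Ltail s = Lfun s - (1 + lam nmin * exp (- of_real (ln (real nmin)) * s))"

lemma Ltail_holomorphic: "Ltail holomorphic_on UNIV"
  unfolding Ltail_def by (intro holomorphic_intros Lfun_holomorphic)

text \<open>Beyond n_f the factor n^(2 - Re s) is at most its value at n_f + 1, and the remaining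
  series converges at abscissa 2.\<close>

lemma Ltail_bound:
  obtains C where "C > 0" "\<And>s. Re s \<ge> 2 \<Longrightarrow> norm (Ltail s) \<le> C * (real nmin + 1) powr (- Re s)"
proof -
  define N where "N = nmin"
  have N: "N > 1" using nmin by (simp add: N_def)
  define B where "B = (\<Sum>n. norm (lam (Suc n)) * real (Suc n) powr (- 2))"
  have B0: "B \<ge> 0" unfolding B_def by (intro suminf_nonneg summable_lam_Suc) auto
  have "norm (Ltail s) \<le> (B * (real N + 1)\<^sup>2) * (real N + 1) powr (- Re s)" if s: "Re s \<ge> 2" for s
  proof -
    define t where "t = (\<lambda>n. lam (Suc n) * of_nat (Suc n) powr (- s))"
    have ts: "t sums Lfun s" using Lambda_sums[of s] s by (simp add: t_def)
    have nt: "norm (t n) = norm (lam (Suc n)) * real (Suc n) powr (- Re s)" for n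
      unfolding t_def norm_mult norm_nat_powr ..
    have "(\<Sum>n<N. t n) = (\<Sum>n\<in>{0, N - 1}. t n)"
    proof (rule sum.mono_neutral_right)
      show "\<forall>i\<in>{..<N} - {0, N - 1}. t i = 0"
        using nmin(3) by (auto simp: t_def N_def)
    qed (use N in auto)
    also have "\<dots> = t 0 + t (N - 1)" using N by simp
    also have "t 0 = 1" by (simp add: t_def lam_1)
    also have "t (N - 1) = lam nmin * exp (- of_real (ln (real nmin)) * s)"
      using N by (simp add: t_def N_def powr_def Ln_of_nat mult.commute)
    finally have "Ltail s = Lfun s - (\<Sum>n<N. t n)" by (simp add: Ltail_def)
    also have "\<dots> = (\<Sum>n. t (n + N))"
      using suminf_minus_initial_segment[OF sums_summable[OF ts], of N] ts by (simp add: sums_iff)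
    also have "norm \<dots> \<le> (\<Sum>n. norm (lam (Suc (n + N))) * real (Suc (n + N)) powr (- 2) * (real N + 1) powr (2 - Re s))"
    proof (rule norm_suminf_le)
      fix n
      have "real (Suc (n + N)) powr (- Re s) = real (Suc (n + N)) powr (- 2) * real (Suc (n + N)) powr (2 - Re s)"
        by (simp add: powr_add[symmetric])
      also have "\<dots> \<le> real (Suc (n + N)) powr (- 2) * (real N + 1) powr (2 - Re s)"
        using s by (intro mult_left_mono powr_mono2') auto
      finally show "norm (t (n + N)) \<le> norm (lam (Suc (n + N))) * real (Suc (n + N)) powr (- 2) * (real N + 1) powr (2 - Re s)"
        unfolding nt mult.assoc by (intro mult_left_mono) auto
      show "summable (\<lambda>n. norm (lam (Suc (n + N))) * real (Suc (n + N)) powr (- 2) * (real N + 1) powr (2 - Re s))"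
        using summable_ignore_initial_segment[OF summable_lam_Suc[of 2], of N] by (intro summable_mult2) simp
    qed
    also have "\<dots> = (\<Sum>n. norm (lam (Suc (n + N))) * real (Suc (n + N)) powr (- 2)) * (real N + 1) powr (2 - Re s)"
      using summable_ignore_initial_segment[OF summable_lam_Suc[of 2], of N] by (intro suminf_mult2[symmetric]) simp
    also have "\<dots> \<le> B * (real N + 1) powr (2 - Re s)"
    proof (intro mult_right_mono)
      have "B = (\<Sum>n. norm (lam (Suc (n + N))) * real (Suc (n + N)) powr (- 2)) + (\<Sum>n<N. norm (lam (Suc n)) * real (Suc n) powr (- 2))"
        unfolding B_def by (rule suminf_split_initial_segment[OF summable_lam_Suc]) simp
      moreover have "(\<Sum>n<N. norm (lam (Suc n)) * real (Suc n) powr (- 2)) \<ge> 0" by (intro sum_nonneg) auto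
      ultimately show "(\<Sum>n. norm (lam (Suc (n + N))) * real (Suc (n + N)) powr (- 2)) \<le> B" by linarith
    qed auto
    also have "(real N + 1) powr (2 - Re s) = (real N + 1)\<^sup>2 * (real N + 1) powr (- Re s)"
      by (simp add: powr_diff powr_minus divide_inverse)
    finally show ?thesis by (simp add: mult_ac)
  qed
  then have "norm (Ltail s) \<le> (B * (real N + 1)\<^sup>2 + 1) * (real N + 1) powr (- Re s)" if s: "Re s \<ge> 2" for s
    by (rule order_trans[OF _ mult_right_mono]) (use s in auto)
  moreover have "B * (real N + 1)\<^sup>2 + 1 > 0" using B0 by (intro add_nonneg_pos mult_nonneg_nonneg) auto
  ultimately show thesis using that unfolding N_def by blast
qed

text \<open>The logarithm of the index of the dominating term: differentiation kills the constant
  term 1, which leads only for m = 0.\<close>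

definition mu :: "nat \<Rightarrow> real" where "mu m = (if m = 0 then 0 else ln (real nmin))"

text \<open>Cauchy's estimate costs the tail a constant factor only, and (n_f / (n_f + 1))^\<sigma>
  tends to 0. The bound 1/2 keeps the quotient in the right half-plane, where its principal
  logarithm is bounded.\<close>

lemma Lfun_deriv_right:
  obtains c \<beta>0 where "c \<noteq> 0" "\<And>s. Re s \<ge> \<beta>0 \<Longrightarrow> norm ((deriv ^^ m) Lfun s * exp (of_real (mu m) * s) / c - 1) \<le> 1/2"
proof -
  obtain C where C: "C > 0" "\<And>s. Re s \<ge> 2 \<Longrightarrow> norm (Ltail s) \<le> C * (real nmin + 1) powr (- Re s)"
    using Ltail_bound by blast
  define N where "N = real nmin"
  have N: "N > 1" using nmin by (simp add: N_def)
  have Lf: "Lfun s = (1 + lam nmin * exp (- of_real (ln N) * s)) + Ltail s" for s by (simp add: Ltail_def N_def)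
  show thesis
  proof (cases "m = 0")
    case True
    have "((\<lambda>\<sigma>. (1 / N) powr \<sigma>) \<longlongrightarrow> 0) at_top" "((\<lambda>\<sigma>. (1 / (N + 1)) powr \<sigma>) \<longlongrightarrow> 0) at_top"
      using N by real_asymp+
    then have "((\<lambda>\<sigma>. norm (lam nmin) * (1 / N) powr \<sigma> + C * (1 / (N + 1)) powr \<sigma>) \<longlongrightarrow> norm (lam nmin) * 0 + C * 0) at_top"
      by (intro tendsto_intros)
    then have "((\<lambda>\<sigma>. norm (lam nmin) * N powr (- \<sigma>) + C * (N + 1) powr (- \<sigma>)) \<longlongrightarrow> 0) at_top"
      using N by (simp add: powr_minus_divide powr_divide)
    then have "eventually (\<lambda>\<sigma>. norm (lam nmin) * N powr (- \<sigma>) + C * (N + 1) powr (- \<sigma>) < 1/2) at_top"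
      by (rule order_tendstoD) simp
    then obtain \<sigma>0 where s0: "\<And>\<sigma>. \<sigma> \<ge> \<sigma>0 \<Longrightarrow> norm (lam nmin) * N powr (- \<sigma>) + C * (N + 1) powr (- \<sigma>) < 1/2"
      by (auto simp: eventually_at_top_linorder)
    show thesis
    proof (rule that[of 1 "max \<sigma>0 2"])
      fix s assume s: "Re s \<ge> max \<sigma>0 2"
      have "norm (Lfun s - 1) \<le> norm (lam nmin * exp (- of_real (ln N) * s)) + norm (Ltail s)"
        using norm_triangle_ineq[of "lam nmin * exp (- of_real (ln N) * s)" "Ltail s"] by (simp add: Lf)
      also have "\<dots> \<le> norm (lam nmin) * N powr (- Re s) + C * (N + 1) powr (- Re s)"
        using C(2)[of s] s N by (simp add: norm_mult powr_def N_def[symmetric] mult.commute)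
      also have "\<dots> < 1/2" using s0 s by simp
      finally show "norm ((deriv ^^ m) Lfun s * exp (of_real (mu m) * s) / 1 - 1) \<le> 1/2"
        by (simp add: True mu_def)
    qed simp
  next
    case False
    define c where "c = lam nmin * (- of_real (ln N)) ^ m"
    have c0: "c \<noteq> 0" using nmin N by (simp add: c_def)
    have eq: "(deriv ^^ m) Lfun s = c * exp (- of_real (ln N) * s) + (deriv ^^ m) Ltail s" for s
    proof -
      have "(deriv ^^ m) Lfun s = (deriv ^^ m) (\<lambda>s. (1 + lam nmin * exp (- of_real (ln N) * s)) + Ltail s) s"
        using Lf by (simp only: ext[of Lfun "\<lambda>s. (1 + lam nmin * exp (- of_real (ln N) * s)) + Ltail s"])
      also have "\<dots> = (deriv ^^ m) (\<lambda>s. 1 + lam nmin * exp (- of_real (ln N) * s)) s + (deriv ^^ m) Ltail s"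
        by (rule higher_deriv_add[of _ UNIV]) (auto intro!: holomorphic_intros Ltail_holomorphic)
      also have "(deriv ^^ m) (\<lambda>s. 1 + lam nmin * exp (- of_real (ln N) * s)) s = (deriv ^^ m) (\<lambda>s. 1) s + (deriv ^^ m) (\<lambda>s. lam nmin * exp (- of_real (ln N) * s)) s"
        by (rule higher_deriv_add[of _ UNIV]) (auto intro!: holomorphic_intros)
      also have "(deriv ^^ m) (\<lambda>s. lam nmin * exp (- of_real (ln N) * s)) s = lam nmin * (deriv ^^ m) (\<lambda>s. exp (- of_real (ln N) * s)) s"
        by (rule higher_deriv_cmult[of _ UNIV]) (auto intro!: holomorphic_intros)
      finally show ?thesis using False by (simp only: higher_deriv_exp_linear higher_deriv_const) (simp add: c_def)
    qed
    have "((\<lambda>\<sigma>. fact m * (C * (N + 1) powr (- (\<sigma> - 1))) * N powr \<sigma> / norm c) \<longlongrightarrow> 0) at_top"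
    proof -
      have "((\<lambda>\<sigma>. (N / (N + 1)) powr \<sigma>) \<longlongrightarrow> 0) at_top" using N by real_asymp
      then have "((\<lambda>\<sigma>. fact m * C * (N + 1) / norm c * (N / (N + 1)) powr \<sigma>) \<longlongrightarrow> fact m * C * (N + 1) / norm c * 0) at_top"
        by (intro tendsto_intros)
      moreover have "fact m * (C * (N + 1) powr (- (\<sigma> - 1))) * N powr \<sigma> / norm c = fact m * C * (N + 1) / norm c * (N / (N + 1)) powr \<sigma>" for \<sigma>
        using N by (simp add: powr_diff powr_divide field_simps)
      ultimately show ?thesis by (simp only: mult_zero_right)
    qed
    then have "eventually (\<lambda>\<sigma>. fact m * (C * (N + 1) powr (- (\<sigma> - 1))) * N powr \<sigma> / norm c < 1/2) at_top"
      by (rule order_tendstoD) simp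
    then obtain \<sigma>0 where s0: "\<And>\<sigma>. \<sigma> \<ge> \<sigma>0 \<Longrightarrow> fact m * (C * (N + 1) powr (- (\<sigma> - 1))) * N powr \<sigma> / norm c < 1/2"
      by (auto simp: eventually_at_top_linorder)
    show thesis
    proof (rule that[OF c0, of "max \<sigma>0 3"])
      fix s assume s: "Re s \<ge> max \<sigma>0 3"
      have e: "exp (- of_real (ln N) * s) * exp (of_real (mu m) * s) = 1"
        using False by (simp add: mu_def N_def exp_add[symmetric])
      have "(deriv ^^ m) Lfun s * exp (of_real (mu m) * s) = c * (exp (- of_real (ln N) * s) * exp (of_real (mu m) * s)) + (deriv ^^ m) Ltail s * exp (of_real (mu m) * s)"
        by (simp add: eq algebra_simps)
      then have "(deriv ^^ m) Lfun s * exp (of_real (mu m) * s) / c - 1 = (deriv ^^ m) Ltail s * exp (of_real (mu m) * s) / c"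
        unfolding e using c0 by (simp add: field_simps)
      also have "norm \<dots> = norm ((deriv ^^ m) Ltail s) * N powr (Re s) / norm c"
        using False N by (simp add: norm_mult norm_divide mu_def N_def powr_def mult.commute)
      also have "\<dots> \<le> (fact m * (C * (N + 1) powr (- (Re s - 1)))) * N powr (Re s) / norm c"
      proof (intro divide_right_mono mult_right_mono higher_deriv_norm_le[OF Ltail_holomorphic])
        fix w assume w: "norm (s - w) = 1"
        have re: "\<bar>Re s - Re w\<bar> \<le> 1" using w abs_Re_le_cmod[of "s - w"] by simp
        moreover have "Re s \<ge> 3" using s by simp
        ultimately have "Re w \<ge> 2" by linarith
        then have "norm (Ltail w) \<le> C * (N + 1) powr (- Re w)" using C(2)[of w] by (simp add: N_def)
        also have "\<dots> \<le> C * (N + 1) powr (- (Re s - 1))" using re C N by (intro mult_left_mono powr_mono) auto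
        finally show "norm (Ltail w) \<le> C * (N + 1) powr (- (Re s - 1))" .
      qed auto
      also have "\<dots> < 1/2" using s0[of "Re s"] s by simp
      finally show "norm ((deriv ^^ m) Lfun s * exp (of_real (mu m) * s) / c - 1) \<le> 1/2" by simp
    qed
  qed
qed

end

section \<open>The derivatives far to the left\<close>

lemma open_left_half_plane: "open {s. Re s < (A :: real)}"
  by (rule open_halfspace_Re_lt)

lemma cball_subset_left: "Re s < - A - 1 \<Longrightarrow> cball s 1 \<subseteq> {w. Re w < - A}"
proof
  fix w assume "Re s < - A - 1" "w \<in> cball s 1"
  then show "w \<in> {w. Re w < - A}" using abs_Re_le_cmod[of "s - w"] by (auto simp: dist_norm)
qed

lemma norm_cos_complex_le: "norm (cos (w::complex)) \<le> exp \<bar>Im w\<bar>"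
proof -
  have "norm (cos w) = norm (exp (\<i> * w) + exp (- (\<i> * w))) / 2"
    by (simp add: cos_exp_eq norm_divide)
  also have "\<dots> \<le> (norm (exp (\<i> * w)) + norm (exp (- (\<i> * w)))) / 2"
    by (intro divide_right_mono norm_triangle_ineq) auto
  also have "\<dots> \<le> (exp \<bar>Im w\<bar> + exp \<bar>Im w\<bar>) / 2"
    by (intro divide_right_mono add_mono) auto
  finally show ?thesis by simp
qed

text \<open>
  Each differentiation multiplies by \<open>g' \<approx> - 2 log (- s)\<close>, which dominates the derivative of the sine
  factor; the error \<open>E\<close> is controlled relative to \<open>e\<^bsup>\<pi>|Im s|\<^esup>\<close>, the size of the sine away from its zeros.
\<close>
lemma higher_deriv_exp_sin:
  fixes F g :: "complex \<Rightarrow> complex" and \<kappa> :: real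
  assumes F: "F holomorphic_on UNIV" and g: "g holomorphic_on {s. Re s < - A0}"
    and Fg: "\<And>s. Re s < - A0 \<Longrightarrow> F s = exp (g s) * sin (of_real pi * (s + of_real \<kappa>))"
    and big: "\<And>K. \<exists>A\<ge>A0. \<forall>s. Re s < - A \<longrightarrow> Re (deriv g s) \<le> - K"
    and d2: "\<And>s. Re s < - A0 \<Longrightarrow> norm (deriv (deriv g) s) \<le> C"
  shows "\<exists>A E. A \<ge> A0 \<and> E holomorphic_on {s. Re s < - A} \<and>
     (\<forall>s. Re s < - A \<longrightarrow> (deriv ^^ m) F s = exp (g s) * deriv g s ^ m * (sin (of_real pi * (s + of_real \<kappa>)) + E s)) \<and>
     (\<forall>\<eta>>0. \<exists>A'\<ge>A. \<forall>s. Re s < - A' \<longrightarrow> norm (E s) \<le> \<eta> * exp (pi * \<bar>Im s\<bar>))"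
proof (induction m)
  case 0
  show ?case
    by (rule exI[of _ A0], rule exI[of _ "\<lambda>_. 0"]) (auto simp: Fg)
next
  case (Suc m)
  then obtain A1 E where A1: "A1 \<ge> A0" and E: "E holomorphic_on {s. Re s < - A1}"
    and eq: "\<And>s. Re s < - A1 \<Longrightarrow> (deriv ^^ m) F s = exp (g s) * deriv g s ^ m * (sin (of_real pi * (s + of_real \<kappa>)) + E s)"
    and sm: "\<And>\<eta>. \<eta> > 0 \<Longrightarrow> \<exists>A'\<ge>A1. \<forall>s. Re s < - A' \<longrightarrow> norm (E s) \<le> \<eta> * exp (pi * \<bar>Im s\<bar>)"
    by metis
  obtain A2 where A2: "A2 \<ge> A0" "\<And>s. Re s < - A2 \<Longrightarrow> Re (deriv g s) \<le> - 1" using big[of 1] by blast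
  define A where "A = max A1 A2"
  define ld where "ld = deriv g"
  define S where "S = (\<lambda>s :: complex. sin (of_real pi * (s + of_real \<kappa>)))"
  \<comment> \<open>The product rule for exp g * ld^m * (S + E), divided by exp g * ld^(m + 1) and
    with S removed.\<close>
  define E' where "E' = (\<lambda>s. E s + (of_nat m * deriv ld s / (ld s)\<^sup>2) * (S s + E s) + (of_real pi * cos (of_real pi * (s + of_real \<kappa>)) + deriv E s) / ld s)"
  let ?U = "{s. Re s < - A}"
  have oU: "open ?U" by (rule open_left_half_plane)
  have sub: "?U \<subseteq> {s. Re s < - A0}" "?U \<subseteq> {s. Re s < - A1}" using A1 by (auto simp: A_def)
  have gU: "g holomorphic_on ?U" and EU: "E holomorphic_on ?U" using g E sub holomorphic_on_subset by blast+
  have lU: "ld holomorphic_on ?U" unfolding ld_def using gU oU by (rule holomorphic_deriv)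
  have lnz: "ld s \<noteq> 0" if "s \<in> ?U" for s using A2(2)[of s] that by (force simp: ld_def A_def)
  have "E' holomorphic_on ?U"
    unfolding E'_def S_def using lnz by (intro holomorphic_intros EU lU holomorphic_deriv oU) auto
  moreover have "(deriv ^^ Suc m) F s = exp (g s) * deriv g s ^ Suc m * (S s + E' s)" if s: "Re s < - A" for s
  proof -
    have sU: "s \<in> ?U" using s by simp
    have dg: "(g has_field_derivative ld s) (at s)" unfolding ld_def using holomorphic_derivI[OF gU oU sU] .
    have dl: "(ld has_field_derivative deriv ld s) (at s)" using holomorphic_derivI[OF lU oU sU] .
    have dE: "(E has_field_derivative deriv E s) (at s)" using holomorphic_derivI[OF EU oU sU] .
    have "((\<lambda>s. exp (g s) * ld s ^ m * (S s + E s)) has_field_derivative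
        (exp (g s) * ld s) * ld s ^ m * (S s + E s) + exp (g s) * (of_nat m * ld s ^ (m - 1) * deriv ld s) * (S s + E s)
        + exp (g s) * ld s ^ m * (of_real pi * cos (of_real pi * (s + of_real \<kappa>)) + deriv E s)) (at s)"
      unfolding S_def
      by (rule derivative_eq_intros dg dl dE refl | simp add: algebra_simps)+
    then have "((deriv ^^ m) F has_field_derivative
        (exp (g s) * ld s) * ld s ^ m * (S s + E s) + exp (g s) * (of_nat m * ld s ^ (m - 1) * deriv ld s) * (S s + E s)
        + exp (g s) * ld s ^ m * (of_real pi * cos (of_real pi * (s + of_real \<kappa>)) + deriv E s)) (at s)"
      by (rule has_field_derivative_transform_within_open[OF _ oU sU]) (use sub eq in \<open>auto simp: ld_def S_def\<close>)
    then have "(deriv ^^ Suc m) F s =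
        (exp (g s) * ld s) * ld s ^ m * (S s + E s) + exp (g s) * (of_nat m * ld s ^ (m - 1) * deriv ld s) * (S s + E s)
        + exp (g s) * ld s ^ m * (of_real pi * cos (of_real pi * (s + of_real \<kappa>)) + deriv E s)"
      by (simp add: DERIV_imp_deriv)
    also have "of_nat m * ld s ^ (m - 1) * deriv ld s = ld s ^ Suc m * (of_nat m * deriv ld s / (ld s)\<^sup>2)"
      using lnz[OF sU] by (cases m) (auto simp: power2_eq_square field_simps)
    also have "(exp (g s) * ld s) * ld s ^ m * (S s + E s) + exp (g s) * (ld s ^ Suc m * (of_nat m * deriv ld s / (ld s)\<^sup>2)) * (S s + E s)
        + exp (g s) * ld s ^ m * (of_real pi * cos (of_real pi * (s + of_real \<kappa>)) + deriv E s)
       = exp (g s) * ld s ^ Suc m * (S s + E' s)"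
    proof -
      have "ld s ^ m * (of_real pi * cos (of_real pi * (s + of_real \<kappa>)) + deriv E s)
         = ld s ^ Suc m * ((of_real pi * cos (of_real pi * (s + of_real \<kappa>)) + deriv E s) / ld s)"
        using lnz[OF sU] by simp
      then show ?thesis unfolding E'_def mult.assoc[of "exp (g s)" "ld s ^ m"] by (simp add: algebra_simps)
    qed
    finally show ?thesis by (simp add: ld_def)
  qed
  moreover have "\<exists>A'\<ge>A. \<forall>s. Re s < - A' \<longrightarrow> norm (E' s) \<le> \<eta> * exp (pi * \<bar>Im s\<bar>)" if eta: "\<eta> > 0" for \<eta>
  proof -
    define \<eta>1 where "\<eta>1 = min 1 (\<eta> / 3)"
    have eta1: "0 < \<eta>1" "\<eta>1 \<le> 1" "\<eta>1 \<le> \<eta> / 3" using eta by (auto simp: \<eta>1_def)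
    \<comment> \<open>Large enough that, once |ld| >= K, each of the two quotients in
      \<open>E'\<close> contributes at most a third of \<eta>.\<close>
    define K where "K = 1 + (2 * real m * \<bar>C\<bar>) / (\<eta> / 3) + (pi + exp pi) / (\<eta> / 3)"
    have K1: "K \<ge> 1" using eta by (simp add: K_def add_nonneg_nonneg)
    have K2: "2 * real m * \<bar>C\<bar> \<le> \<eta> / 3 * K"
      using eta by (simp add: K_def distrib_left add_nonneg_nonneg)
    have K3: "pi + exp pi \<le> \<eta> / 3 * K"
    proof -
      have "pi + exp pi = \<eta> / 3 * ((pi + exp pi) / (\<eta> / 3))" using eta by simp
      also have "\<dots> \<le> \<eta> / 3 * K"
        unfolding K_def using eta by (intro mult_left_mono) (simp_all add: add_nonneg_nonneg)
      finally show ?thesis .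
    qed
    obtain B1 where B1: "B1 \<ge> A1" "\<And>s. Re s < - B1 \<Longrightarrow> norm (E s) \<le> \<eta>1 * exp (pi * \<bar>Im s\<bar>)" using sm[OF eta1(1)] by blast
    obtain B2 where B2: "B2 \<ge> A0" "\<And>s. Re s < - B2 \<Longrightarrow> Re (deriv g s) \<le> - K" using big[of K] by blast
    show ?thesis
    proof (intro exI[of _ "max A (max B1 B2) + 1"] conjI allI impI)
      fix s assume s: "Re s < - (max A (max B1 B2) + 1)"
      have sr: "Re s < - B1 - 1" "Re s < - B2" "Re s < - A" "Re s < - A0" using s A1 by (auto simp: A_def)
      define x where "x = exp (pi * \<bar>Im s\<bar>)"
      have x: "x > 0" by (simp add: x_def)
      have "\<bar>Re (ld s)\<bar> \<ge> K" using B2(2)[OF sr(2)] by (simp add: ld_def)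
      then have lK: "norm (ld s) \<ge> K" using abs_Re_le_cmod[of "ld s"] by linarith
      have nE: "norm (E s) \<le> \<eta>1 * x" using B1(2)[of s] sr by (simp add: x_def)
      have nS: "norm (S s) \<le> x" using norm_sin_complex_le[of "of_real pi * (s + of_real \<kappa>)"] by (simp add: S_def x_def abs_mult)
      have nc: "norm (cos (of_real pi * (s + of_real \<kappa>))) \<le> x" using norm_cos_complex_le[of "of_real pi * (s + of_real \<kappa>)"] by (simp add: x_def abs_mult)
      have ndl: "norm (deriv ld s) \<le> \<bar>C\<bar>" using d2[OF sr(4)] by (simp add: ld_def)
      \<comment> \<open>On the unit circle around s the imaginary part moves by at most 1, which
        costs the factor exp \<pi>.\<close>
      have ndE: "norm (deriv E s) \<le> exp pi * x"
      proof -
        have "norm ((deriv ^^ 1) E s) \<le> fact 1 * (exp pi * x)"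
        proof (rule higher_deriv_norm_le[of _ "{s. Re s < - B1}"])
          show "E holomorphic_on {s. Re s < - B1}" using B1(1) by (intro holomorphic_on_subset[OF E]) auto
          show "cball s 1 \<subseteq> {s. Re s < - B1}" using sr by (intro cball_subset_left) auto
          fix w assume w: "norm (s - w) = 1"
          then have "w \<in> cball s 1" by (simp add: dist_norm)
          then have "Re w < - B1" using cball_subset_left[of s B1] sr by auto
          then have "norm (E w) \<le> \<eta>1 * exp (pi * \<bar>Im w\<bar>)" by (rule B1(2))
          also have "\<dots> \<le> 1 * exp (pi * (1 + \<bar>Im s\<bar>))"
          proof (intro mult_mono)
            have "\<bar>Im w\<bar> \<le> 1 + \<bar>Im s\<bar>" using w abs_Im_le_cmod[of "s - w"] by simp
            then show "exp (pi * \<bar>Im w\<bar>) \<le> exp (pi * (1 + \<bar>Im s\<bar>))" by simp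
          qed (use eta1 in auto)
          also have "\<dots> = exp pi * x" by (simp add: x_def exp_add[symmetric] distrib_left)
          finally show "norm (E w) \<le> exp pi * x" .
        qed
        then show ?thesis by simp
      qed
      have t2: "norm ((of_nat m * deriv ld s / (ld s)\<^sup>2) * (S s + E s)) \<le> \<eta> / 3 * x"
      proof -
        have "norm (of_nat m * deriv ld s / (ld s)\<^sup>2) \<le> real m * \<bar>C\<bar> / K"
        proof -
          have "K * 1 \<le> norm (ld s) * norm (ld s)" using lK K1 by (intro mult_mono) auto
          then show ?thesis
            unfolding norm_divide norm_mult norm_power power2_eq_square using ndl K1 by (intro frac_le mult_mono) auto
        qed
        moreover have "norm (S s + E s) \<le> 2 * x"
        proof -
          have "\<eta>1 * x \<le> 1 * x" using eta1 x by (intro mult_right_mono) auto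
          then show ?thesis using norm_triangle_ineq[of "S s" "E s"] nS nE by linarith
        qed
        ultimately have "norm ((of_nat m * deriv ld s / (ld s)\<^sup>2) * (S s + E s)) \<le> (real m * \<bar>C\<bar> / K) * (2 * x)"
          unfolding norm_mult using K1 by (intro mult_mono) (auto simp: norm_mult)
        also have "\<dots> = (2 * real m * \<bar>C\<bar> / K) * x" by simp
        also have "\<dots> \<le> \<eta> / 3 * x" using K1 K2 x by (intro mult_right_mono) (auto simp: divide_le_eq)
        finally show ?thesis .
      qed
      have t3: "norm ((of_real pi * cos (of_real pi * (s + of_real \<kappa>)) + deriv E s) / ld s) \<le> \<eta> / 3 * x"
      proof -
        have "norm (of_real pi * cos (of_real pi * (s + of_real \<kappa>)) + deriv E s) \<le> pi * x + exp pi * x"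
        proof (rule order_trans[OF norm_triangle_ineq add_mono[OF _ ndE]])
          show "norm (of_real pi * cos (of_real pi * (s + of_real \<kappa>))) \<le> pi * x"
            unfolding norm_mult using nc by (intro mult_mono) auto
        qed
        then have "norm ((of_real pi * cos (of_real pi * (s + of_real \<kappa>)) + deriv E s) / ld s) \<le> (pi * x + exp pi * x) / K"
          unfolding norm_divide using lK K1 x by (intro frac_le) auto
        also have "\<dots> = ((pi + exp pi) / K) * x" by (simp add: algebra_simps add_divide_distrib)
        also have "\<dots> \<le> \<eta> / 3 * x" using K1 K3 x by (intro mult_right_mono) (auto simp: divide_le_eq)
        finally show ?thesis .
      qed
      have t1: "norm (E s) \<le> \<eta> / 3 * x" using nE eta1 x mult_right_mono[of \<eta>1 "\<eta> / 3" x] by linarith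
      have "norm (E' s) \<le> norm (E s) + norm ((of_nat m * deriv ld s / (ld s)\<^sup>2) * (S s + E s)) + norm ((of_real pi * cos (of_real pi * (s + of_real \<kappa>)) + deriv E s) / ld s)"
        unfolding E'_def by (intro order_trans[OF norm_triangle_ineq] add_mono norm_triangle_ineq order_refl)
      also have "\<dots> \<le> \<eta> * x" using t1 t2 t3 by linarith
      finally show "norm (E' s) \<le> \<eta> * exp (pi * \<bar>Im s\<bar>)" by (simp add: x_def)
    qed (auto simp: A_def)
  qed
  ultimately show ?case using A1 by (intro exI[of _ A] exI[of _ E']) (auto simp: A_def S_def)
qed

text \<open>
  Close to a zero of the sine, the imaginary part of the function (up to sign) is strictly monotone on the
  vertical segment from \<open>cnj s\<close> to \<open>s\<close>; elsewhere the sine dominates \<open>E\<close>.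
\<close>
lemma sin_perturbed_no_conjugate_zeros:
  fixes E :: "complex \<Rightarrow> complex" and \<kappa> :: real
  assumes E: "E holomorphic_on U" "open U" and U: "\<And>v. \<bar>v\<bar> \<le> Im s \<Longrightarrow> Complex (Re s) v \<in> U"
    and Eb: "norm (E s) \<le> exp (pi * Im s) / 100"
    and dEb: "\<And>v. \<bar>v\<bar> \<le> Im s \<Longrightarrow> norm (deriv E (Complex (Re s) v)) \<le> exp (pi * (\<bar>v\<bar> + 1)) / 100"
    and s: "Im s > 0"
    and z1: "sin (of_real pi * (s + of_real \<kappa>)) + E s = 0"
    and z2: "sin (of_real pi * (cnj s + of_real \<kappa>)) + E (cnj s) = 0"
  shows False
proof -
  define t where "t = Im s"
  define u where "u = of_real pi * (s + of_real \<kappa>)"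
  have u: "Re u = pi * (Re s + \<kappa>)" "Im u = pi * t" by (auto simp: u_def t_def)
  have sinu: "norm (sin u) \<le> exp (pi * t) / 100"
    using Eb z1 by (simp add: u_def t_def eq_neg_iff_add_eq_0[symmetric])
  have exp_bounds: "exp (1::real) \<le> 3" by (rule exp_le)
  show False
  proof (cases "t \<ge> 1/4")
    \<comment> \<open>|sin u| is at least sinh (\<pi> t), which from t = 1/4 on exceeds the allowed
      exp (\<pi> t) / 100.\<close>
    case True
    have "norm (exp (- (\<i> * u))) - norm (exp (\<i> * u)) \<le> norm (exp (\<i> * u) - exp (- (\<i> * u)))"
      using norm_triangle_ineq2[of "exp (- (\<i> * u))" "exp (\<i> * u)"] by (simp add: norm_minus_commute)
    also have "\<dots> = 2 * norm (sin u)" by (simp add: sin_exp_eq norm_divide norm_mult)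
    finally have 1: "exp (pi * t) - exp (- (pi * t)) \<le> 2 * norm (sin u)" by (simp add: u)
    have "pi * t \<ge> 3 * (1/4)" using True pi_gt3 by (intro mult_mono) auto
    then have "exp (pi * t) \<ge> 1 + 3/4" using exp_ge_add_one_self[of "pi * t"] by linarith
    moreover from this have "exp (- (pi * t)) \<le> 1 / (1 + 3/4)"
      unfolding exp_minus inverse_eq_divide by (intro divide_left_mono) auto
    ultimately show False using 1 sinu by simp
  next
    case False
    \<comment> \<open>The nearest zero of the sine; \<open>y\<close> is the signed distance to it,
      and the sign \<sigma> makes the real sine increasing there.\<close>
    define n where "n = round (Re s + \<kappa>)"
    define y where "y = Re s + \<kappa> - of_int n"
    have y: "\<bar>y\<bar> \<le> 1/2" using of_int_round_abs_le[of "Re s + \<kappa>"] by (simp add: y_def n_def abs_minus_commute)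
    define \<sigma> where "\<sigma> = cos (pi * of_int n)"
    have \<sigma>: "\<bar>\<sigma>\<bar> = 1" "\<sigma> * \<sigma> = 1" by (auto simp: \<sigma>_def cos_npi_int)
    have piy: "pi * (Re s + \<kappa>) = pi * y + pi * of_int n" by (simp add: y_def algebra_simps)
    have et: "exp (pi * t) \<le> 3"
    proof -
      have "pi * t \<le> 4 * (1/4)" using False s pi_less_4 by (intro mult_mono) (auto simp: t_def)
      then have "exp (pi * t) \<le> exp 1" by simp
      then show ?thesis using exp_bounds by linarith
    qed
    show False
    proof (cases "\<bar>y\<bar> \<ge> 1/4")
      \<comment> \<open>Away from the zero |sin (\<pi> y)| >= sin (\<pi> / 6) = 1/2, whereas the
        error is at most 3/100.\<close>
      case True
      have "sin (pi / 6) \<le> sin (pi * \<bar>y\<bar>)"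
        using True y pi_gt_zero by (intro sin_monotone_2pi_le) (auto simp: field_simps)
      then have "1/2 \<le> \<bar>sin (pi * y)\<bar>" by (cases "y \<ge> 0") (auto simp: sin_30)
      also have "\<bar>sin (pi * y)\<bar> = \<bar>sin (Re u)\<bar>"
        unfolding u piy sin_add using \<sigma> by (simp add: sin_npi_int abs_mult \<sigma>_def)
      also have "\<dots> * 1 \<le> \<bar>sin (Re u)\<bar> * ((exp (Im u) + exp (- Im u)) / 2)"
      proof (rule mult_left_mono)
        have "exp (Im u) + exp (- Im u) \<ge> 2" using exp_ge_add_one_self[of "Im u"] exp_ge_add_one_self[of "- Im u"] by linarith
        then show "1 \<le> (exp (Im u) + exp (- Im u)) / 2" by simp
      qed simp
      also have "\<dots> = \<bar>Re (sin u)\<bar>" by (simp add: Re_sin abs_mult)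
      also have "\<dots> \<le> norm (sin u)" by (rule abs_Re_le_cmod)
      finally show False using sinu et by simp
    next
      case y4: False
      define h where "h = (\<lambda>w. of_real \<sigma> * (sin (of_real pi * (w + of_real \<kappa>)) + E w))"
      define h' where "h' = (\<lambda>w. of_real \<sigma> * (of_real pi * cos (of_real pi * (w + of_real \<kappa>)) + deriv E w))"
      define H where "H = (\<lambda>v. Im (h (Complex (Re s) v)))"
      have dH: "(H has_real_derivative Re (h' (Complex (Re s) v))) (at v)" if v: "- t \<le> v" "v \<le> t" for v
      proof -
        define w where "w = Complex (Re s) v"
        have wU: "w \<in> U" unfolding w_def using v by (intro U) (auto simp: t_def)
        have dE: "(E has_field_derivative deriv E w) (at w)" using holomorphic_derivI[OF E wU] .
        have "(h has_field_derivative h' w) (at w)"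
          unfolding h_def h'_def by (rule derivative_eq_intros dE refl | simp)+
        moreover have "((\<lambda>v. Complex (Re s) v) has_vector_derivative \<i>) (at v)"
        proof -
          have "(\<lambda>v. Complex (Re s) v) = (\<lambda>v. of_real (Re s) + of_real v * \<i>)" by (auto simp: complex_eq_iff)
          then show ?thesis by (auto intro!: derivative_eq_intros)
        qed
        ultimately have "((h \<circ> (\<lambda>v. Complex (Re s) v)) has_vector_derivative \<i> * h' w) (at v)"
          unfolding w_def by (intro field_vector_diff_chain_at)
        then have "((\<lambda>v. Im ((h \<circ> (\<lambda>v. Complex (Re s) v)) v)) has_vector_derivative Im (\<i> * h' w)) (at v)"
          by (rule bounded_linear.has_vector_derivative[OF bounded_linear_Im])
        then show ?thesis unfolding H_def w_def by (simp add: o_def has_real_derivative_iff_has_vector_derivative)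
      qed
      have pos: "Re (h' (Complex (Re s) v)) > 0" if v: "- t \<le> v" "v \<le> t" for v
      proof -
        define w where "w = Complex (Re s) v"
        have cy: "cos (pi * y) \<ge> 1/2"
        proof -
          have "cos (pi / 3) \<le> cos \<bar>pi * y\<bar>"
            using y4 pi_gt_zero by (intro cos_monotone_0_pi_le) (auto simp: abs_mult field_simps)
          then show ?thesis by (simp add: cos_60)
        qed
        have "Re (of_real \<sigma> * (of_real pi * cos (of_real pi * (w + of_real \<kappa>)))) = (\<sigma> * \<sigma>) * (pi * (cos (pi * y) * ((exp (pi * v) + exp (- (pi * v))) / 2)))"
          using piy by (simp add: Re_cos w_def cos_add sin_npi_int \<sigma>_def)
        also have "\<dots> \<ge> 3 * (1/2 * 1)"
        proof -
          have "exp (pi * v) + exp (- (pi * v)) \<ge> 2" using exp_ge_add_one_self[of "pi * v"] exp_ge_add_one_self[of "- (pi * v)"] by linarith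
          then have "pi * (cos (pi * y) * ((exp (pi * v) + exp (- (pi * v))) / 2)) \<ge> 3 * (1/2 * 1)"
            using cy pi_gt3 by (intro mult_mono) auto
          then show ?thesis using \<sigma> by simp
        qed
        finally have 1: "Re (of_real \<sigma> * (of_real pi * cos (of_real pi * (w + of_real \<kappa>)))) \<ge> 3/2" by simp
        have "norm (of_real \<sigma> * deriv E w) = norm (deriv E w)" using \<sigma> by (simp add: norm_mult)
        also have "\<dots> \<le> exp (pi * (\<bar>v\<bar> + 1)) / 100" unfolding w_def using v by (intro dEb) (auto simp: t_def)
        \<comment> \<open>As |v| < 1/4, the exponent is at most 4; even exp 5 / 100 stays below the
          lower bound 3/2 for the cosine term.\<close>
        also have "\<dots> \<le> exp (5 * 1) / 100"
        proof -
          have "\<bar>v\<bar> + 1 \<le> 5/4" using v False by auto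
          then have "pi * (\<bar>v\<bar> + 1) \<le> 3.2 * (5/4)" using pi_approx by (intro mult_mono) auto
          then show ?thesis by simp
        qed
        also have "\<dots> < 3/2"
        proof -
          have "exp (1::real) < 2.72" using e_less_272 by simp
          then have "exp (1::real) ^ 5 < 2.72 ^ 5" by (intro power_strict_mono) auto
          moreover have "exp (5 * 1 :: real) = exp 1 ^ 5" using exp_of_nat_mult[of 5 "1::real"] by simp
          ultimately have "exp (5 * 1 :: real) < 149" by (simp add: power_numeral_reduce)
          then show ?thesis by simp
        qed
        finally have 2: "\<bar>Re (of_real \<sigma> * deriv E w)\<bar> < 3/2" using abs_Re_le_cmod[of "of_real \<sigma> * deriv E w"] by linarith
        have "Re (h' w) = Re (of_real \<sigma> * (of_real pi * cos (of_real pi * (w + of_real \<kappa>)))) + Re (of_real \<sigma> * deriv E w)"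
          unfolding h'_def by (simp only: distrib_left plus_complex.sel)
        then show ?thesis using 1 2 unfolding w_def by linarith
      qed
      have "- t < t" using s by (simp add: t_def)
      from MVT2[OF this dH] obtain v where v: "- t < v" "v < t" "H t - H (- t) = (t - - t) * Re (h' (Complex (Re s) v))" by auto
      have "Complex (Re s) t = s" "Complex (Re s) (- t) = cnj s" by (auto simp: t_def complex_eq_iff)
      then have "H t = 0" "H (- t) = 0" using z1 z2 unfolding H_def h_def by (simp_all only: mult_zero_right zero_complex.sel)
      then show False using v pos[of v] s by (simp add: t_def)
    qed
  qed
qed

lemma has_field_derivative_log_primitive:
  assumes "open S" "s \<in> S" and K: "K \<noteq> 0" and eq: "\<And>w. w \<in> S \<Longrightarrow> F w = K * exp (Q w)" and Q: "Q holomorphic_on S"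
  shows "(Q has_field_derivative deriv F s / F s) (at s)"
proof -
  have dQ: "(Q has_field_derivative deriv Q s) (at s)" using Q assms(1,2) by (rule holomorphic_derivI)
  have "((\<lambda>w. K * exp (Q w)) has_field_derivative K * (exp (Q s) * deriv Q s)) (at s)"
    by (rule derivative_eq_intros dQ refl | simp)+
  then have "(F has_field_derivative K * (exp (Q s) * deriv Q s)) (at s)"
    by (rule has_field_derivative_transform_within_open[OF _ assms(1,2)]) (simp add: eq)
  then have "deriv F s = F s * deriv Q s" using eq[OF assms(2)] by (simp add: DERIV_imp_deriv)
  moreover have "F s \<noteq> 0" using eq[OF assms(2)] K by simp
  ultimately show ?thesis using dQ by simp
qed

lemma Re_pos_of_near_1: "norm (w - 1) \<le> 1/2 \<Longrightarrow> Re w \<ge> 1/2"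
  using abs_Re_le_cmod[of "w - 1"] by simp

lemma norm_Ln_near_1:
  assumes "norm (w - 1) \<le> 1/2"
  shows "norm (Ln w) \<le> 4 + 1"
proof -
  have r: "Re w \<ge> 1/2" using Re_pos_of_near_1[OF assms] .
  then have w0: "w \<noteq> 0" by auto
  have "norm w \<le> norm (w - 1) + norm (1::complex)" using norm_triangle_ineq[of "w - 1" 1] by simp
  then have nw: "norm w \<le> 2" using assms by simp
  have nw2: "norm w \<ge> 1/2" using r complex_Re_le_cmod[of w] by linarith
  have "ln (norm w) \<le> norm w - 1" using w0 by (intro ln_le_minus_one) auto
  moreover have "- ln (norm w) \<le> 1 / norm w - 1" using ln_le_minus_one[of "1 / norm w"] w0 by (simp add: ln_div)
  moreover have "1 / norm w \<le> 2" using nw2 w0 by (simp add: divide_le_eq)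
  ultimately have "\<bar>Re (Ln w)\<bar> \<le> 1" using nw w0 by (simp add: abs_le_iff)
  moreover have "\<bar>Im (Ln w)\<bar> \<le> 4" using mpi_less_Im_Ln[OF w0] Im_Ln_le_pi[OF w0] pi_less_4 by simp
  ultimately show ?thesis using cmod_le[of "Ln w"] by linarith
qed

lemma bounded_imp_bigo_ln:
  fixes h :: "real \<Rightarrow> real"
  assumes "\<And>t. t \<ge> t0 \<Longrightarrow> \<bar>h t\<bar> \<le> B"
  shows "h \<in> O[at_top](\<lambda>t. ln t)"
proof (rule bigoI[where c = "\<bar>B\<bar>"])
  show "eventually (\<lambda>t. norm (h t) \<le> \<bar>B\<bar> * norm (ln t)) at_top"
    using eventually_ge_at_top[of "max t0 (exp 1)"]
  proof eventually_elim
    case (elim t)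
    then have "t \<ge> exp 1" by simp
    then have "t > 0" using exp_gt_zero[of "1::real"] by linarith
    then have "ln t \<ge> 1" using elim by (subst ln_ge_iff) auto
    then have "\<bar>B\<bar> * 1 \<le> \<bar>B\<bar> * \<bar>ln t\<bar>" by (intro mult_left_mono) auto
    then show ?case using assms[of t] elim by simp
  qed
qed

section \<open>Logarithms of the L-function and the final count\<close>

context level_one_cusp_form
begin

text \<open>Reflection turns \<open>rGamma (s + \<kappa>)\<close> into Gamma(1 - s - \<kappa>) times
  the sine; \<open>g\<close> then adds up logarithms of factors whose arguments have large real
  part. Its derivative is minus two logarithms up to O(1), and each \<open>ln_Gamma\<close>
  contributes -(t ln t - t) to its imaginary part.\<close>

lemma Lfun_left_log:
  obtains A0 C g where "A0 \<ge> \<bar>\<kappa>\<bar> + 2" "g holomorphic_on {s. Re s < - A0}"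
    "\<And>s. Re s < - A0 \<Longrightarrow> Lfun s = exp (g s) * sin (of_real pi * (s + of_real \<kappa>))"
    "\<And>s. Re s < - A0 \<Longrightarrow> norm (deriv g s + Ln (1 - s + of_real \<kappa>) + Ln (1 - s - of_real \<kappa>)) \<le> C"
    "\<And>b. b > A0 \<Longrightarrow> (\<lambda>t. Im (g (Complex (- b) t)) - (2 * t * ln (2 * pi) - 2 * (t * ln t - t))) \<in> O[at_top](\<lambda>t. ln t)"
proof -
  obtain c \<beta>0 where c: "c \<noteq> 0" "\<And>s. Re s \<ge> \<beta>0 \<Longrightarrow> norm (Lfun s / c - 1) \<le> 1/2"
    using Lfun_deriv_right[of 0] by (auto simp: mu_def)
  define A0 where "A0 = max \<beta>0 (\<bar>\<kappa>\<bar> + 2)"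
  define c1 where "c1 = Ln (c * inverse (\<i> powi k) / of_real pi)"
  have c1: "exp c1 = c * inverse (\<i> powi k) / of_real pi" unfolding c1_def using c by (intro exp_Ln) simp
  define E where "E = (\<lambda>z. Ln (Lfun z / c))"
  define g where "g = (\<lambda>s. c1 + (2 * s - 1) * of_real (ln (2 * pi)) + ln_Gamma (1 - s + of_real \<kappa>) + ln_Gamma (1 - s - of_real \<kappa>) + E (1 - s))"
  let ?U = "{s. Re s < - A0}"
  have Re2: "Re (1 - s + of_real \<kappa>) \<ge> 2" "Re (1 - s - of_real \<kappa>) \<ge> 2" "Re (1 - s) \<ge> \<beta>0 + 1" if "s \<in> ?U" for s
    using that by (auto simp: A0_def)
  have nr: "1 - s + of_real \<kappa> \<notin> \<real>\<^sub>\<le>\<^sub>0" "1 - s - of_real \<kappa> \<notin> \<real>\<^sub>\<le>\<^sub>0" if "s \<in> ?U" for s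
    using Re2[OF that] by (auto simp: complex_nonpos_Reals_iff)
  have Lnr: "Lfun z / c \<notin> \<real>\<^sub>\<le>\<^sub>0" if "Re z \<ge> \<beta>0" for z
    using Re_pos_of_near_1[OF c(2)[OF that]] by (auto simp: complex_nonpos_Reals_iff)
  have Ehol: "E holomorphic_on {z. Re z > \<beta>0}"
    unfolding E_def using Lnr c by (intro holomorphic_intros holomorphic_on_subset[OF Lfun_holomorphic]) auto
  have oB: "open {z. Re z > \<beta>0}" by (rule open_halfspace_Re_gt)
  have dE: "(E has_field_derivative deriv E (1 - s)) (at (1 - s))" if "s \<in> ?U" for s
    using holomorphic_derivI[OF Ehol oB] Re2(3)[OF that] by auto
  have dg: "(g has_field_derivative (2 * of_real (ln (2 * pi)) - Digamma (1 - s + of_real \<kappa>) - Digamma (1 - s - of_real \<kappa>) - deriv E (1 - s))) (at s)"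
    if s: "s \<in> ?U" for s
  proof -
    have dE': "((\<lambda>s. E (1 - s)) has_field_derivative deriv E (1 - s) * (- 1)) (at s)"
      by (rule DERIV_chain2[where f = E and g = "\<lambda>s. 1 - s", OF dE[OF s]]) (auto intro!: derivative_eq_intros)
    show ?thesis unfolding g_def using nr[OF s]
      by (auto intro!: derivative_eq_intros dE')
  qed
  have g1: "g holomorphic_on ?U"
    unfolding holomorphic_on_open[OF open_left_half_plane] using dg by blast
  have g2: "Lfun s = exp (g s) * sin (of_real pi * (s + of_real \<kappa>))" if s: "Re s < - A0" for s
  proof -
    define z1 z2 where "z1 = 1 - s + of_real \<kappa>" and "z2 = 1 - s - of_real \<kappa>"
    have sU: "s \<in> ?U" using s by simp
    have ni: "z1 \<notin> \<int>\<^sub>\<le>\<^sub>0" "z2 \<notin> \<int>\<^sub>\<le>\<^sub>0" using Re2[OF sU] by (auto intro!: not_nonpos_Int simp: z1_def z2_def)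
    have G: "exp (ln_Gamma z1) = Gamma z1" "exp (ln_Gamma z2) = Gamma z2" using ni by (simp_all add: Gamma_complex_altdef)
    have eE: "exp (E (1 - s)) = Lfun (1 - s) / c" unfolding E_def
      using Lnr[of "1 - s"] Re2(3)[OF sU] by (intro exp_Ln) auto
    have e2: "exp ((2 * s - 1) * of_real (ln (2 * pi))) = of_real (2 * pi) powr (2 * s - 1)"
      using pi_gt_zero by (simp add: powr_def Ln_of_real[symmetric] del: Ln_of_real)
    have r: "rGamma (s + of_real \<kappa>) = Gamma z2 * sin (of_real pi * (s + of_real \<kappa>)) / of_real pi"
    proof -
      have "rGamma z2 \<noteq> 0" using ni by (simp add: rGamma_eq_zero_iff)
      moreover have "rGamma (s + of_real \<kappa>) * rGamma z2 = sin (of_real pi * (s + of_real \<kappa>)) / of_real pi"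
        using rGamma_reflection_complex[of "s + of_real \<kappa>"] by (simp add: z2_def algebra_simps)
      moreover have "Gamma z2 * rGamma z2 = 1" using ni by (simp add: rGamma_inverse_Gamma Gamma_eq_zero_iff)
      ultimately show ?thesis by (metis (no_types, lifting) mult.assoc mult.commute mult.right_neutral times_divide_eq_right)
    qed
    have "exp (g s) = (c * inverse (\<i> powi k) / of_real pi) * of_real (2 * pi) powr (2 * s - 1) * Gamma z1 * Gamma z2 * (Lfun (1 - s) / c)"
      unfolding g_def exp_add z1_def[symmetric] z2_def[symmetric] G eE e2 c1 ..
    moreover have "Re (1 - s) + \<kappa> > 0" using Re2(1)[OF sU] by simp
    ultimately show ?thesis using Lfun_reflect[of s] c(1) unfolding z1_def[symmetric] r by simp
  qed
  have nE: "norm (deriv E z) \<le> 5" if "Re z \<ge> \<beta>0 + 2" for z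
  proof -
    have "norm ((deriv ^^ 1) E z) \<le> fact 1 * 5"
    proof (rule higher_deriv_norm_le[OF Ehol])
      show "cball z 1 \<subseteq> {z. Re z > \<beta>0}"
      proof
        fix w assume "w \<in> cball z 1"
        then show "w \<in> {z. Re z > \<beta>0}" using that abs_Re_le_cmod[of "z - w"] by (auto simp: dist_norm)
      qed
      fix w assume "norm (z - w) = 1"
      then have "Re w \<ge> \<beta>0" using that abs_Re_le_cmod[of "z - w"] by auto
      then show "norm (E w) \<le> 5" unfolding E_def using norm_Ln_near_1[OF c(2)] by simp
    qed
    then show ?thesis by simp
  qed
  show thesis
  \<comment> \<open>The extra unit pays for Cauchy's estimate of \<open>deriv E\<close>. The
    constant adds 2 ln (2 \<pi>), the bound 8 / |z| <= 4 for each Digamma, and 5 for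
    \<open>deriv E\<close>.\<close>
  proof (rule that[of "A0 + 1" g "2 * ln (2 * pi) + 4 + 4 + 5"])
    show "A0 + 1 \<ge> \<bar>\<kappa>\<bar> + 2" by (simp add: A0_def)
    show "g holomorphic_on {s. Re s < - (A0 + 1)}" by (rule holomorphic_on_subset[OF g1]) auto
    show "Lfun s = exp (g s) * sin (of_real pi * (s + of_real \<kappa>))" if "Re s < - (A0 + 1)" for s
      using that by (intro g2) simp
    show "norm (deriv g s + Ln (1 - s + of_real \<kappa>) + Ln (1 - s - of_real \<kappa>)) \<le> 2 * ln (2 * pi) + 4 + 4 + 5" if s: "Re s < - (A0 + 1)" for s
    proof -
      define z1 z2 where "z1 = 1 - s + of_real \<kappa>" and "z2 = 1 - s - of_real \<kappa>"
      have sU: "s \<in> ?U" using s by simp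
      have R: "Re z1 \<ge> 2" "Re z2 \<ge> 2" using Re2[OF sU] by (auto simp: z1_def z2_def)
      have b: "norm (Digamma z - Ln z) \<le> 4" if "Re z \<ge> 2" for z
      proof -
        have "norm z \<ge> 2" using that complex_Re_le_cmod[of z] by linarith
        then have "8 / norm z \<le> 8 / 2" by (intro divide_left_mono) auto
        then show ?thesis using Digamma_Ln_bound[OF that] by simp
      qed
      have l0: "ln (2 * pi) \<ge> 0" using pi_gt3 by simp
      have "deriv g s + Ln z1 + Ln z2 = 2 * of_real (ln (2 * pi)) - (Digamma z1 - Ln z1) - (Digamma z2 - Ln z2) - deriv E (1 - s)"
        using DERIV_imp_deriv[OF dg[OF sU]] by (simp add: z1_def z2_def algebra_simps)
      also have "norm \<dots> \<le> norm (2 * of_real (ln (2 * pi)) :: complex) + norm (Digamma z1 - Ln z1) + norm (Digamma z2 - Ln z2) + norm (deriv E (1 - s))"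
        by (intro order_trans[OF norm_triangle_ineq4] add_mono order_refl)
      also have "\<dots> \<le> 2 * ln (2 * pi) + 4 + 4 + 5"
      proof (intro add_mono b R)
        show "norm (2 * of_real (ln (2 * pi)) :: complex) \<le> 2 * ln (2 * pi)" using l0 by (simp add: norm_mult)
        show "norm (deriv E (1 - s)) \<le> 5" using s by (intro nE) (simp add: A0_def)
      qed
      finally show ?thesis by (simp add: z1_def z2_def)
    qed
    fix b assume b: "b > A0 + 1"
    define b1 b2 where "b1 = 1 + b + \<kappa>" and "b2 = 1 + b - \<kappa>"
    have bb: "b1 \<ge> 2" "b2 \<ge> 2" using b by (auto simp: b1_def b2_def A0_def)
    have G1: "(\<lambda>t. Im (ln_Gamma (Complex b1 (- t))) + (t * ln t - t)) \<in> O[at_top](\<lambda>t. ln t)" by (rule Im_ln_Gamma_asymp[OF bb(1)])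
    have G2: "(\<lambda>t. Im (ln_Gamma (Complex b2 (- t))) + (t * ln t - t)) \<in> O[at_top](\<lambda>t. ln t)" by (rule Im_ln_Gamma_asymp[OF bb(2)])
    have G3: "(\<lambda>t. Im c1 + Im (E (1 - Complex (- b) t))) \<in> O[at_top](\<lambda>t. ln t)"
    proof (rule bounded_imp_bigo_ln)
      fix t :: real
      have "norm (E (1 - Complex (- b) t)) \<le> 5" unfolding E_def using b norm_Ln_near_1[OF c(2)[of "1 - Complex (- b) t"]] by (simp add: A0_def)
      then show "\<bar>Im c1 + Im (E (1 - Complex (- b) t))\<bar> \<le> \<bar>Im c1\<bar> + 5"
        using abs_Im_le_cmod[of "E (1 - Complex (- b) t)"] by linarith
    qed
    have eq: "Im (g (Complex (- b) t)) - (2 * t * ln (2 * pi) - 2 * (t * ln t - t)) =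
      (Im (ln_Gamma (Complex b1 (- t))) + (t * ln t - t)) + (Im (ln_Gamma (Complex b2 (- t))) + (t * ln t - t)) + (Im c1 + Im (E (1 - Complex (- b) t)))" for t
    proof -
      have "1 - Complex (- b) t + of_real \<kappa> = Complex b1 (- t)" "1 - Complex (- b) t - of_real \<kappa> = Complex b2 (- t)"
        by (auto simp: complex_eq_iff b1_def b2_def)
      then show ?thesis by (simp add: g_def)
    qed
    show "(\<lambda>t. Im (g (Complex (- b) t)) - (2 * t * ln (2 * pi) - 2 * (t * ln t - t))) \<in> O[at_top](\<lambda>t. ln t)"
      unfolding eq by (intro sum_in_bigo G1 G2 G3)
  qed
qed

end

context hecke_eigenform
begin

text \<open>The coefficients are real, so the conjugated function has the same Dirichlet series and
  coincides with L by uniqueness of the entire continuation.\<close>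

lemma Lfun_cnj: "Lfun (cnj s) = cnj (Lfun s)"
proof -
  have lr: "cnj (lam n) = lam n" for n
    using a_real[of n] by (simp add: lam_def complex_eq_iff)
  have "is_entire_L k f (\<lambda>s. cnj (Lfun (cnj s)))"
    unfolding is_entire_L_def
  proof (intro conjI allI impI)
    show "(\<lambda>s. cnj (Lfun (cnj s))) holomorphic_on UNIV"
      using holomorphic_on_compose_cnj_cnj[of Lfun UNIV] holomorphic_on_subset[OF Lfun_holomorphic subset_UNIV, of "range cnj"] by (simp add: o_def)
    fix s :: complex assume s: "Re s > 1"
    have hl: "hecke_lambda k f = lam"
      unfolding fun_eq_iff hecke_lambda_def lam_def \<kappa>_def fourier_coeff_eqI[OF q_exp] by simp
    have "(\<lambda>n. cnj (lam (Suc n) * of_nat (Suc n) powr (- cnj s))) sums cnj (Lfun (cnj s))"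
      using Lambda_sums[of "cnj s"] s unfolding sums_cnj by simp
    moreover have "cnj (lam (Suc n) * of_nat (Suc n) powr (- cnj s)) = lam (Suc n) * of_nat (Suc n) powr (- s)" for n
    proof -
      have "cnj (of_nat (Suc n) powr (- cnj s)) = of_nat (Suc n) powr (- s)"
        by (simp add: powr_def exp_cnj Ln_of_nat del: of_nat_Suc)
      then show ?thesis by (simp add: lr del: of_nat_Suc)
    qed
    ultimately show "(\<lambda>n. hecke_lambda k f (Suc n) * of_nat (Suc n) powr (- s)) sums cnj (Lfun (cnj s))"
      unfolding hl by simp
  qed
  then have "Lfun = (\<lambda>s. cnj (Lfun (cnj s)))" using cusp_L_eqI cusp_L_eq by metis
  then show ?thesis by (metis complex_cnj_cnj)
qed

text \<open>The case m = 0 is included and counts the zeros of L itself with \<mu> = 0.\<close>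

theorem zero_count_Lfun_deriv:
  "(\<lambda>T. zero_count ((deriv ^^ m) Lfun) T - (- mu m * T - (2 * T * ln (2 * pi) - 2 * (T * ln T - T))) / (2 * pi)) \<in> O[at_top](\<lambda>T. ln T)"
proof -
  define F where "F = (deriv ^^ m) Lfun"
  have F: "F holomorphic_on UNIV" unfolding F_def by (intro holomorphic_higher_deriv Lfun_holomorphic) auto
  have Fcnj: "F (cnj s) = cnj (F s)" for s unfolding F_def by (rule higher_deriv_cnj[OF Lfun_holomorphic Lfun_cnj])
  obtain A0 C g where A0: "A0 \<ge> \<bar>\<kappa>\<bar> + 2" and g: "g holomorphic_on {s. Re s < - A0}"
    and Lg: "\<And>s. Re s < - A0 \<Longrightarrow> Lfun s = exp (g s) * sin (of_real pi * (s + of_real \<kappa>))"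
    and dg: "\<And>s. Re s < - A0 \<Longrightarrow> norm (deriv g s + Ln (1 - s + of_real \<kappa>) + Ln (1 - s - of_real \<kappa>)) \<le> C"
    and Img: "\<And>b. b > A0 \<Longrightarrow> (\<lambda>t. Im (g (Complex (- b) t)) - (2 * t * ln (2 * pi) - 2 * (t * ln t - t))) \<in> O[at_top](\<lambda>t. ln t)"
    by (rule Lfun_left_log, rule that, assumption+)
  \<comment> \<open>Far to the left each of the two logarithms has real part at least |K| + |C|,
    which outweighs the bounded error.\<close>
  have big: "\<exists>A\<ge>A0 + 1. \<forall>s. Re s < - A \<longrightarrow> Re (deriv g s) \<le> - K" for K
  proof (intro exI[of _ "max (A0 + 1) (\<bar>\<kappa>\<bar> + exp (\<bar>K\<bar> + \<bar>C\<bar>))"] conjI allI impI)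
    fix s assume s: "Re s < - max (A0 + 1) (\<bar>\<kappa>\<bar> + exp (\<bar>K\<bar> + \<bar>C\<bar>))"
    define z1 z2 where "z1 = 1 - s + of_real \<kappa>" and "z2 = 1 - s - of_real \<kappa>"
    have R: "Re z1 \<ge> exp (\<bar>K\<bar> + \<bar>C\<bar>)" "Re z2 \<ge> exp (\<bar>K\<bar> + \<bar>C\<bar>)" using s by (auto simp: z1_def z2_def)
    have ln: "Re (Ln z) \<ge> \<bar>K\<bar> + \<bar>C\<bar>" if "Re z \<ge> exp (\<bar>K\<bar> + \<bar>C\<bar>)" for z
    proof -
      have n: "norm z \<ge> exp (\<bar>K\<bar> + \<bar>C\<bar>)" using that complex_Re_le_cmod[of z] by linarith
      have "norm z > 0" using n exp_gt_zero[of "\<bar>K\<bar> + \<bar>C\<bar>"] by linarith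
      then show ?thesis using n by (simp add: ln_ge_iff)
    qed
    have "Re s < - A0" using s by linarith
    then have "Re (deriv g s + Ln z1 + Ln z2) \<le> C"
      using dg[of s] complex_Re_le_cmod[of "deriv g s + Ln z1 + Ln z2"] by (simp add: z1_def z2_def)
    then show "Re (deriv g s) \<le> - K" using ln[OF R(1)] ln[OF R(2)] by simp
  qed simp
  have og: "open {s. Re s < - A0}" by (rule open_left_half_plane)
  have d2: "norm (deriv (deriv g) s) \<le> C + 2" if s: "Re s < - (A0 + 1)" for s
  proof -
    \<comment> \<open>\<open>deriv g\<close> itself is unbounded, so Cauchy's estimate is applied to
      this bounded combination; each logarithm adds a term 1 / z.\<close>
    define D where "D = (\<lambda>s. deriv g s + Ln (1 - s + of_real \<kappa>) + Ln (1 - s - of_real \<kappa>))"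
    have nr: "1 - s + of_real \<kappa> \<notin> \<real>\<^sub>\<le>\<^sub>0" "1 - s - of_real \<kappa> \<notin> \<real>\<^sub>\<le>\<^sub>0" if "Re s < - A0" for s
      using that A0 by (auto simp: complex_nonpos_Reals_iff)
    have dgh: "deriv g holomorphic_on {s. Re s < - A0}" using g og by (rule holomorphic_deriv)
    have Dh: "D holomorphic_on {s. Re s < - A0}" unfolding D_def using nr
      by (intro holomorphic_intros dgh) auto
    have "norm ((deriv ^^ 1) D s) \<le> fact 1 * C"
    proof (rule higher_deriv_norm_le[OF Dh])
      show sub: "cball s 1 \<subseteq> {s. Re s < - A0}" using s by (intro cball_subset_left) simp
      fix w assume "norm (s - w) = 1"
      then have "w \<in> cball s 1" by (simp add: dist_norm)
      then have "Re w < - A0" using sub by auto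
      then show "norm (D w) \<le> C" unfolding D_def by (rule dg)
    qed
    then have nD: "norm (deriv D s) \<le> C" by simp
    have s': "s \<in> {s. Re s < - A0}" using s by simp
    have "(D has_field_derivative deriv (deriv g) s - 1 / (1 - s + of_real \<kappa>) - 1 / (1 - s - of_real \<kappa>)) (at s)"
      unfolding D_def using nr[of s] s holomorphic_derivI[OF dgh og s']
      by (auto intro!: derivative_eq_intros simp: divide_inverse)
    then have "deriv (deriv g) s = deriv D s + 1 / (1 - s + of_real \<kappa>) + 1 / (1 - s - of_real \<kappa>)"
      by (simp add: DERIV_imp_deriv)
    also have "norm \<dots> \<le> norm (deriv D s) + norm (1 / (1 - s + of_real \<kappa>)) + norm (1 / (1 - s - of_real \<kappa>))"
      by (intro order_trans[OF norm_triangle_ineq] add_mono order_refl)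
    also have "\<dots> \<le> C + 1 + 1"
    proof (intro add_mono nD)
      have "norm (1 - s + of_real \<kappa>) \<ge> 1" "norm (1 - s - of_real \<kappa>) \<ge> 1"
        using s A0 complex_Re_le_cmod[of "1 - s + of_real \<kappa>"] complex_Re_le_cmod[of "1 - s - of_real \<kappa>"] by auto
      then show "norm (1 / (1 - s + of_real \<kappa>)) \<le> 1" "norm (1 / (1 - s - of_real \<kappa>)) \<le> 1"
        unfolding norm_divide by (auto simp: divide_le_eq)
    qed
    finally show ?thesis by simp
  qed
  have "\<exists>A E. A \<ge> A0 + 1 \<and> E holomorphic_on {s. Re s < - A} \<and>
     (\<forall>s. Re s < - A \<longrightarrow> (deriv ^^ m) Lfun s = exp (g s) * deriv g s ^ m * (sin (of_real pi * (s + of_real \<kappa>)) + E s)) \<and>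
     (\<forall>\<eta>>0. \<exists>A'\<ge>A. \<forall>s. Re s < - A' \<longrightarrow> norm (E s) \<le> \<eta> * exp (pi * \<bar>Im s\<bar>))"
    by (rule higher_deriv_exp_sin[OF Lfun_holomorphic, where C = "C + 2"])
       (use Lg big d2 in \<open>auto intro: holomorphic_on_subset[OF g]\<close>)
  then obtain A1 E where A1: "A1 \<ge> A0 + 1" and E1: "E holomorphic_on {s. Re s < - A1}"
    and FE1: "\<And>s. Re s < - A1 \<Longrightarrow> F s = exp (g s) * deriv g s ^ m * (sin (of_real pi * (s + of_real \<kappa>)) + E s)"
    and small: "\<And>\<eta>. \<eta> > 0 \<Longrightarrow> \<exists>A'\<ge>A1. \<forall>s. Re s < - A' \<longrightarrow> norm (E s) \<le> \<eta> * exp (pi * \<bar>Im s\<bar>)"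
    unfolding F_def by metis
  obtain A2 where A2: "A2 \<ge> A1" "\<And>s. Re s < - A2 \<Longrightarrow> norm (E s) \<le> 1/100 * exp (pi * \<bar>Im s\<bar>)" using small[of "1/100"] by auto
  obtain A3 where A3: "A3 \<ge> A0 + 1" "\<And>s. Re s < - A3 \<Longrightarrow> Re (deriv g s) \<le> - 1" using big[of 1] by blast
  define A where "A = max A2 A3"
  let ?U = "{s. Re s < - A}"
  have oU: "open ?U" by (rule open_left_half_plane)
  have AU: "A \<ge> A0 + 1" "A \<ge> A1" "A \<ge> A2" "A \<ge> A3" using A1 A2 A3 by (auto simp: A_def)
  have E: "E holomorphic_on ?U" by (rule holomorphic_on_subset[OF E1]) (use AU in auto)
  have gU: "g holomorphic_on ?U" by (rule holomorphic_on_subset[OF g]) (use AU in auto)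
  have lU: "deriv g holomorphic_on ?U" using gU oU by (rule holomorphic_deriv)
  have FE: "F s = exp (g s) * deriv g s ^ m * (sin (of_real pi * (s + of_real \<kappa>)) + E s)" if "s \<in> ?U" for s
    using that AU by (intro FE1) auto
  have nE: "norm (E s) \<le> exp (pi * \<bar>Im s\<bar>) / 100" if "s \<in> ?U" for s using A2(2)[of s] that AU by auto
  have lneg: "Re (- deriv g s) \<ge> 1" if "s \<in> ?U" for s using A3(2)[of s] that AU by auto
  have ndE: "norm (deriv E s) \<le> exp (pi * (\<bar>Im s\<bar> + 1)) / 100" if s: "Re s < - A - 1" for s
  proof -
    have "norm ((deriv ^^ 1) E s) \<le> fact 1 * (exp (pi * (\<bar>Im s\<bar> + 1)) / 100)"
    proof (rule higher_deriv_norm_le[OF E])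
      show sub: "cball s 1 \<subseteq> ?U" using s by (intro cball_subset_left) simp
      fix w assume w: "norm (s - w) = 1"
      then have "w \<in> cball s 1" by (simp add: dist_norm)
      then have "w \<in> ?U" using sub by auto
      then have "norm (E w) \<le> exp (pi * \<bar>Im w\<bar>) / 100" by (rule nE)
      also have "\<dots> \<le> exp (pi * (\<bar>Im s\<bar> + 1)) / 100"
      proof -
        have "\<bar>Im w\<bar> \<le> \<bar>Im s\<bar> + 1" using w abs_Im_le_cmod[of "s - w"] by simp
        then show ?thesis by simp
      qed
      finally show "norm (E w) \<le> exp (pi * (\<bar>Im s\<bar> + 1)) / 100" .
    qed
    then show ?thesis by simp
  qed
  \<comment> \<open>Beyond - A - 1, where \<open>ndE\<close> holds, so that the line and everything
    to its left admit the derivative bound.\<close>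
  define \<alpha> where "\<alpha> = - A - 2"
  have zf_left: "F s \<noteq> 0" if s: "Re s \<le> \<alpha>" "Im s > 0" for s
  proof
    assume F0: "F s = 0"
    have sU: "s \<in> ?U" "cnj s \<in> ?U" using s by (auto simp: \<alpha>_def)
    have nz: "exp (g w) * deriv g w ^ m \<noteq> 0" if "w \<in> ?U" for w using lneg[OF that] by auto
    have z1: "sin (of_real pi * (s + of_real \<kappa>)) + E s = 0" using F0 FE[OF sU(1)] nz[OF sU(1)] by (metis mult_eq_0_iff)
    have "F (cnj s) = 0" using F0 by (simp add: Fcnj)
    then have z2: "sin (of_real pi * (cnj s + of_real \<kappa>)) + E (cnj s) = 0" using FE[OF sU(2)] nz[OF sU(2)] by (metis mult_eq_0_iff)
    show False
    proof (rule sin_perturbed_no_conjugate_zeros[OF E oU _ _ _ s(2) z1 z2])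
      show "Complex (Re s) v \<in> ?U" for v using s by (simp add: \<alpha>_def)
      show "norm (E s) \<le> exp (pi * Im s) / 100" using nE[OF sU(1)] s by simp
      show "norm (deriv E (Complex (Re s) v)) \<le> exp (pi * (\<bar>v\<bar> + 1)) / 100" for v
        using ndE[of "Complex (Re s) v"] s by (simp add: \<alpha>_def)
    qed
  qed
  obtain c \<beta>0 where c: "c \<noteq> 0" "\<And>s. Re s \<ge> \<beta>0 \<Longrightarrow> norm (F s * exp (of_real (mu m) * s) / c - 1) \<le> 1/2"
    using Lfun_deriv_right[of m] unfolding F_def by metis
  \<comment> \<open>To the right of both the zero-free abscissa and \<alpha>, each with a unit to
    spare.\<close>
  define \<beta> where "\<beta> = max (\<beta>0 + 1) (\<alpha> + 1)"
  have ab: "\<alpha> < \<beta>" by (simp add: \<beta>_def)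
  have zf_right: "F s \<noteq> 0" if "Re s \<ge> \<beta>0" for s using Re_pos_of_near_1[OF c(2)[OF that]] by auto
  have zf: "\<alpha> < Re s \<and> Re s < \<beta>" if "F s = 0" "Im s > 0" for s
    using zf_left[of s] zf_right[of s] that by (auto simp: \<beta>_def not_le[symmetric])
  obtain C' n where gr: "\<And>s. \<bar>Re s - \<beta>\<bar> \<le> 8 * (\<beta> - \<alpha>) \<Longrightarrow> Im s \<ge> 2 \<Longrightarrow> norm (F s) \<le> C' * Im s ^ n"
    using Lfun_deriv_growth[where \<beta> = \<beta> and R = "8 * (\<beta> - \<alpha>)" and m = m] unfolding F_def by metis
  define u where "u = (\<lambda>s. of_real pi * (s + of_real \<kappa>) :: complex)"
  \<comment> \<open>Since - 2 i exp (i u) sin u = 1 - exp (2 i u), this is close to 1 once Im s > 1,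
    and its principal logarithm exists.\<close>
  define W where "W = (\<lambda>s. - 2 * \<i> * exp (\<i> * u s) * (sin (u s) + E s))"
  \<comment> \<open>A logarithm of F up to the constant \<open>K\<close>. Re (- deriv g) >= 1 admits
    the principal branch, and - i \<pi> s has imaginary part - \<pi> Re s, constant on a vertical
    line.\<close>
  define Q where "Q = (\<lambda>s. g s + of_nat m * Ln (- deriv g s) + (- \<i> * of_real pi * s) + Ln (W s))"
  define K where "K = (- 1) ^ m * (exp (- \<i> * of_real pi * of_real \<kappa>) / (- 2 * \<i>))"
  let ?V = "{s. Re s < - A} \<inter> {s. Im s > 1}"
  have oV: "open ?V" by (intro open_Int open_left_half_plane open_halfspace_Im_gt)
  have W1: "norm (W s - 1) \<le> 1/2" if s: "s \<in> ?V" for s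
  proof -
    have Imu: "Im (u s) = pi * Im s" by (simp add: u_def)
    have e: "exp (\<i> * u s) * exp (- (\<i> * u s)) = 1" by (simp add: exp_minus)
    have "W s - 1 = - (exp (\<i> * u s) * exp (\<i> * u s)) - 2 * \<i> * exp (\<i> * u s) * E s"
    proof -
      have "- 2 * \<i> * exp (\<i> * u s) * sin (u s) = exp (\<i> * u s) * exp (- (\<i> * u s)) - exp (\<i> * u s) * exp (\<i> * u s)"
        by (simp add: sin_exp_eq field_simps)
      then show ?thesis unfolding W_def e by (simp add: algebra_simps)
    qed
    also have "norm \<dots> \<le> norm (exp (\<i> * u s) * exp (\<i> * u s)) + norm (2 * \<i> * exp (\<i> * u s) * E s)"
      using norm_triangle_ineq4[of "- (exp (\<i> * u s) * exp (\<i> * u s))" "2 * \<i> * exp (\<i> * u s) * E s"] by (simp only: norm_minus_cancel)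
    also have "norm (exp (\<i> * u s) * exp (\<i> * u s)) \<le> 1 / 4 * 1"
    proof -
      have "pi * Im s \<ge> 3 * 1" using s pi_gt3 by (intro mult_mono) auto
      then have "exp (pi * Im s) \<ge> 4" using exp_ge_add_one_self[of "pi * Im s"] by linarith
      then have "exp (- (pi * Im s)) \<le> 1 / 4" unfolding exp_minus inverse_eq_divide by (intro divide_left_mono) auto
      moreover have "exp (- (pi * Im s)) \<le> 1" using s by simp
      ultimately show ?thesis unfolding norm_mult norm_exp_eq_Re using Imu by (intro mult_mono) auto
    qed
    also have "norm (2 * \<i> * exp (\<i> * u s) * E s) \<le> 2 * (exp (- (pi * Im s)) * (exp (pi * Im s) / 100))"
      using nE[of s] s Imu by (auto simp: norm_mult intro!: mult_left_mono)
    also have "\<dots> = 1 / 50" by (simp add: exp_minus)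
    finally show ?thesis by simp
  qed
  have Wnr: "W s \<notin> \<real>\<^sub>\<le>\<^sub>0" if "s \<in> ?V" for s using Re_pos_of_near_1[OF W1[OF that]] by (auto simp: complex_nonpos_Reals_iff)
  have lnr: "- deriv g s \<notin> \<real>\<^sub>\<le>\<^sub>0" if "s \<in> ?U" for s using lneg[OF that] by (auto simp: complex_nonpos_Reals_iff)
  have VU: "?V \<subseteq> ?U" by auto
  have Qhol: "Q holomorphic_on ?V"
  proof -
    have "W holomorphic_on ?V" unfolding W_def u_def by (intro holomorphic_intros holomorphic_on_subset[OF E VU])
    then show ?thesis unfolding Q_def using Wnr lnr VU
      by (intro holomorphic_intros holomorphic_on_subset[OF gU VU] holomorphic_on_subset[OF lU VU]) auto
  qed
  have K0: "K \<noteq> 0" by (simp add: K_def)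
  have FQ: "F s = K * exp (Q s)" if s: "s \<in> ?V" for s
  proof -
    have sU: "s \<in> ?U" using s by auto
    have l0: "- deriv g s \<noteq> 0" using lneg[OF sU] by auto
    have W0: "W s \<noteq> 0" using Re_pos_of_near_1[OF W1[OF s]] by auto
    have e1: "exp (of_nat m * Ln (- deriv g s)) = (- deriv g s) ^ m" using l0 by (simp add: exp_of_nat_mult)
    have e2: "exp (- \<i> * of_real pi * of_real \<kappa>) * exp (- \<i> * of_real pi * s) * exp (\<i> * u s) = 1"
      unfolding exp_add[symmetric] by (simp add: u_def algebra_simps)
    have "K * exp (Q s) = (- 1) ^ m * (- deriv g s) ^ m * exp (g s) * (exp (- \<i> * of_real pi * of_real \<kappa>) * exp (- \<i> * of_real pi * s) * (W s / (- 2 * \<i>)))"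
      unfolding Q_def exp_add e1 exp_Ln[OF W0] K_def by (simp add: mult_ac)
    also have "W s / (- 2 * \<i>) = exp (\<i> * u s) * (sin (u s) + E s)" by (simp add: W_def)
    also have "exp (- \<i> * of_real pi * of_real \<kappa>) * exp (- \<i> * of_real pi * s) * (exp (\<i> * u s) * (sin (u s) + E s)) = sin (u s) + E s"
      unfolding mult.assoc[symmetric] e2 by simp
    also have "(- 1) ^ m * (- deriv g s) ^ m = deriv g s ^ m" by (simp flip: power_mult_distrib)
    finally show ?thesis using FE[OF sU] by (simp add: u_def mult_ac)
  qed
  define P where "P = (\<lambda>s. - of_real (mu m) * s + Ln (F s * exp (of_real (mu m) * s) / c))"
  let ?R = "{s. Re s > \<beta>0}"
  have oR: "open ?R" by (rule open_halfspace_Re_gt)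
  have Pnr: "F s * exp (of_real (mu m) * s) / c \<notin> \<real>\<^sub>\<le>\<^sub>0" if "Re s \<ge> \<beta>0" for s
    using Re_pos_of_near_1[OF c(2)[OF that]] by (auto simp: complex_nonpos_Reals_iff)
  have Phol: "P holomorphic_on ?R"
    unfolding P_def using Pnr c by (intro holomorphic_intros holomorphic_on_subset[OF F]) auto
  have FP: "F s = c * exp (P s)" if "s \<in> ?R" for s
  proof -
    have "F s * exp (of_real (mu m) * s) / c \<noteq> 0" using zf_right[of s] that c by auto
    then have "exp (P s) = exp (- of_real (mu m) * s) * (F s * exp (of_real (mu m) * s) / c)"
      unfolding P_def exp_add by (simp only: exp_Ln simp_thms)
    then show ?thesis using c by (simp add: exp_minus)
  qed
  define q where "q = (\<lambda>t::real. 2 * t * ln (2 * pi) - 2 * (t * ln t - t))"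
  define p where "p = (\<lambda>t::real. - mu m * t)"
  have "(\<lambda>T. zero_count F T - (p T - q T) / (2 * pi)) \<in> O[at_top](\<lambda>T. ln T)"
  proof (rule zero_count_asymp[OF F ab _ zf, where Q = Q and P = P and C = C' and n = n and ?t0.0 = 2 and c = "norm c * exp (- mu m * \<beta>) / 2"])
    show "(Q has_field_derivative deriv F (Complex \<alpha> t) / F (Complex \<alpha> t)) (at (Complex \<alpha> t))" if "t \<ge> 2" for t
      by (rule has_field_derivative_log_primitive[OF oV _ K0 FQ Qhol]) (use that in \<open>auto simp: \<alpha>_def\<close>)
    show "(P has_field_derivative deriv F (Complex \<beta> t) / F (Complex \<beta> t)) (at (Complex \<beta> t))" for t
      by (rule has_field_derivative_log_primitive[OF oR _ c(1) FP Phol]) (auto simp: \<beta>_def)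
    show "norm (F s) \<le> C' * Im s ^ n" if "2 \<le> Im s" "\<bar>Re s - \<beta>\<bar> \<le> 8 * (\<beta> - \<alpha>)" for s using gr that by blast
    show "norm c * exp (- mu m * \<beta>) / 2 \<le> norm (F (Complex \<beta> t))" for t
    proof -
      define s where "s = Complex \<beta> t"
      have "Re s \<ge> \<beta>0" by (simp add: s_def \<beta>_def)
      from Re_pos_of_near_1[OF c(2)[OF this]] have "1/2 \<le> norm (F s * exp (of_real (mu m) * s) / c)"
        using complex_Re_le_cmod[of "F s * exp (of_real (mu m) * s) / c"] by linarith
      also have "\<dots> = norm (F s) * exp (mu m * \<beta>) / norm c" by (simp add: norm_mult norm_divide s_def)
      finally show ?thesis using c by (simp add: s_def exp_minus field_simps)
    qed
    show "0 < norm c * exp (- mu m * \<beta>) / 2" using c by simp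
    show "(\<lambda>t. Im (Q (Complex \<alpha> t)) - q t) \<in> O[at_top](\<lambda>t. ln t)"
    proof -
      \<comment> \<open>Everything in arg F except Im g; each summand is bounded on the
        line.\<close>
      define h where "h = (\<lambda>t. real m * Im (Ln (- deriv g (Complex \<alpha> t))) - pi * \<alpha> + Im (Ln (W (Complex \<alpha> t))))"
      have "h \<in> O[at_top](\<lambda>t. ln t)"
      proof (rule bounded_imp_bigo_ln)
        fix t :: real assume t: "t \<ge> 2"
        define s where "s = Complex \<alpha> t"
        have sV: "s \<in> ?V" using t by (simp add: s_def \<alpha>_def)
        have l0: "- deriv g s \<noteq> 0" and W0: "W s \<noteq> 0" using lneg[of s] Re_pos_of_near_1[OF W1[OF sV]] sV by auto
        have 1: "\<bar>Im (Ln (- deriv g s))\<bar> \<le> pi" "\<bar>Im (Ln (W s))\<bar> \<le> pi"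
          using mpi_less_Im_Ln[OF l0] Im_Ln_le_pi[OF l0] mpi_less_Im_Ln[OF W0] Im_Ln_le_pi[OF W0] by (auto simp: abs_le_iff)
        have "\<bar>real m * Im (Ln (- deriv g s))\<bar> \<le> real m * pi" unfolding abs_mult using 1 by (intro mult_mono) auto
        then show "\<bar>h t\<bar> \<le> real m * pi + \<bar>pi * \<alpha>\<bar> + pi" unfolding h_def s_def[symmetric] using 1 by linarith
      qed
      moreover have "(\<lambda>t. Im (g (Complex \<alpha> t)) - q t) \<in> O[at_top](\<lambda>t. ln t)"
      proof -
        have "- (A + 2) = \<alpha>" by (simp add: \<alpha>_def)
        from Img[of "A + 2", unfolded this] show ?thesis using AU by (simp add: q_def)
      qed
      ultimately have "(\<lambda>t. (Im (g (Complex \<alpha> t)) - q t) + h t) \<in> O[at_top](\<lambda>t. ln t)" by (intro sum_in_bigo(1))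
      moreover have "(Im (g (Complex \<alpha> t)) - q t) + h t = Im (Q (Complex \<alpha> t)) - q t" for t
        by (simp add: Q_def h_def)
      ultimately show ?thesis by simp
    qed
    show "(\<lambda>t. Im (P (Complex \<beta> t)) - p t) \<in> O[at_top](\<lambda>t. ln t)"
    proof (rule bounded_imp_bigo_ln)
      fix t :: real
      define s where "s = Complex \<beta> t"
      have "Re s \<ge> \<beta>0" by (simp add: s_def \<beta>_def)
      then have nz: "F s * exp (of_real (mu m) * s) / c \<noteq> 0" using zf_right c by auto
      have "Im (P s) - p t = Im (Ln (F s * exp (of_real (mu m) * s) / c))" by (simp add: P_def p_def s_def)
      then show "\<bar>Im (P (Complex \<beta> t)) - p t\<bar> \<le> pi"
        unfolding s_def[symmetric] using mpi_less_Im_Ln[OF nz] Im_Ln_le_pi[OF nz] by (simp add: abs_le_iff)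
    qed
    show "isCont q t" if "t > 2" for t unfolding q_def using that by (intro continuous_intros) auto
    show "isCont p t" for t unfolding p_def by (intro continuous_intros)
  qed auto
  then show ?thesis by (simp add: F_def p_def q_def)
qed

end

theorem theorem2:
  fixes k :: int and f :: "complex \<Rightarrow> complex" and m :: nat
  assumes "cusp_form k f" and "normalized_hecke_eigenform k f" and "m \<ge> 1"
  shows "(\<lambda>T. zero_count ((deriv ^^ m) (cusp_L k f)) T
            - (T / pi * ln (T / (2 * pi * exp 1)) - T / (2 * pi) * ln (real (n_min k f))))
           \<in> O[at_top](\<lambda>T. ln T)
    \<and> (\<lambda>T. zero_count ((deriv ^^ m) (cusp_L k f)) T
            - (zero_count (cusp_L k f) T - T / (2 * pi) * ln (real (n_min k f))))
           \<in> O[at_top](\<lambda>T. ln T)"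
proof -
  obtain a where a: "has_q_expansion f a" using assms(1) by (auto simp: cusp_form_def modular_form_def)
  note fc = fourier_coeff_eqI[OF a]
  interpret hecke_eigenform k f a
  proof
    show "f holomorphic_on upper_half_plane" using assms(1) by (simp add: cusp_form_def modular_form_def)
    show "has_q_expansion f a" by (rule a)
    show "a 0 = 0" using assms(1) by (simp add: cusp_form_def fc)
    show "a 1 = 1" using assms(2) by (simp add: normalized_hecke_eigenform_def fc)
    show "f (mob \<gamma> z) = jfac \<gamma> z powi k * f z" if "mdet \<gamma> = 1" "Im z > 0" for \<gamma> z
      using assms(1) that by (cases \<gamma> rule: mdet.cases) (auto simp: cusp_form_def modular_form_def upper_half_plane_def)
    show "\<exists>c. \<forall>z. Im z > 0 \<longrightarrow> hecke_operator k n f z = c * f z" if "n \<ge> 1" for n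
      using assms(2) that by (auto simp: normalized_hecke_eigenform_def upper_half_plane_def)
  qed
  have hl: "hecke_lambda k f = lam"
    unfolding fun_eq_iff hecke_lambda_def lam_def \<kappa>_def fc by simp
  have mu: "mu m = ln (real (n_min k f))" "mu 0 = 0"
    using assms(3) by (simp_all add: mu_def nmin_def n_min_def hl)
  \<comment> \<open>The main term as a function of the frequency \<mu>, to be used with ln n_f and
    with 0.\<close>
  define M where "M = (\<lambda>\<mu> T. (- \<mu> * T - (2 * T * ln (2 * pi) - 2 * (T * ln T - T))) / (2 * pi))"
  have M: "M \<mu> T = T / pi * ln (T / (2 * pi * exp 1)) - T / (2 * pi) * \<mu>" if "T > 0" for \<mu> T
  proof -
    have ln: "ln (T / (2 * pi * exp 1)) = ln T - ln (2 * pi) - 1" using that by (simp add: ln_div ln_mult)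
    show ?thesis unfolding M_def ln by (simp add: field_simps)
  qed
  have Z: "(\<lambda>T. zero_count ((deriv ^^ j) (cusp_L k f)) T - M (mu j) T) \<in> O[at_top](\<lambda>T. ln T)" for j
    using zero_count_Lfun_deriv[of j] by (simp only: M_def cusp_L_eq)
  show ?thesis
  proof
    show "(\<lambda>T. zero_count ((deriv ^^ m) (cusp_L k f)) T
            - (T / pi * ln (T / (2 * pi * exp 1)) - T / (2 * pi) * ln (real (n_min k f)))) \<in> O[at_top](\<lambda>T. ln T)"
      by (rule landau_o.big.in_cong[THEN iffD1, OF _ Z[of m]], use eventually_gt_at_top[of "0::real"] in eventually_elim)
        (simp add: M mu)
    \<comment> \<open>The asymptotics for m and for 0 are subtracted.\<close>
    show "(\<lambda>T. zero_count ((deriv ^^ m) (cusp_L k f)) T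
            - (zero_count (cusp_L k f) T - T / (2 * pi) * ln (real (n_min k f)))) \<in> O[at_top](\<lambda>T. ln T)"
      by (rule landau_o.big.in_cong[THEN iffD1, OF _ sum_in_bigo(2)[OF Z[of m] Z[of 0]]], use eventually_gt_at_top[of "0::real"] in eventually_elim)
        (simp add: M mu)
  qed
qed

end
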